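(* Let $\mathcal L'$ and $\mathcal L''$ be bounded complexes of vector bundles on an affine manifold $U$, and let $f\colon\mathcal L'\to\mathcal L''$ be a quasi-isomorphism. Given an $L_\infty$ algebroid structure on $\mathcal L''$, there exists an $L_\infty$ algebroid structure on $\mathcal L'$ and an extension of $f$ to an $L_\infty$ quasi-isomorphism.
   Context: An affine manifold $U$ is a real $C^\infty$ manifold ($\mathbb K=\mathbb R$), a Stein manifold ($\mathbb K=\mathbb C$), or a smooth affine variety over a field $\mathbb K$ of characteristic zero. Vector bundles on $U$ (of finite rank) are identified with finite rank projective $\mathcal O(U)$-modules of sections; $\mathcal T_U$ is the tangent bundle. Complexes underlying $L_\infty$ algebroids are bounded complexes of finite rank vector bundles $\mathcal L=(\cdots\to\mathcal L_2\to\mathcal L_1\to\mathcal L_0)$ with $\mathcal L_i$ in degree $-i$. An $L_\infty$ algebroid structure on $\mathcal L$ is an $L_\infty$ algebra structure over $\mathbb K$ on $\mathcal L$ whose unary bracket is the given differential $\delta$, whose binary bracket is $\mathbb K$-bilinear of degree $0$ and whose $n$-ary brackets for $n>2$ are $\mathcal O(U)$-multilinear of degree $2-n$, together with an $\mathcal O(U)$-linear morphism of complexes $a\colon\mathcal L\to\mathcal T_U$ (the anchor) satisfying $[x,fy]=(\mathscr L_{ax}f)y+f[x,y]$ for $x,y\in\mathcal L$, $f\in\mathcal O(U)$. Equivalently it is the differential on $\mathcal O([U/\mathcal L])=\mathrm{Sym}_{\mathcal O(U)}(\mathcal L^\vee[-1])$ given by the Chevalley–Eilenberg differential of $\mathcal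 L$ with coefficients in $\mathcal O(U)$ restricted to $\mathcal O(U)$-multilinear cochains. An $L_\infty$ morphism $\mathcal M\to\mathcal L$ of $L_\infty$ algebroids on $U$ is a cdga morphism $\mathcal O([U/\mathcal L])\to\mathcal O([U/\mathcal M])$ that acts as the identity on $\mathcal O(U)$; equivalently, a sequence of $\mathcal O(U)$-multilinear graded skew-symmetric maps $f_n\colon\mathcal M^{\times n}\to\mathcal L$ of degree $1-n$ ($n\ge1$) forming a morphism of $\mathbb K$-linear $L_\infty$ algebras, with $f_1$ a morphism of complexes of vector bundles compatible with the anchors. It is an $L_\infty$ quasi-isomorphism if $f_1$ is a quasi-isomorphism. An extension of a chain map $f$ is an $L_\infty$ morphism with $f_1=f$. *)

theory Defs
  imports "HOL-Analysis.Analysis" "HOL-Library.Function_Algebras" "HOL-Library.Poly_Mapping"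
    "HOL-Library.FuncSet"
begin

section \<open>Affine manifolds\<close>

text \<open>
  An affine manifold \<open>U\<close> over \<open>\<K>\<close> enters through its \<open>\<K>\<close>-algebra \<open>\<O>(U)\<close> of functions: a
  commutative ring \<open>'r\<close> with structure map \<open>\<eta> :: 'k \<Rightarrow> 'r\<close> that is the algebra of functions of a
  smooth manifold, of a Stein manifold, or of a smooth affine variety. As \<open>0 \<noteq> 1\<close> in
  \<open>'r\<close>, the empty manifold is excluded.
\<close>

definition algebra_map :: "('k::field \<Rightarrow> 'r::comm_ring_1) \<Rightarrow> bool" where
  "algebra_map \<eta> \<longleftrightarrow> \<eta> 1 = 1 \<and> (\<forall>a b. \<eta> (a + b) = \<eta> a + \<eta> b) \<and> (\<forall>a b. \<eta> (a * b) = \<eta> a * \<eta> b)"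

subsection \<open>Real and complex manifolds\<close>

text \<open>
  Coordinate space of dimension \<open>n \<ge> 0\<close>: the points are the functions on \<open>{..<n}\<close>
  (extended by \<open>undefined\<close>).
\<close>

definition coord_space :: "nat \<Rightarrow> (nat \<Rightarrow> 'c::real_normed_field) topology" where
  "coord_space n = product_topology (\<lambda>_. euclidean) {..<n}"

text \<open>
  Functions on an open subset \<open>W\<close> of coordinate space all of whose iterated partial derivatives of
  order at most \<open>k\<close> exist and are continuous. Derivatives are taken over the field \<open>'c\<close>, so for
  \<open>'c = complex\<close> a smooth function is the same thing as a holomorphic function.
\<close>

primrec Ck_on :: "nat \<Rightarrow> nat \<Rightarrow> (nat \<Rightarrow> 'c::real_normed_field) set \<Rightarrow> ((nat \<Rightarrow> 'c) \<Rightarrow> 'c) \<Rightarrow> bool" where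
  "Ck_on 0 n W g \<longleftrightarrow> continuous_map (subtopology (coord_space n) W) euclidean g"
| "Ck_on (Suc k) n W g \<longleftrightarrow> continuous_map (subtopology (coord_space n) W) euclidean g \<and>
     (\<forall>i<n. \<exists>g'. (\<forall>x\<in>W. ((\<lambda>t. g (x(i := t))) has_field_derivative g' x) (at (x i))) \<and>
                 Ck_on k n W g')"

definition smooth_on :: "nat \<Rightarrow> (nat \<Rightarrow> 'c::real_normed_field) set \<Rightarrow> ((nat \<Rightarrow> 'c) \<Rightarrow> 'c) \<Rightarrow> bool" where
  "smooth_on n W g \<longleftrightarrow> (\<forall>k. Ck_on k n W g)"

definition manifold ::
  "'p topology \<Rightarrow> nat \<Rightarrow> ('p set \<times> ('p \<Rightarrow> nat \<Rightarrow> 'c::real_normed_field)) set \<Rightarrow> bool" where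
  "manifold X n \<A> \<longleftrightarrow>
     Hausdorff_space X \<and> second_countable X \<and> (\<Union>(V, \<phi>)\<in>\<A>. V) = topspace X \<and>
     (\<forall>(V, \<phi>)\<in>\<A>. openin X V \<and>
        (\<exists>W. openin (coord_space n) W \<and>
             homeomorphic_map (subtopology X V) (subtopology (coord_space n) W) \<phi>)) \<and>
     (\<forall>(V, \<phi>)\<in>\<A>. \<forall>(V', \<phi>')\<in>\<A>. \<forall>i<n.
        smooth_on n (\<phi> ` (V \<inter> V')) (\<lambda>x. \<phi>' (the_inv_into V \<phi> x) i))"

definition functions_on ::
  "'p topology \<Rightarrow> nat \<Rightarrow> ('p set \<times> ('p \<Rightarrow> nat \<Rightarrow> 'c::real_normed_field)) set \<Rightarrow> ('p \<Rightarrow> 'c) set" where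
  "functions_on X n \<A> =
     {h \<in> extensional (topspace X). \<forall>(V, \<phi>)\<in>\<A>. smooth_on n (\<phi> ` V) (\<lambda>x. h (the_inv_into V \<phi> x))}"

text \<open>
  \<open>\<eta>\<close> is the algebra of functions of the given manifold: \<open>\<sigma>\<close> identifies the ground field with
  \<open>'c\<close> (the real or the complex numbers) and \<open>\<Phi>\<close> identifies \<open>'r\<close> with the functions, compatibly.
\<close>

definition is_function_algebra ::
  "'p topology \<Rightarrow> nat \<Rightarrow> ('p set \<times> ('p \<Rightarrow> nat \<Rightarrow> 'c::real_normed_field)) set \<Rightarrow>
   ('k::field \<Rightarrow> 'r::comm_ring_1) \<Rightarrow> bool" where
  "is_function_algebra X n \<A> \<eta> \<longleftrightarrow>
     (\<exists>(\<sigma> :: 'k \<Rightarrow> 'c) (\<Phi> :: 'r \<Rightarrow> 'p \<Rightarrow> 'c).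
        bij \<sigma> \<and> algebra_map \<sigma> \<and> bij_betw \<Phi> UNIV (functions_on X n \<A>) \<and>
        (\<forall>p\<in>topspace X.
           (\<forall>f g. \<Phi> (f + g) p = \<Phi> f p + \<Phi> g p) \<and>
           (\<forall>f g. \<Phi> (f * g) p = \<Phi> f p * \<Phi> g p) \<and>
           (\<forall>c. \<Phi> (\<eta> c) p = \<sigma> c)))"

text \<open>A Stein manifold is a holomorphically convex and holomorphically separable complex manifold.\<close>

definition stein_manifold ::
  "'p topology \<Rightarrow> nat \<Rightarrow> ('p set \<times> ('p \<Rightarrow> nat \<Rightarrow> complex)) set \<Rightarrow> bool" where
  "stein_manifold X n \<A> \<longleftrightarrow>
     manifold X n \<A> \<and>
     (\<forall>K. compactin X K \<longrightarrow>
        compactin X {p \<in> topspace X. \<forall>h\<in>functions_on X n \<A>. \<forall>b.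
                       (\<forall>q\<in>K. cmod (h q) \<le> b) \<longrightarrow> cmod (h p) \<le> b}) \<and>
     (\<forall>p\<in>topspace X. \<forall>q\<in>topspace X. p \<noteq> q \<longrightarrow> (\<exists>h\<in>functions_on X n \<A>. h p \<noteq> h q))"

subsection \<open>Smooth affine varieties\<close>

text \<open>
  The monoid algebra of the finitely supported exponents is the polynomial ring in the variables
  \<open>x\<^sub>i\<close> for all natural numbers \<open>i\<close>; \<open>polys_in n\<close> is its subring \<open>\<K>[x\<^sub>0,\<dots>,x\<^sub>n\<^sub>-\<^sub>1]\<close>.
\<close>

type_synonym 'k mpoly = "(nat \<Rightarrow>\<^sub>0 nat) \<Rightarrow>\<^sub>0 'k"

definition polys_in :: "nat \<Rightarrow> 'k::field mpoly set" where
  "polys_in n = {p. \<forall>m\<in>Poly_Mapping.keys p. Poly_Mapping.keys m \<subseteq> {..<n}}"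

definition eval_poly :: "('k::field \<Rightarrow> 'r::comm_ring_1) \<Rightarrow> (nat \<Rightarrow> 'r) \<Rightarrow> 'k mpoly \<Rightarrow> 'r" where
  "eval_poly \<eta> x p =
     (\<Sum>m\<in>Poly_Mapping.keys p. \<eta> (Poly_Mapping.lookup p m) *
        (\<Prod>i\<in>Poly_Mapping.keys m. x i ^ Poly_Mapping.lookup m i))"

definition partial_deriv :: "nat \<Rightarrow> 'k::field mpoly \<Rightarrow> 'k mpoly" where
  "partial_deriv i p =
     (\<Sum>m\<in>Poly_Mapping.keys p.
        Poly_Mapping.single (m - Poly_Mapping.single i 1)
          (of_nat (Poly_Mapping.lookup m i) * Poly_Mapping.lookup p m))"

definition prime_ideal :: "'r::comm_ring_1 set \<Rightarrow> bool" where
  "prime_ideal \<pp> \<longleftrightarrow>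
     0 \<in> \<pp> \<and> (\<forall>a\<in>\<pp>. \<forall>b\<in>\<pp>. a + b \<in> \<pp>) \<and> (\<forall>a. \<forall>b\<in>\<pp>. a * b \<in> \<pp>) \<and>
     1 \<notin> \<pp> \<and> (\<forall>a b. a * b \<in> \<pp> \<longrightarrow> a \<in> \<pp> \<or> b \<in> \<pp>)"

text \<open>
  The spectrum of a finitely generated algebra \<open>\<K>[x\<^sub>0,\<dots>,x\<^sub>n\<^sub>-\<^sub>1]/I\<close> is a smooth variety if (Jacobian
  criterion) at every point \<open>\<pp>\<close> the ideal \<open>I\<close> is locally generated by elements
  \<open>g\<^sub>0,\<dots>,g\<^sub>c\<^sub>-\<^sub>1\<close> whose differentials are linearly independent over the residue field of \<open>\<pp>\<close>.
\<close>

definition smooth_affine_variety :: "('k::field \<Rightarrow> 'r::comm_ring_1) \<Rightarrow> bool" where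
  "smooth_affine_variety \<eta> \<longleftrightarrow>
     (\<exists>n x. eval_poly \<eta> x ` polys_in n = UNIV \<and>
        (let I = {p \<in> polys_in n. eval_poly \<eta> x p = 0} in
         \<forall>\<pp>. prime_ideal \<pp> \<longrightarrow>
           (\<exists>(c :: nat) g. (\<forall>j<c. g j \<in> I) \<and>
              (\<forall>h\<in>I. \<exists>u\<in>polys_in n. eval_poly \<eta> x u \<notin> \<pp> \<and>
                 (\<exists>b. (\<forall>j<c. b j \<in> polys_in n) \<and> u * h = (\<Sum>j<c. b j * g j))) \<and>
              (\<forall>a. (\<forall>i<n. (\<Sum>j<c. a j * eval_poly \<eta> x (partial_deriv i (g j))) \<in> \<pp>) \<longrightarrow>
                   (\<forall>j<c. a j \<in> \<pp>)))))"

definition affine_manifold :: "'p itself \<Rightarrow> ('k::field_char_0 \<Rightarrow> 'r::comm_ring_1) \<Rightarrow> bool" where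
  "affine_manifold (_ :: 'p itself) \<eta> \<longleftrightarrow> algebra_map \<eta> \<and>
     ((\<exists>(X :: 'p topology) n (\<A> :: ('p set \<times> ('p \<Rightarrow> nat \<Rightarrow> real)) set).
         manifold X n \<A> \<and> is_function_algebra X n \<A> \<eta>) \<or>
      (\<exists>(X :: 'p topology) n (\<A> :: ('p set \<times> ('p \<Rightarrow> nat \<Rightarrow> complex)) set).
         stein_manifold X n \<A> \<and> is_function_algebra X n \<A> \<eta>) \<or>
      smooth_affine_variety \<eta>)"

section \<open>Complexes of vector bundles\<close>

text \<open>
  A complex of \<open>\<O>(U)\<close>-modules, graded cohomologically by the integers. The components are
  submodules \<open>component \<L> d\<close> of one ambient module \<open>'m\<close>. They are not required to be
  independent, so a homogeneous element is always given together with its degree \<open>d\<close>.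
\<close>

record ('r, 'm) module_complex =
  scl :: "'r \<Rightarrow> 'm \<Rightarrow> 'm"
  component :: "int \<Rightarrow> 'm set"
  differential :: "int \<Rightarrow> 'm \<Rightarrow> 'm"

definition linear_on ::
  "('r \<Rightarrow> 'm::ab_group_add \<Rightarrow> 'm) \<Rightarrow> 'm set \<Rightarrow> ('r \<Rightarrow> 'n::ab_group_add \<Rightarrow> 'n) \<Rightarrow> 'n set \<Rightarrow>
   ('m \<Rightarrow> 'n) \<Rightarrow> bool" where
  "linear_on s P t Q h \<longleftrightarrow>
     (\<forall>x\<in>P. h x \<in> Q) \<and> (\<forall>x\<in>P. \<forall>y\<in>P. h (x + y) = h x + h y) \<and> (\<forall>r. \<forall>x\<in>P. h (s r x) = t r (h x))"

text \<open>Vector bundles of finite rank: direct summands of some free module of finite rank \<open>n\<close>.\<close>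

definition vector_bundle :: "('r::comm_ring_1 \<Rightarrow> 'm::ab_group_add \<Rightarrow> 'm) \<Rightarrow> 'm set \<Rightarrow> bool" where
  "vector_bundle s P \<longleftrightarrow> module.subspace s P \<and>
     (\<exists>n i p. let F = {v :: nat \<Rightarrow> 'r. \<forall>j\<ge>n. v j = 0}; t = (\<lambda>r v j. r * v j) in
        linear_on s P t F i \<and> linear_on t F s P p \<and> (\<forall>x\<in>P. p (i x) = x))"

definition bundle_complex :: "('r::comm_ring_1, 'm::ab_group_add) module_complex \<Rightarrow> bool" where
  "bundle_complex \<L> \<longleftrightarrow>
     module (scl \<L>) \<and>
     (\<forall>d. vector_bundle (scl \<L>) (component \<L> d)) \<and>
     (\<forall>d>0. component \<L> d = {0}) \<and> (\<exists>N. \<forall>d<N. component \<L> d = {0}) \<and>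
     (\<forall>d. linear_on (scl \<L>) (component \<L> d) (scl \<L>) (component \<L> (d + 1)) (differential \<L> d)) \<and>
     (\<forall>d. \<forall>x\<in>component \<L> d. differential \<L> (d + 1) (differential \<L> d x) = 0)"

definition chain_map ::
  "('r, 'm::ab_group_add) module_complex \<Rightarrow> ('r, 'n::ab_group_add) module_complex \<Rightarrow> (int \<Rightarrow> 'm \<Rightarrow> 'n) \<Rightarrow> bool" where
  "chain_map \<M> \<L> f \<longleftrightarrow>
     (\<forall>d. linear_on (scl \<M>) (component \<M> d) (scl \<L>) (component \<L> d) (f d)) \<and>
     (\<forall>d. \<forall>x\<in>component \<M> d. f (d + 1) (differential \<M> d x) = differential \<L> d (f d x))"

text \<open>A chain map inducing injective and surjective maps on all cohomology modules.\<close>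

definition quasi_isomorphism ::
  "('r, 'm::ab_group_add) module_complex \<Rightarrow> ('r, 'n::ab_group_add) module_complex \<Rightarrow> (int \<Rightarrow> 'm \<Rightarrow> 'n) \<Rightarrow> bool" where
  "quasi_isomorphism \<M> \<L> f \<longleftrightarrow> chain_map \<M> \<L> f \<and>
     (\<forall>d. \<forall>x\<in>component \<M> d. differential \<M> d x = 0 \<and> f d x \<in> differential \<L> (d - 1) ` component \<L> (d - 1) \<longrightarrow>
            x \<in> differential \<M> (d - 1) ` component \<M> (d - 1)) \<and>
     (\<forall>d. \<forall>y\<in>component \<L> d. differential \<L> d y = 0 \<longrightarrow>
            (\<exists>x\<in>component \<M> d. differential \<M> d x = 0 \<and> y - f d x \<in> differential \<L> (d - 1) ` component \<L> (d - 1)))"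

definition derivations :: "('k::field \<Rightarrow> 'r::comm_ring_1) \<Rightarrow> ('r \<Rightarrow> 'r) set" where
  "derivations \<eta> =
     {D. (\<forall>f g. D (f + g) = D f + D g) \<and> (\<forall>c f. D (\<eta> c * f) = \<eta> c * D f) \<and>
         (\<forall>f g. D (f * g) = f * D g + g * D f)}"

text \<open>
  The tangent bundle as a complex in degree \<open>0\<close>: a vector field is identified with its Lie
  derivative, a derivation of \<open>\<O>(U)\<close>.
\<close>

definition tangent_complex :: "('k::field \<Rightarrow> 'r::comm_ring_1) \<Rightarrow> ('r, 'r \<Rightarrow> 'r) module_complex" where
  "tangent_complex \<eta> =
     \<lparr>scl = (\<lambda>r D f. r * D f), component = (\<lambda>d. if d = 0 then derivations \<eta> else {0}), differential = (\<lambda>d D. 0)\<rparr>"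

section \<open>Graded multilinear maps\<close>

text \<open>
  A family \<open>g\<^sub>n\<close> of \<open>n\<close>-ary operations is a single function \<open>g\<close> on lists of homogeneous elements,
  each paired with its degree; \<open>g\<^sub>n\<close> is its restriction to lists of length \<open>n\<close>.
\<close>

type_synonym ('m, 'n) ops = "(int \<times> 'm) list \<Rightarrow> 'n"

definition homogeneous :: "('r, 'm) module_complex \<Rightarrow> (int \<times> 'm) list \<Rightarrow> bool" where
  "homogeneous \<L> xs \<longleftrightarrow> (\<forall>(d, x)\<in>set xs. x \<in> component \<L> d)"

definition total_degree :: "(int \<times> 'm) list \<Rightarrow> int" where
  "total_degree xs = sum_list (map fst xs)"

definition signed :: "int \<Rightarrow> 'n::ab_group_add \<Rightarrow> 'n" where
  "signed e x = (if even e then x else - x)"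

definition has_degree ::
  "('r, 'm) module_complex \<Rightarrow> ('r, 'n) module_complex \<Rightarrow> nat \<Rightarrow> int \<Rightarrow> ('m, 'n) ops \<Rightarrow> bool" where
  "has_degree \<M> \<L> n k g \<longleftrightarrow>
     (\<forall>xs. homogeneous \<M> xs \<and> length xs = n \<longrightarrow> g xs \<in> component \<L> (total_degree xs + k))"

definition graded_skew :: "('r, 'm) module_complex \<Rightarrow> nat \<Rightarrow> ('m, 'n::ab_group_add) ops \<Rightarrow> bool" where
  "graded_skew \<M> n g \<longleftrightarrow>
     (\<forall>us d x e y vs. homogeneous \<M> (us @ [(d, x), (e, y)] @ vs) \<and> length us + 2 + length vs = n \<longrightarrow>
        g (us @ [(d, x), (e, y)] @ vs) = signed (1 + d * e) (g (us @ [(e, y), (d, x)] @ vs)))"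

definition multilinear_over ::
  "'r set \<Rightarrow> ('r, 'm::ab_group_add) module_complex \<Rightarrow> ('r, 'n::ab_group_add) module_complex \<Rightarrow> nat \<Rightarrow>
   ('m, 'n) ops \<Rightarrow> bool" where
  "multilinear_over S \<M> \<L> n g \<longleftrightarrow>
     (\<forall>us d x vs. homogeneous \<M> (us @ [(d, x)] @ vs) \<and> length us + 1 + length vs = n \<longrightarrow>
        (\<forall>y\<in>component \<M> d. g (us @ [(d, x + y)] @ vs) = g (us @ [(d, x)] @ vs) + g (us @ [(d, y)] @ vs)) \<and>
        (\<forall>r\<in>S. g (us @ [(d, scl \<M> r x)] @ vs) = scl \<L> r (g (us @ [(d, x)] @ vs))))"

text \<open>
  For a permutation \<open>p\<close> of the positions of a list of elements of degrees \<open>ds\<close>, the exponent of the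
  Koszul sign: each pair of elements that change order contributes the product of their degrees.
\<close>

definition koszul :: "int list \<Rightarrow> nat list \<Rightarrow> int" where
  "koszul ds p =
     (\<Sum>(a, b)\<in>{(a, b). a < b \<and> b < length p \<and> p ! b < p ! a}. ds ! (p ! a) * ds ! (p ! b))"

section \<open>L-infinity algebroids\<close>

text \<open>
  The map \<open>g\<^sub>n[1]\<close> on the shifted complex \<open>\<M>[1]\<close> corresponding to \<open>g\<^sub>n\<close>, characterised by
  \<open>g\<^sub>n[1] \<circ> s\<^sup>\<otimes>\<^sup>n = s \<circ> g\<^sub>n\<close> where \<open>s : \<M> \<rightarrow> \<M>[1]\<close> is the suspension; explicitly
  \<open>g\<^sub>n[1] (s x\<^sub>1, \<dots>, s x\<^sub>n) = (-1)\<^bsup>\<Sum>\<^sub>k (n - k) |x\<^sub>k|\<^esup> s (g\<^sub>n (x\<^sub>1, \<dots>, x\<^sub>n))\<close>.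
  The arguments carry their degrees in \<open>\<M>[1]\<close>, which are one less than those in \<open>\<M>\<close>. Skew maps
  \<open>g\<^sub>n\<close> of degree \<open>2 - n\<close> (resp. \<open>1 - n\<close>) become symmetric maps of degree \<open>1\<close> (resp. \<open>0\<close>), and
  all signs in the relations below become Koszul signs.
\<close>

definition shifted :: "('m, 'n::ab_group_add) ops \<Rightarrow> ('m, 'n) ops" where
  "shifted g xs =
     signed (\<Sum>k<length xs. int (length xs - 1 - k) * (fst (xs ! k) + 1))
       (g (map (\<lambda>(d, x). (d + 1, x)) xs))"

definition shift_homogeneous :: "('r, 'm) module_complex \<Rightarrow> (int \<times> 'm) list \<Rightarrow> bool" where
  "shift_homogeneous \<L> xs \<longleftrightarrow> (\<forall>(d, x)\<in>set xs. x \<in> component \<L> (d + 1))"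

text \<open>
  The sum over unshuffles \<open>\<Sum> \<plusminus> h (q (x\<^sub>A), x\<^sub>B)\<close>, with \<open>A\<close> nonempty and \<open>B\<close> its complement, for
  \<open>q\<close> of degree \<open>1\<close>.
\<close>

definition unshuffle_sum :: "('m, 'n::ab_group_add) ops \<Rightarrow> ('m, 'm) ops \<Rightarrow> ('m, 'n) ops" where
  "unshuffle_sum h q xs =
     (\<Sum>A | A \<subseteq> {..<length xs} \<and> A \<noteq> {}.
        let B = {..<length xs} - A in
        signed (koszul (map fst xs) (sorted_list_of_set A @ sorted_list_of_set B))
          (h ((total_degree (nths xs A) + 1, q (nths xs A)) # nths xs B)))"

text \<open>
  The relation \<open>\<Sum> \<plusminus> l[1] (l[1] (x\<^sub>A), x\<^sub>B) = 0\<close>. In terms of the brackets \<open>l\<close> themselves it reads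
  \<open>\<Sum> (-1)\<^bsup>i(j-1)\<^esup> \<chi>(\<sigma>) l\<^sub>j (l\<^sub>i (x\<^sub>\<sigma>\<^sub>(\<^sub>1\<^sub>), \<dots>, x\<^sub>\<sigma>\<^sub>(\<^sub>i\<^sub>)), x\<^sub>\<sigma>\<^sub>(\<^sub>i\<^sub>+\<^sub>1\<^sub>), \<dots>, x\<^sub>\<sigma>\<^sub>(\<^sub>n\<^sub>)) = 0\<close>,
  the sum being over \<open>i + j = n + 1\<close> and unshuffles \<open>\<sigma>\<close>, with \<open>\<chi>(\<sigma>)\<close> the skew Koszul sign.
\<close>

definition Linf_relations :: "('r, 'm::ab_group_add) module_complex \<Rightarrow> ('m, 'm) ops \<Rightarrow> bool" where
  "Linf_relations \<L> l \<longleftrightarrow>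
     (\<forall>xs. xs \<noteq> [] \<and> shift_homogeneous \<L> xs \<longrightarrow> unshuffle_sum (shifted l) (shifted l) xs = 0)"

definition Linf_algebroid ::
  "('k::field \<Rightarrow> 'r::comm_ring_1) \<Rightarrow> ('r, 'm::ab_group_add) module_complex \<Rightarrow> ('m, 'm) ops \<Rightarrow>
   (int \<Rightarrow> 'm \<Rightarrow> 'r \<Rightarrow> 'r) \<Rightarrow> bool" where
  "Linf_algebroid \<eta> \<L> l a \<longleftrightarrow>
     (\<forall>d. \<forall>x\<in>component \<L> d. l [(d, x)] = differential \<L> d x) \<and>
     (\<forall>n\<ge>1. has_degree \<L> \<L> n (2 - int n) l \<and> graded_skew \<L> n l) \<and>
     multilinear_over (range \<eta>) \<L> \<L> 2 l \<and>
     (\<forall>n>2. multilinear_over UNIV \<L> \<L> n l) \<and>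
     Linf_relations \<L> l \<and>
     chain_map \<L> (tangent_complex \<eta>) a \<and>
     (\<forall>d e. \<forall>x\<in>component \<L> d. \<forall>y\<in>component \<L> e. \<forall>f.
        l [(d, x), (e, scl \<L> f y)] = scl \<L> (a d x f) y + scl \<L> f (l [(d, x), (e, y)]))"

section \<open>L-infinity morphisms\<close>

text \<open>
  The partitions of \<open>{..<n}\<close> into nonempty blocks, each represented once, as the list of its
  blocks ordered by their least elements.
\<close>

definition block_partitions :: "nat \<Rightarrow> nat set list set" where
  "block_partitions n =
     {Bs. {} \<notin> set Bs \<and> \<Union>(set Bs) = {..<n} \<and> sorted_wrt (\<lambda>A B. A \<inter> B = {} \<and> Min A < Min B) Bs}"

text \<open>The sum over partitions \<open>\<Sum> \<plusminus> h (g (x\<^bsub>B1\<^esub>), \<dots>, g (x\<^bsub>Bk\<^esub>))\<close> for \<open>g\<close> of degree \<open>0\<close>.\<close>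

definition partition_sum :: "('n, 'q::ab_group_add) ops \<Rightarrow> ('m, 'n) ops \<Rightarrow> ('m, 'q) ops" where
  "partition_sum h g xs =
     (\<Sum>Bs\<in>block_partitions (length xs).
        signed (koszul (map fst xs) (concat (map sorted_list_of_set Bs)))
          (h (map (\<lambda>B. (total_degree (nths xs B), g (nths xs B))) Bs)))"

definition Linf_morphism ::
  "('r, 'm::ab_group_add) module_complex \<Rightarrow> ('m, 'm) ops \<Rightarrow> (int \<Rightarrow> 'm \<Rightarrow> 'r \<Rightarrow> 'r) \<Rightarrow>
   ('r, 'n::ab_group_add) module_complex \<Rightarrow> ('n, 'n) ops \<Rightarrow> (int \<Rightarrow> 'n \<Rightarrow> 'r \<Rightarrow> 'r) \<Rightarrow>
   ('m, 'n) ops \<Rightarrow> bool" where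
  "Linf_morphism \<M> l a \<L> l' a' F \<longleftrightarrow>
     (\<forall>n\<ge>1. has_degree \<M> \<L> n (1 - int n) F \<and> graded_skew \<M> n F \<and> multilinear_over UNIV \<M> \<L> n F) \<and>
     (\<forall>xs. xs \<noteq> [] \<and> shift_homogeneous \<M> xs \<longrightarrow>
        unshuffle_sum (shifted F) (shifted l) xs = partition_sum (shifted l') (shifted F) xs) \<and>
     chain_map \<M> \<L> (\<lambda>d x. F [(d, x)]) \<and>
     (\<forall>d. \<forall>x\<in>component \<M> d. a' d (F [(d, x)]) = a d x)"

definition Linf_quasi_isomorphism ::
  "('r, 'm::ab_group_add) module_complex \<Rightarrow> ('m, 'm) ops \<Rightarrow> (int \<Rightarrow> 'm \<Rightarrow> 'r \<Rightarrow> 'r) \<Rightarrow>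
   ('r, 'n::ab_group_add) module_complex \<Rightarrow> ('n, 'n) ops \<Rightarrow> (int \<Rightarrow> 'n \<Rightarrow> 'r \<Rightarrow> 'r) \<Rightarrow>
   ('m, 'n) ops \<Rightarrow> bool" where
  "Linf_quasi_isomorphism \<M> l a \<L> l' a' F \<longleftrightarrow>
     Linf_morphism \<M> l a \<L> l' a' F \<and> quasi_isomorphism \<M> \<L> (\<lambda>d x. F [(d, x)])"

definition extends_chain_map ::
  "('r, 'm) module_complex \<Rightarrow> (int \<Rightarrow> 'm \<Rightarrow> 'n) \<Rightarrow> ('m, 'n) ops \<Rightarrow> bool" where
  "extends_chain_map \<M> f F \<longleftrightarrow> (\<forall>d. \<forall>x\<in>component \<M> d. F [(d, x)] = f d x)"

end

theory Submission
  imports Defs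
begin

text \<open>
  After the shift, brackets are graded symmetric operations \<open>q\<close> of degree \<open>1\<close> with
  \<open>q \<circ> q = 0\<close>, and an \<open>L\<^sub>\<infinity>\<close> morphism is a symmetric \<open>F\<close> of degree \<open>0\<close> for which
  the defect \<open>F \<circ> q - h \<circ> F\<close> vanishes, \<open>h\<close> being the given bracket. One
  constructs \<open>q\<close> and \<open>F\<close> by induction on the arity. In the lowest arity where they do not vanish, the
  curvature \<open>q \<circ> q\<close> and the defect form a cocycle with values in the mapping cone of the
  quasi-isomorphism \<open>f\<close>. The cone is a bounded acyclic complex of projective modules, hence has an
  \<open>\<O>\<close>-linear contraction, and composing the cocycle with this contraction yields the correction
  to \<open>(q, F)\<close> in that arity. Post-composition preserves symmetry, so no averaging is needed.

  The correction has to be \<open>\<O>\<close>-multilinear although the binary bracket is not. The induction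
  starts from a binary bracket built from connections, and the failure of the curvature to be
  linear is multiplication by \<open>a[y,z] - [ay,az]\<close> applied to a function. For the given algebroid this
  expression annihilates the degree \<open>0\<close> bundle and lies in its trace ideal, so it is zero; the
  vanishing of the binary defect carries this over to the transferred bracket.
\<close>

text \<open>The curvature \<open>R\<close> of \<open>q\<close> cannot be corrected alone: its values
  form a cocycle in the source complex, which may have cohomology. It is the defect \<open>Q\<close>
  that exhibits \<open>f \<circ> R\<close> as a boundary, so both have to be corrected together. Let
  \<open>\<Delta>\<close> be the differential of the cone, \<open>H\<close> its contraction and
  \<open>\<delta>\<close> the differential acting on the arguments. The cocycle condition for
  \<open>Z = (R, Q)\<close> reads \<open>\<Delta> Z = Z \<delta>\<close>, so \<open>W = H Z\<close>
  satisfies \<open>\<Delta> W + W \<delta> = (\<Delta> H + H \<Delta>) Z = Z\<close>. Subtracting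
  \<open>W\<close> from \<open>(q, F)\<close> in the arity in question therefore cancels
  \<open>Z\<close> there.

  The trace ideal enters because a bundle may be zero over some components of \<open>U\<close>,
  where annihilating it is no information.

  Signs are tamed by recursion: unshuffles and partitions of a list are generated from its head with
  one Koszul sign per step, so identities become inductions on lists. Permutations are met only
  where these recursions are compared with the sums over sets of positions in the
  definitions.\<close>

lemma signed_0 [simp]: "signed e 0 = 0"
  by (simp add: signed_def)

lemma signed_zero [simp]: "signed 0 x = x"
  by (simp add: signed_def)

lemma signed_add: "signed e (x + y) = signed e x + signed e y"
  by (simp add: signed_def)

lemma signed_minus: "signed e (- x) = - signed e x"
  by (simp add: signed_def)

lemma signed_signed [simp]: "signed e (signed e' x) = signed (e + e') x"
  by (auto simp: signed_def)

lemma signed_cong: "even (e + e') \<Longrightarrow> signed e x = signed e' x"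
  by (auto simp: signed_def)

lemma signed_minus_cong: "odd (e + e') \<Longrightarrow> signed e x = - signed e' x"
  by (auto simp: signed_def)

lemma total_degree_simps [simp]:
  "total_degree [] = 0" "total_degree (x # xs) = fst x + total_degree xs"
  "total_degree (xs @ ys) = total_degree xs + total_degree ys"
  by (simp_all add: total_degree_def)

section \<open>Sums over unshuffles\<close>

text \<open>This is the coproduct of the symmetric coalgebra, evaluated by \<open>\<phi>\<close>. If
  the head \<open>x\<close> goes to the second part, all of \<open>A\<close> has to pass it, whence
  the sign.\<close>

primrec split_sum ::
  "(int \<times> 'm) list \<Rightarrow> ((int \<times> 'm) list \<Rightarrow> (int \<times> 'm) list \<Rightarrow> 'n::ab_group_add) \<Rightarrow> 'n" where
  "split_sum [] \<phi> = \<phi> [] []"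
| "split_sum (x # xs) \<phi> = split_sum xs (\<lambda>A B. \<phi> (x # A) B) +
     split_sum xs (\<lambda>A B. signed (fst x * total_degree A) (\<phi> A (x # B)))"

lemma split_sum_cong:
  assumes "\<And>A B. set A \<union> set B \<subseteq> set xs \<Longrightarrow> length A + length B = length xs \<Longrightarrow>
    total_degree A + total_degree B = total_degree xs \<Longrightarrow> \<phi> A B = \<psi> A B"
  shows "split_sum xs \<phi> = split_sum xs \<psi>"
  using assms
proof (induction xs arbitrary: \<phi> \<psi>)
  case (Cons x xs)
  have "split_sum xs (\<lambda>A B. \<phi> (x # A) B) = split_sum xs (\<lambda>A B. \<psi> (x # A) B)"
    by (rule Cons.IH, rule Cons.prems) auto
  moreover have "split_sum xs (\<lambda>A B. signed (fst x * total_degree A) (\<phi> A (x # B))) =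
      split_sum xs (\<lambda>A B. signed (fst x * total_degree A) (\<psi> A (x # B)))"
    by (rule Cons.IH, rule arg_cong[where f = "signed _"], rule Cons.prems) auto
  ultimately show ?case by simp
qed simp

text \<open>The length equation lets the termination proof of \<open>part_sum\<close> see that its
  recursive call under \<open>split_sum\<close> concerns a shorter list.\<close>

lemma split_sum_fundef_cong [fundef_cong]:
  assumes "xs = ys" "\<And>A B. length A + length B = length ys \<Longrightarrow> \<phi> A B = \<psi> A B"
  shows "split_sum xs \<phi> = split_sum ys \<psi>"
  using assms by (auto intro: split_sum_cong)

lemma split_sum_0 [simp]: "split_sum xs (\<lambda>A B. 0) = 0"
  by (induction xs) auto

lemma split_sum_add: "split_sum xs (\<lambda>A B. \<phi> A B + \<psi> A B) = split_sum xs \<phi> + split_sum xs \<psi>"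
  by (induction xs arbitrary: \<phi> \<psi>) (auto simp: signed_add)

lemma split_sum_minus: "split_sum xs (\<lambda>A B. - \<phi> A B) = - split_sum xs \<phi>"
  by (induction xs arbitrary: \<phi>) (auto simp: signed_minus)

lemma split_sum_diff: "split_sum xs (\<lambda>A B. \<phi> A B - \<psi> A B) = split_sum xs \<phi> - split_sum xs \<psi>"
  using split_sum_add[of xs \<phi> "\<lambda>A B. - \<psi> A B"] by (simp add: split_sum_minus)

lemma split_sum_signed: "split_sum xs (\<lambda>A B. signed e (\<phi> A B)) = signed e (split_sum xs \<phi>)"
  by (simp add: signed_def split_sum_minus)

section \<open>Additivity relative to a subgroup\<close>

definition subgroup_set :: "'m::ab_group_add set \<Rightarrow> bool" where
  "subgroup_set K \<longleftrightarrow> 0 \<in> K \<and> (\<forall>x\<in>K. \<forall>y\<in>K. x + y \<in> K) \<and> (\<forall>x\<in>K. - x \<in> K)"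

text \<open>Operations are controlled on homogeneous arguments only, so additivity is asked on one
  component and not on the whole type.\<close>

definition additive_on :: "'m::ab_group_add set \<Rightarrow> ('m \<Rightarrow> 'n::ab_group_add) \<Rightarrow> bool" where
  "additive_on K h \<longleftrightarrow> subgroup_set K \<and> (\<forall>x\<in>K. \<forall>y\<in>K. h (x + y) = h x + h y)"

lemma subgroup_set_signed: "subgroup_set K \<Longrightarrow> x \<in> K \<Longrightarrow> signed e x \<in> K"
  by (auto simp: subgroup_set_def signed_def)

lemma additive_on_0: "additive_on K h \<Longrightarrow> h 0 = 0"
  unfolding additive_on_def subgroup_set_def by (metis add.right_neutral add_left_cancel)

lemma additive_on_minus: "additive_on K h \<Longrightarrow> x \<in> K \<Longrightarrow> h (- x) = - h x"
  using additive_on_0[of K h] unfolding additive_on_def subgroup_set_def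
  by (metis add.right_inverse add_eq_0_iff)

lemma additive_on_signed: "additive_on K h \<Longrightarrow> x \<in> K \<Longrightarrow> h (signed e x) = signed e (h x)"
  by (simp add: signed_def additive_on_minus)

lemma additive_on_diff:
  "additive_on K h \<Longrightarrow> x \<in> K \<Longrightarrow> y \<in> K \<Longrightarrow> h (x - y) = h x - h y"
  using additive_on_minus[of K h y] unfolding additive_on_def subgroup_set_def
  by (metis add_uminus_conv_diff)

text \<open>Both claims are proved together: a partial sum has to be known to lie in
  \<open>K\<close> before additivity of \<open>h\<close> applies to it.\<close>

lemma split_sum_additive:
  assumes "additive_on K h"
    and "\<And>A B. set A \<union> set B \<subseteq> set xs \<Longrightarrow> length A + length B = length xs \<Longrightarrow>
      total_degree A + total_degree B = total_degree xs \<Longrightarrow> \<phi> A B \<in> K"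
  shows "split_sum xs \<phi> \<in> K" and "h (split_sum xs \<phi>) = split_sum xs (\<lambda>A B. h (\<phi> A B))"
proof -
  have "split_sum xs \<phi> \<in> K \<and> h (split_sum xs \<phi>) = split_sum xs (\<lambda>A B. h (\<phi> A B))"
    using assms(2)
  proof (induction xs arbitrary: \<phi>)
    case (Cons x xs)
    have 1: "split_sum xs (\<lambda>A B. \<phi> (x # A) B) \<in> K \<and> h (split_sum xs (\<lambda>A B. \<phi> (x # A) B)) =
        split_sum xs (\<lambda>A B. h (\<phi> (x # A) B))"
      by (rule Cons.IH, rule Cons.prems) auto
    have mem: "\<phi> A (x # B) \<in> K" if "set A \<union> set B \<subseteq> set xs" "length A + length B = length xs"
      "total_degree A + total_degree B = total_degree xs" for A B
      using that by (intro Cons.prems) auto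
    have 2: "split_sum xs (\<lambda>A B. signed (fst x * total_degree A) (\<phi> A (x # B))) \<in> K \<and>
        h (split_sum xs (\<lambda>A B. signed (fst x * total_degree A) (\<phi> A (x # B)))) =
        split_sum xs (\<lambda>A B. h (signed (fst x * total_degree A) (\<phi> A (x # B))))"
      by (rule Cons.IH) (use mem assms(1) in \<open>auto simp: additive_on_def intro: subgroup_set_signed\<close>)
    have 3: "split_sum xs (\<lambda>A B. h (signed (fst x * total_degree A) (\<phi> A (x # B)))) =
        split_sum xs (\<lambda>A B. signed (fst x * total_degree A) (h (\<phi> A (x # B))))"
      by (rule split_sum_cong) (use mem assms(1) in \<open>auto intro: additive_on_signed\<close>)
    show ?case
      using 1 2 3 assms(1) by (auto simp: additive_on_def subgroup_set_def)
  qed simp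
  then show "split_sum xs \<phi> \<in> K" and "h (split_sum xs \<phi>) = split_sum xs (\<lambda>A B. h (\<phi> A B))"
    by auto
qed

lemma split_sum_mem:
  assumes "subgroup_set K"
    and "\<And>A B. set A \<union> set B \<subseteq> set xs \<Longrightarrow> length A + length B = length xs \<Longrightarrow>
      total_degree A + total_degree B = total_degree xs \<Longrightarrow> \<phi> A B \<in> K"
  shows "split_sum xs \<phi> \<in> K"
  by (rule split_sum_additive(1)[of K id]) (use assms in \<open>auto simp: additive_on_def\<close>)

text \<open>Coassociativity: both sides run over the decompositions into three parts, and the sign
  of passing \<open>E\<close> is the product of the signs of passing \<open>A\<close> and
  \<open>C\<close>.\<close>

lemma split_sum_coassoc:
  "split_sum xs (\<lambda>A B. split_sum B (\<lambda>C D. \<phi> A C D)) =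
   split_sum xs (\<lambda>E D. split_sum E (\<lambda>A C. \<phi> A C D))"
proof (induction xs arbitrary: \<phi>)
  case (Cons x xs)
  have *: "split_sum xs (\<lambda>E D. signed (fst x * total_degree E) (split_sum E (\<lambda>A C. \<phi> A C (x # D)))) =
      split_sum xs (\<lambda>E D. split_sum E (\<lambda>A C. signed (fst x * total_degree A + fst x * total_degree C)
          (\<phi> A C (x # D))))"
    by (intro split_sum_cong) (simp flip: split_sum_signed distrib_left cong: split_sum_cong)
  show ?case
    unfolding split_sum.simps *
    by (simp add: Cons.IH split_sum_add signed_add algebra_simps flip: split_sum_signed)
qed simp

text \<open>Cocommutativity: the two summands of the recursion change places.\<close>

lemma split_sum_comm:
  "split_sum xs \<phi> = split_sum xs (\<lambda>A B. signed (total_degree A * total_degree B) (\<phi> B A))"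
proof (induction xs arbitrary: \<phi>)
  case (Cons x xs)
  show ?case
    unfolding split_sum.simps
    by (subst (1 2) Cons.IH)
      (auto simp: algebra_simps intro!: arg_cong2[where f = "(+)"] split_sum_cong signed_cong)
qed simp

text \<open>Coassociativity gathers the first two of three parts into a pair, to which
  cocommutativity applies.\<close>

lemma split_sum_swap:
  "split_sum xs (\<lambda>A B. split_sum B (\<lambda>C D. \<phi> A C D)) =
   split_sum xs (\<lambda>A B. split_sum B (\<lambda>C D. signed (total_degree A * total_degree C) (\<phi> C A D)))"
  unfolding split_sum_coassoc by (subst split_sum_comm) (rule refl)

text \<open>The hypotheses cover the case that \<open>x\<close> and \<open>y\<close> go to the same
  part. If they are separated, the recursion itself creates the sign, and the two ways of separating
  them change places.\<close>

lemma split_sum_adjacent: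
  assumes "\<And>us' vs' B. set us' \<union> set vs' \<union> set B \<subseteq> set us \<union> set vs \<Longrightarrow>
      length us' + length vs' + length B = length us + length vs \<Longrightarrow>
      \<phi> (us' @ x # y # vs') B = signed (fst x * fst y) (\<phi> (us' @ y # x # vs') B)"
    and "\<And>us' vs' A. set us' \<union> set vs' \<union> set A \<subseteq> set us \<union> set vs \<Longrightarrow>
      length us' + length vs' + length A = length us + length vs \<Longrightarrow>
      \<phi> A (us' @ x # y # vs') = signed (fst x * fst y) (\<phi> A (us' @ y # x # vs'))"
  shows "split_sum (us @ x # y # vs) \<phi> = signed (fst x * fst y) (split_sum (us @ y # x # vs) \<phi>)"
  using assms
proof (induction us arbitrary: \<phi>)
  case Nil
  let ?s = "fst x * fst y"
  have 1: "split_sum vs (\<lambda>A B. \<phi> (x # y # A) B) = signed ?s (split_sum vs (\<lambda>A B. \<phi> (y # x # A) B))"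
    unfolding split_sum_signed[symmetric] using Nil(1)[of "[]"] by (intro split_sum_cong) auto
  have 2: "split_sum vs (\<lambda>A B. signed (fst x * total_degree A) (signed (fst y * total_degree A)
      (\<phi> A (x # y # B)))) =
      signed ?s (split_sum vs (\<lambda>A B. signed (fst y * total_degree A) (signed (fst x * total_degree A)
          (\<phi> A (y # x # B)))))"
    unfolding split_sum_signed[symmetric] using Nil(2)[of "[]"]
    by (intro split_sum_cong) (auto simp: algebra_simps)
  have 3: "split_sum vs (\<lambda>A B. signed (fst x * total_degree (y # A)) (\<phi> (y # A) (x # B))) =
      signed ?s (split_sum vs (\<lambda>A B. signed (fst x * total_degree A) (\<phi> (y # A) (x # B))))"
    unfolding split_sum_signed[symmetric] by (intro split_sum_cong) (auto simp: algebra_simps)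
  have 4: "split_sum vs (\<lambda>A B. signed (fst y * total_degree A) (\<phi> (x # A) (y # B))) =
      signed ?s (split_sum vs (\<lambda>A B. signed (fst y * total_degree (x # A)) (\<phi> (x # A) (y # B))))"
    unfolding split_sum_signed[symmetric]
    by (intro split_sum_cong) (auto simp: algebra_simps intro!: signed_cong)
  show ?case
    using 1 2 3 4 by (simp add: signed_add add.commute)
next
  case (Cons u us)
  have 1: "split_sum (us @ x # y # vs) (\<lambda>A B. \<phi> (u # A) B) =
      signed (fst x * fst y) (split_sum (us @ y # x # vs) (\<lambda>A B. \<phi> (u # A) B))"
  proof (rule Cons.IH, goal_cases)
    case (1 us' vs' B)
    have "\<phi> ((u # us') @ x # y # vs') B = signed (fst x * fst y) (\<phi> ((u # us') @ y # x # vs') B)"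
      by (rule Cons.prems(1)) (use 1 in auto)
    then show ?case by simp
  next
    case (2 us' vs' A)
    show ?case by (rule Cons.prems(2)) (use 2 in auto)
  qed
  have 2: "split_sum (us @ x # y # vs) (\<lambda>A B. signed (fst u * total_degree A) (\<phi> A (u # B))) =
      signed (fst x * fst y) (split_sum (us @ y # x # vs) (\<lambda>A B. signed (fst u * total_degree A)
          (\<phi> A (u # B))))"
  proof (rule Cons.IH, goal_cases)
    case (1 us' vs' B)
    have "\<phi> (us' @ x # y # vs') (u # B) = signed (fst x * fst y) (\<phi> (us' @ y # x # vs') (u # B))"
      by (rule Cons.prems(1)) (use 1 in auto)
    then show ?case by (simp add: algebra_simps)
  next
    case (2 us' vs' A)
    have "\<phi> A ((u # us') @ x # y # vs') = signed (fst x * fst y) (\<phi> A ((u # us') @ y # x # vs'))"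
      by (rule Cons.prems(2)) (use 2 in auto)
    then show ?case by (simp add: algebra_simps)
  qed
  show ?case using 1 2 by (simp add: signed_add)
qed

section \<open>Sums over partitions\<close>

text \<open>The block of the head is split off first, so every partition occurs once, with its
  blocks ordered by their first elements. The Koszul sign is the one produced by
  \<open>split_sum\<close>.\<close>

function part_sum ::
  "(int \<times> 'm) list \<Rightarrow> ((int \<times> 'm) list list \<Rightarrow> 'n::ab_group_add) \<Rightarrow> 'n" where
  "part_sum [] \<psi> = \<psi> []"
| "part_sum (x # xs) \<psi> = split_sum xs (\<lambda>A B. part_sum B (\<lambda>Bs. \<psi> ((x # A) # Bs)))"
  by pat_completeness auto
termination
  by (relation "Wellfounded.measure (length \<circ> fst)") auto

lemma part_sum_cong:
  assumes "\<And>Bs. set (concat Bs) \<subseteq> set xs \<Longrightarrow> [] \<notin> set Bs \<Longrightarrow> length (concat Bs) = length xs \<Longrightarrow>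
    total_degree (concat Bs) = total_degree xs \<Longrightarrow> \<phi> Bs = \<psi> Bs"
  shows "part_sum xs \<phi> = part_sum xs \<psi>"
  using assms
proof (induction xs arbitrary: \<phi> \<psi> rule: measure_induct_rule[of length])
  case (less xs)
  show ?case
  proof (cases xs)
    case (Cons x ys)
    have "part_sum B (\<lambda>Bs. \<phi> ((x # A) # Bs)) = part_sum B (\<lambda>Bs. \<psi> ((x # A) # Bs))"
      if "set A \<union> set B \<subseteq> set ys" "length A + length B = length ys"
        "total_degree A + total_degree B = total_degree ys" for A B
    proof (rule less.IH, goal_cases)
      case (2 Bs)
      with that Cons show ?case by (intro less.prems) auto
    qed (use that Cons in simp)
    then show ?thesis using Cons by (auto intro: split_sum_cong)
  qed (use less.prems[of "[]"] in simp)
qed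

lemma part_sum_add: "part_sum xs (\<lambda>Bs. \<phi> Bs + \<psi> Bs) = part_sum xs \<phi> + part_sum xs \<psi>"
proof (induction xs arbitrary: \<phi> \<psi> rule: measure_induct_rule[of length])
  case (less xs)
  show ?case
  proof (cases xs)
    case (Cons x ys)
    show ?thesis
      unfolding Cons part_sum.simps split_sum_add[symmetric]
      by (rule split_sum_cong) (use less Cons in auto)
  qed simp
qed

lemma part_sum_minus: "part_sum xs (\<lambda>Bs. - \<phi> Bs) = - part_sum xs \<phi>"
proof (induction xs arbitrary: \<phi> rule: measure_induct_rule[of length])
  case (less xs)
  show ?case
  proof (cases xs)
    case (Cons x ys)
    show ?thesis
      unfolding Cons part_sum.simps split_sum_minus[symmetric]
      by (rule split_sum_cong) (use less Cons in auto)
  qed simp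
qed

lemma part_sum_signed: "part_sum xs (\<lambda>Bs. signed e (\<phi> Bs)) = signed e (part_sum xs \<phi>)"
  by (simp add: signed_def part_sum_minus)

lemma part_sum_0 [simp]: "part_sum xs (\<lambda>Bs. 0) = 0"
  using part_sum_add[of xs "\<lambda>_. 0" "\<lambda>_. 0"] by simp

lemma part_sum_additive:
  assumes "additive_on K h"
    and "\<And>Bs. set (concat Bs) \<subseteq> set xs \<Longrightarrow> [] \<notin> set Bs \<Longrightarrow> length (concat Bs) = length xs \<Longrightarrow>
      total_degree (concat Bs) = total_degree xs \<Longrightarrow> \<phi> Bs \<in> K"
  shows "part_sum xs \<phi> \<in> K" and "h (part_sum xs \<phi>) = part_sum xs (\<lambda>Bs. h (\<phi> Bs))"
proof -
  have "part_sum xs \<phi> \<in> K \<and> h (part_sum xs \<phi>) = part_sum xs (\<lambda>Bs. h (\<phi> Bs))"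
    using assms(2)
  proof (induction xs arbitrary: \<phi> rule: measure_induct_rule[of length])
    case (less xs)
    show ?case
    proof (cases xs)
      case (Cons x ys)
      have IH: "part_sum B (\<lambda>Bs. \<phi> ((x # A) # Bs)) \<in> K \<and>
          h (part_sum B (\<lambda>Bs. \<phi> ((x # A) # Bs))) = part_sum B (\<lambda>Bs. h (\<phi> ((x # A) # Bs)))"
        if "set A \<union> set B \<subseteq> set ys" "length A + length B = length ys"
          "total_degree A + total_degree B = total_degree ys" for A B
      proof (rule less.IH, goal_cases)
        case (2 Bs)
        with that Cons show ?case by (intro less.prems) auto
      qed (use that Cons in simp)
      note * = split_sum_additive[OF assms(1), of ys "\<lambda>A B. part_sum B (\<lambda>Bs. \<phi> ((x # A) # Bs))"]
      have "split_sum ys (\<lambda>A B. h (part_sum B (\<lambda>Bs. \<phi> ((x # A) # Bs)))) =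
          split_sum ys (\<lambda>A B. part_sum B (\<lambda>Bs. h (\<phi> ((x # A) # Bs))))"
        by (rule split_sum_cong) (use IH in auto)
      then show ?thesis using * IH Cons by auto
    qed (use less.prems[of "[]"] in simp)
  qed
  then show "part_sum xs \<phi> \<in> K" and "h (part_sum xs \<phi>) = part_sum xs (\<lambda>Bs. h (\<phi> Bs))"
    by auto
qed

lemma part_sum_mem:
  assumes "subgroup_set K"
    and "\<And>Bs. set (concat Bs) \<subseteq> set xs \<Longrightarrow> [] \<notin> set Bs \<Longrightarrow> length (concat Bs) = length xs \<Longrightarrow>
      total_degree (concat Bs) = total_degree xs \<Longrightarrow> \<phi> Bs \<in> K"
  shows "part_sum xs \<phi> \<in> K"
  by (rule part_sum_additive(1)[of K id]) (use assms in \<open>auto simp: additive_on_def\<close>)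

text \<open>Inside one block the first hypothesis exchanges \<open>x\<close> and \<open>y\<close>.
  If they lie in different blocks, the exchange may reorder the list of blocks, which the second
  hypothesis repairs. \<open>Z\<close> stands for the homogeneous elements, to which both hypotheses
  are confined.\<close>

lemma part_sum_adjacent:
  assumes "\<And>Bs us' vs' Bs'. set us' \<union> set vs' \<union> set (concat Bs) \<union> set (concat Bs') \<subseteq> Z \<Longrightarrow>
      [] \<notin> set Bs \<union> set Bs' \<Longrightarrow>
      \<psi> (Bs @ (us' @ x # y # vs') # Bs') = signed (fst x * fst y) (\<psi> (Bs @ (us' @ y # x # vs') # Bs'))"
    and "\<And>Bs A B Bs'. set A \<union> set B \<union> set (concat Bs) \<union> set (concat Bs') \<subseteq> Z \<Longrightarrow>
      [] \<notin> {A, B} \<union> set Bs \<union> set Bs' \<Longrightarrow>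
      \<psi> (Bs @ A # B # Bs') = signed (total_degree A * total_degree B) (\<psi> (Bs @ B # A # Bs'))"
    and "set us \<union> set vs \<union> {x, y} \<subseteq> Z"
  shows "part_sum (us @ x # y # vs) \<psi> = signed (fst x * fst y) (part_sum (us @ y # x # vs) \<psi>)"
  using assms
proof (induction "length us + length vs" arbitrary: us vs \<psi> rule: less_induct)
  case less
  let ?s = "fst x * fst y"
  show ?case
  proof (cases us)
    case Nil
    let ?\<theta> = "\<lambda>x y A C D. part_sum D (\<lambda>Bs. \<psi> ((x # A) # (y # C) # Bs))"
    have "split_sum vs (\<lambda>A B. part_sum B (\<lambda>Bs. \<psi> ((x # y # A) # Bs))) =
        signed ?s (split_sum vs (\<lambda>A B. part_sum B (\<lambda>Bs. \<psi> ((y # x # A) # Bs))))"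
      unfolding split_sum_signed[symmetric] part_sum_signed[symmetric]
    proof (intro split_sum_cong part_sum_cong, goal_cases)
      case (1 A B Bs)
      have "\<psi> ([] @ ([] @ x # y # A) # Bs) = signed ?s (\<psi> ([] @ ([] @ y # x # A) # Bs))"
        by (rule less.prems(1)) (use 1 less.prems(3) Nil in auto)
      then show ?case by simp
    qed
    moreover have "split_sum vs (\<lambda>A B. signed (fst y * total_degree A) (split_sum B (\<lambda>C D. ?\<theta> x y A C D))) =
        signed ?s (split_sum vs (\<lambda>A B. signed (fst x * total_degree A) (split_sum B (\<lambda>C D. ?\<theta> y x A C D))))"
    proof -
      \<comment> \<open>Here \<open>x\<close> and \<open>y\<close> head different blocks. Exchanging
        the remainders \<open>A\<close> and \<open>C\<close> of these blocks prepares the second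
        hypothesis, which swaps the blocks themselves.\<close>
      have "split_sum vs (\<lambda>A B. split_sum B (\<lambda>C D. signed (fst y * total_degree A) (?\<theta> x y A C D))) =
          split_sum vs (\<lambda>A B. split_sum B (\<lambda>C D. signed (total_degree A * total_degree C +
              fst y * total_degree C) (?\<theta> x y C A D)))"
        by (subst split_sum_swap) simp
      also have "\<dots> = split_sum vs (\<lambda>A B. split_sum B (\<lambda>C D. signed (?s + fst x * total_degree A)
          (?\<theta> y x A C D)))"
        unfolding part_sum_signed[symmetric]
      proof (intro split_sum_cong part_sum_cong, goal_cases)
        case (1 A B C D Bs)
        then have "set B \<subseteq> Z" "set D \<subseteq> set B" using less.prems(3) Nil by auto
        with 1 have "set (concat Bs) \<subseteq> Z" by blast
        have "\<psi> ([] @ (x # C) # (y # A) # Bs) =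
            signed (total_degree (x # C) * total_degree (y # A)) (\<psi> ([] @ (y # A) # (x # C) # Bs))"
          by (rule less.prems(2)) (use 1 less.prems(3) Nil \<open>set (concat Bs) \<subseteq> Z\<close> in auto)
        then show ?case by (auto simp: algebra_simps intro!: signed_cong)
      qed
      finally show ?thesis
        by (simp add: split_sum_signed) (simp add: add.commute flip: split_sum_signed)
    qed
    ultimately show ?thesis
      by (simp add: Nil signed_add)
  next
    case (Cons u us')
    show ?thesis
      unfolding Cons append_Cons part_sum.simps
    proof (rule split_sum_adjacent, goal_cases)
      case (1 us'' vs'' B)
      have "\<psi> ((u # us'' @ x # y # vs'') # Bs) = signed ?s (\<psi> ((u # us'' @ y # x # vs'') # Bs))"
        if "set (concat Bs) \<subseteq> set B" "[] \<notin> set Bs" for Bs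
      proof -
        have "\<psi> ([] @ ((u # us'') @ x # y # vs'') # Bs) = signed ?s (\<psi> ([] @ ((u # us'') @ y # x # vs'')
            # Bs))"
        proof (rule less.prems(1))
          have "set B \<subseteq> Z" using 1 less.prems(3) Cons by auto
          with that have "set (concat Bs) \<subseteq> Z" by blast
          then show "set (u # us'') \<union> set vs'' \<union> set (concat []) \<union> set (concat Bs) \<subseteq> Z"
            using 1 less.prems(3) Cons by auto
        qed (use that in auto)
        then show ?thesis by simp
      qed
      then show ?case
        unfolding part_sum_signed[symmetric] by (intro part_sum_cong) auto
    next
      case (2 us'' vs'' A)
      show ?case
      proof (rule less.hyps, goal_cases)
        case 1
        show ?case using 2 Cons by auto
      next
        case prems: (2 us' vs' Bs Bs')
        have "\<psi> (((u # A) # Bs) @ (us' @ x # y # vs') # Bs') =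
            signed ?s (\<psi> (((u # A) # Bs) @ (us' @ y # x # vs') # Bs'))"
          by (rule less.prems(1)) (use prems 2 less.prems(3) Cons in auto)
        then show ?case by simp
      next
        case prems: (3 A' B Bs Bs')
        have "\<psi> (((u # A) # Bs) @ A' # B # Bs') =
            signed (total_degree A' * total_degree B) (\<psi> (((u # A) # Bs) @ B # A' # Bs'))"
          by (rule less.prems(2)) (use prems 2 less.prems(3) Cons in auto)
        then show ?case by simp
      next
        case 4
        then show ?case using 2 less.prems(3) Cons by auto
      qed
    qed
  qed
qed

lemma part_sum_split_sum_interchange:
  "part_sum D (\<lambda>Ds. split_sum E (\<lambda>A C. \<phi> A C Ds)) = split_sum E (\<lambda>A C. part_sum D (\<lambda>Ds. \<phi> A C Ds))"
  by (induction E arbitrary: \<phi>) (auto simp: part_sum_add simp flip: part_sum_signed)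

lemma part_sum_interchange:
  "part_sum D (\<lambda>Ds. part_sum E (\<lambda>Es. \<phi> Es Ds)) = part_sum E (\<lambda>Es. part_sum D (\<lambda>Ds. \<phi> Es Ds))"
proof (induction E arbitrary: \<phi> rule: measure_induct_rule[of length])
  case (less E)
  show ?case
  proof (cases E)
    case (Cons x ys)
    show ?thesis
      unfolding Cons part_sum.simps part_sum_split_sum_interchange
      by (intro split_sum_cong less) (use Cons in auto)
  qed simp
qed

text \<open>Isolates the term in which one operation takes all arguments.\<close>

lemma split_sum_all_left:
  assumes "\<And>A B. set A \<union> set B \<subseteq> set xs \<Longrightarrow> length A + length B = length xs \<Longrightarrow>
    total_degree A + total_degree B = total_degree xs \<Longrightarrow> B \<noteq> [] \<Longrightarrow> \<phi> A B = 0"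
  shows "split_sum xs \<phi> = \<phi> xs []"
  using assms
proof (induction xs arbitrary: \<phi>)
  case (Cons x xs)
  have "split_sum xs (\<lambda>A B. \<phi> (x # A) B) = \<phi> (x # xs) []"
    by (rule Cons.IH, rule Cons.prems) auto
  moreover have "split_sum xs (\<lambda>A B. signed (fst x * total_degree A) (\<phi> A (x # B))) = split_sum xs (\<lambda>A B. 0)"
  proof (rule split_sum_cong, goal_cases)
    case (1 A B)
    have "\<phi> A (x # B) = 0" by (rule Cons.prems) (use 1 in auto)
    then show ?case by simp
  qed
  ultimately show ?case by simp
qed simp

text \<open>Splitting the set of blocks of a partition of a set amounts to splitting the set and
  partitioning both parts.\<close>

lemma part_sum_split_sum:
  assumes "\<And>B. fst (g B) = total_degree B"
  shows "part_sum xs (\<lambda>Bs. split_sum (map g Bs) \<phi>) =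
    split_sum xs (\<lambda>E D. part_sum E (\<lambda>As. part_sum D (\<lambda>Ds. \<phi> (map g As) (map g Ds))))"
proof (induction xs arbitrary: \<phi> rule: measure_induct_rule[of length])
  case (less xs)
  show ?case
  proof (cases xs)
    case (Cons x ys)
    define \<Theta> where "\<Theta> A E D = part_sum E (\<lambda>As. part_sum D (\<lambda>Ds. \<phi> (map g As) (g (x # A) # map g Ds)))"
        for A E D
    have td: "total_degree (map g As) = total_degree (concat As)" for As
      by (induction As) (auto simp: assms)
    have 1: "part_sum B (\<lambda>Bs. split_sum (map g Bs) (\<lambda>As Ds. \<phi> (g (x # A) # As) Ds)) =
        split_sum B (\<lambda>E D. part_sum E (\<lambda>As. part_sum D (\<lambda>Ds. \<phi> (g (x # A) # map g As) (map g Ds))))"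
      if "length A + length B = length ys" for A B
      using that Cons by (intro less) auto
    have 2: "part_sum B (\<lambda>Bs. split_sum (map g Bs) (\<lambda>As Ds. signed (fst (g (x # A)) * total_degree As)
        (\<phi> As (g (x # A) # Ds)))) =
        split_sum B (\<lambda>E D. signed ((fst x + total_degree A) * total_degree E) (\<Theta> A E D))"
      if "length A + length B = length ys" for A B
    proof -
      have "part_sum B (\<lambda>Bs. split_sum (map g Bs) (\<lambda>As Ds. signed (fst (g (x # A)) * total_degree As)
          (\<phi> As (g (x # A) # Ds)))) =
        split_sum B (\<lambda>E D. part_sum E (\<lambda>As. part_sum D (\<lambda>Ds. signed (fst (g (x # A))
            * total_degree (map g As)) (\<phi> (map g As) (g (x # A) # map g Ds)))))"
        using that Cons by (intro less) auto
      also have "\<dots> = split_sum B (\<lambda>E D. signed ((fst x + total_degree A) * total_degree E) (\<Theta> A E D))"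
        unfolding \<Theta>_def part_sum_signed[symmetric]
        by (intro split_sum_cong part_sum_cong) (simp add: td assms)
      finally show ?thesis .
    qed
    have 3: "part_sum B (\<lambda>Bs. split_sum (map g ((x # A) # Bs)) \<phi>) =
        split_sum B (\<lambda>E D. part_sum E (\<lambda>As. part_sum D (\<lambda>Ds. \<phi> (g (x # A) # map g As) (map g Ds)))) +
        split_sum B (\<lambda>E D. signed ((fst x + total_degree A) * total_degree E) (\<Theta> A E D))"
      if "length A + length B = length ys" for A B
      unfolding 1[OF that, symmetric] 2[OF that, symmetric] part_sum_add[symmetric] by simp
    have "part_sum xs (\<lambda>Bs. split_sum (map g Bs) \<phi>) =
       split_sum ys (\<lambda>A B. split_sum B (\<lambda>E D. part_sum E (\<lambda>As. part_sum D (\<lambda>Ds. \<phi> (g (x # A) # map g As)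
           (map g Ds)))))
       + split_sum ys (\<lambda>A B. split_sum B (\<lambda>E D. signed ((fst x + total_degree A) * total_degree E)
           (\<Theta> A E D)))"
      unfolding split_sum_add[of ys, symmetric] Cons part_sum.simps
      by (intro split_sum_cong 3)
    \<comment> \<open>These are the terms with the block of \<open>x\<close> on the right.
      Exchanging the rest \<open>A\<close> of that block with \<open>E\<close> gives the second
      summand in the recursion of \<open>split_sum\<close>.\<close>
    also have "split_sum ys (\<lambda>A B. split_sum B (\<lambda>E D. signed ((fst x + total_degree A) * total_degree E)
        (\<Theta> A E D))) =
       split_sum ys (\<lambda>E D. signed (fst x * total_degree E) (split_sum D (\<lambda>A D'. \<Theta> A E D')))"
      unfolding split_sum_signed[symmetric]
      by (subst split_sum_swap) (auto simp: algebra_simps intro!: split_sum_cong signed_cong)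
    finally show ?thesis
      unfolding Cons split_sum.simps part_sum.simps split_sum_coassoc \<Theta>_def
      by (simp add: part_sum_split_sum_interchange)
  qed simp
qed

section \<open>Compositions of families of operations\<close>

text \<open>In contrast to \<open>homogeneous\<close>, the components form an arbitrary family, so
  that a shift of degrees can be built in.\<close>

definition hom :: "(int \<Rightarrow> 'm set) \<Rightarrow> (int \<times> 'm) list \<Rightarrow> bool" where
  "hom C xs \<longleftrightarrow> (\<forall>z\<in>set xs. snd z \<in> C (fst z))"

lemma hom_simps [simp]:
  "hom C []" "hom C (z # xs) \<longleftrightarrow> snd z \<in> C (fst z) \<and> hom C xs"
  "hom C (xs @ ys) \<longleftrightarrow> hom C xs \<and> hom C ys"
  by (auto simp: hom_def)

lemma hom_subset: "hom C xs \<Longrightarrow> set ys \<subseteq> set xs \<Longrightarrow> hom C ys"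
  by (auto simp: hom_def)

definition ops_degree :: "(int \<Rightarrow> 'm set) \<Rightarrow> (int \<Rightarrow> 'n set) \<Rightarrow> int \<Rightarrow> ('m, 'n) ops \<Rightarrow> bool" where
  "ops_degree C D k g \<longleftrightarrow> (\<forall>xs. xs \<noteq> [] \<longrightarrow> hom C xs \<longrightarrow> g xs \<in> D (total_degree xs + k))"

definition ops_symmetric :: "(int \<Rightarrow> 'm set) \<Rightarrow> ('m, 'n::ab_group_add) ops \<Rightarrow> bool" where
  "ops_symmetric C g \<longleftrightarrow> (\<forall>us x y vs. hom C (us @ x # y # vs) \<longrightarrow>
     g (us @ x # y # vs) = signed (fst x * fst y) (g (us @ y # x # vs)))"

text \<open>The first argument is the one on which the recursions operate; symmetry carries
  additivity to the others.\<close>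

definition ops_additive :: "(int \<Rightarrow> 'm::ab_group_add set) \<Rightarrow> ('m, 'n::ab_group_add) ops \<Rightarrow> bool" where
  "ops_additive C g \<longleftrightarrow> (\<forall>d x y vs. x \<in> C d \<longrightarrow> y \<in> C d \<longrightarrow> hom C vs \<longrightarrow>
     g ((d, x + y) # vs) = g ((d, x) # vs) + g ((d, y) # vs))"

text \<open>Precomposition of \<open>h\<close> with the coderivation extending \<open>q\<close>. The
  degree \<open>c\<close> of \<open>q\<close> is a parameter because the output of \<open>q\<close>,
  as an argument of \<open>h\<close>, has to carry its degree. Empty \<open>A\<close> is skipped
  since there is no bracket without arguments.\<close>

definition compose_ops :: "('m, 'n::ab_group_add) ops \<Rightarrow> int \<Rightarrow> ('m, 'm) ops \<Rightarrow> ('m, 'n) ops" where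
  "compose_ops h c q xs =
     split_sum xs (\<lambda>A B. if A = [] then 0 else h ((total_degree A + c, q A) # B))"

text \<open>The part of \<open>compose_ops\<close> with unary \<open>q\<close>, that is, the
  differential acting on the arguments of \<open>h\<close>.\<close>

definition compose_unary :: "('m, 'n::ab_group_add) ops \<Rightarrow> int \<Rightarrow> ('m, 'm) ops \<Rightarrow> ('m, 'n) ops" where
  "compose_unary h c q xs =
     split_sum xs (\<lambda>A B. if length A = 1 then h ((total_degree A + c, q A) # B) else 0)"

abbreviation blocks :: "('m, 'n) ops \<Rightarrow> (int \<times> 'm) list list \<Rightarrow> (int \<times> 'n) list" where
  "blocks F Bs \<equiv> map (\<lambda>B. (total_degree B, F B)) Bs"

text \<open>Precomposition of \<open>h\<close> with the coalgebra morphism extending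
  \<open>F\<close>.\<close>

definition push_ops :: "('n, 'q::ab_group_add) ops \<Rightarrow> ('m, 'n) ops \<Rightarrow> ('m, 'q) ops" where
  "push_ops h F xs = part_sum xs (\<lambda>Bs. h (blocks F Bs))"

text \<open>Precomposition of \<open>h\<close> with a coderivation along that morphism: one block
  goes through \<open>G\<close>, of degree \<open>c\<close>, and all others through
  \<open>F\<close>.\<close>

definition push_along ::
  "('n, 'q::ab_group_add) ops \<Rightarrow> int \<Rightarrow> ('m, 'n) ops \<Rightarrow> ('m, 'n) ops \<Rightarrow> ('m, 'q) ops" where
  "push_along h c G F xs = split_sum xs (\<lambda>E D. if E = [] then 0 else
     part_sum D (\<lambda>Bs. h ((total_degree E + c, G E) # blocks F Bs)))"

lemma ops_degreeD: "ops_degree C D k g \<Longrightarrow> xs \<noteq> [] \<Longrightarrow> hom C xs \<Longrightarrow> g xs \<in> D (total_degree xs + k)"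
  by (auto simp: ops_degree_def)

lemma ops_symmetricD: "ops_symmetric C g \<Longrightarrow> hom C (us @ x # y # vs) \<Longrightarrow>
     g (us @ x # y # vs) = signed (fst x * fst y) (g (us @ y # x # vs))"
  unfolding ops_symmetric_def by blast

lemma ops_additive_on:
  assumes "ops_additive C g" "\<And>d. subgroup_set (C d)" "hom C vs"
  shows "additive_on (C d) (\<lambda>x. g ((d, x) # vs))"
  using assms by (auto simp: ops_additive_def additive_on_def)

lemma ops_additive_0:
  assumes "ops_additive C g" "\<And>d. subgroup_set (C d)" "hom C vs"
  shows "g ((d, 0) # vs) = 0"
  using additive_on_0[OF ops_additive_on[OF assms]] .

lemma hom_blocks:
  assumes "ops_degree C D 0 F" "hom C (concat Bs)" "[] \<notin> set Bs"
  shows "hom D (blocks F Bs)"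
  using assms(2,3) by (induction Bs) (use ops_degreeD[OF assms(1)] in force)+

lemma total_degree_blocks: "total_degree (blocks F Bs) = total_degree (concat Bs)"
  by (induction Bs) auto

section \<open>Degree and symmetry of composites\<close>

lemma compose_ops_degree:
  assumes "ops_degree C D k h" "ops_degree C C c q" "\<And>d. subgroup_set (D d)"
  shows "ops_degree C D (k + c) (compose_ops h c q)"
  unfolding ops_degree_def compose_ops_def
proof (intro allI impI, rule split_sum_mem, rule assms(3), goal_cases)
  case (1 xs A B)
  show ?case
  proof (cases "A = []")
    case True
    then show ?thesis using assms(3)[of "total_degree xs + (k + c)"] by (simp add: subgroup_set_def)
  next
    case False
    have *: "hom C A" "hom C B" using 1 hom_subset[of C xs] by auto
    have "hom C ((total_degree A + c, q A) # B)"
      using * ops_degreeD[OF assms(2) False] by simp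
    from ops_degreeD[OF assms(1) _ this] 1(5)[symmetric] show ?thesis
      using False by (simp add: algebra_simps)
  qed
qed

lemma push_ops_degree:
  assumes "ops_degree D E k h" "ops_degree C D 0 F" "\<And>d. subgroup_set (E d)"
  shows "ops_degree C E k (push_ops h F)"
  unfolding ops_degree_def push_ops_def
proof (intro allI impI, rule part_sum_mem, rule assms(3), goal_cases)
  case (1 xs Bs)
  have "hom D (blocks F Bs)"
    by (rule hom_blocks[OF assms(2)]) (use 1 hom_subset[of C xs] in auto)
  moreover have "blocks F Bs \<noteq> []" using 1 by auto
  ultimately show ?case using ops_degreeD[OF assms(1), of "blocks F Bs"] 1
    by (simp add: total_degree_blocks)
qed

lemma compose_ops_symmetric:
  assumes "ops_symmetric C h" "ops_symmetric C q" "ops_degree C C c q" "ops_additive C h"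
    and "\<And>d. subgroup_set (C d)"
  shows "ops_symmetric C (compose_ops h c q)"
  unfolding ops_symmetric_def compose_ops_def
proof (intro allI impI, rule split_sum_adjacent, goal_cases)
  case (1 us x y vs us' vs' B)
  then have *: "hom C (us' @ x # y # vs')" "hom C B"
    using hom_subset[of C "us @ x # y # vs" "us' @ x # y # vs'"] hom_subset[of C "us @ x # y # vs" B] by auto
  from ops_symmetricD[OF assms(2) *(1)] have
    eq: "q (us' @ x # y # vs') = signed (fst x * fst y) (q (us' @ y # x # vs'))" .
  let ?d = "total_degree (us' @ y # x # vs') + c"
  have "q (us' @ y # x # vs') \<in> C ?d"
    by (rule ops_degreeD[OF assms(3)]) (use * in auto)
  with additive_on_signed[OF ops_additive_on[OF assms(4,5) *(2)], of _ ?d "fst x * fst y"]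
  show ?case by (simp add: eq algebra_simps)
next
  case (2 us x y vs us' vs' A)
  then have *: "hom C (us' @ x # y # vs')" "hom C A"
    using hom_subset[of C "us @ x # y # vs" "us' @ x # y # vs'"] hom_subset[of C "us @ x # y # vs" A] by auto
  show ?case
  proof (cases "A = []")
    case False
    with * ops_degreeD[OF assms(3), of A]
    have "hom C (((total_degree A + c, q A) # us') @ x # y # vs')" by auto
    from ops_symmetricD[OF assms(1) this] False show ?thesis by simp
  qed simp
qed

text \<open>Two inserted copies of \<open>q\<close> are either nested or disjoint. The nested
  insertions make up the right side by coassociativity. The disjoint ones occur in both orders with
  opposite signs, because \<open>q\<close> is odd; their sum equals its own negative and vanishes in
  the absence of 2-torsion.\<close>

lemma compose_compose:
  assumes "\<And>y :: 'n::ab_group_add. y + y = 0 \<Longrightarrow> y = 0"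
    and C: "\<And>d. subgroup_set (C d)"
    and q: "ops_degree C C 1 q"
    and h: "ops_symmetric C h" "ops_additive C h"
    and xs: "hom C xs"
  shows "compose_ops (compose_ops h 1 q) 1 q xs = compose_ops (h :: ('m::ab_group_add, 'n) ops)
      2 (compose_ops q 1 q) xs"
proof -
  let ?z = "\<lambda>A. (total_degree A + 1, q A)"
  \<comment> \<open>\<open>?X\<close> collects the nested insertions, \<open>?Y\<close> the disjoint
    ones.\<close>
  let ?X = "\<lambda>A C D. if A = [] then 0 else h ((total_degree A + total_degree C + 2, q (?z A # C)) # D)"
  let ?Y = "\<lambda>A C D. if A = [] \<or> C = [] then 0 else
      signed ((total_degree A + 1) * total_degree C) (h (?z C # ?z A # D))"
  let ?Ys = "split_sum xs (\<lambda>A B. split_sum B (\<lambda>C D. ?Y A C D))"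
  have "compose_ops (compose_ops h 1 q) 1 q xs =
      split_sum xs (\<lambda>A B. split_sum B (\<lambda>C D. ?X A C D) + split_sum B (\<lambda>C D. ?Y A C D))"
    unfolding compose_ops_def
  proof (intro split_sum_cong, goal_cases)
    case (1 A B)
    show ?case
    proof (cases "A = []")
      case False
      have "split_sum B (\<lambda>C D. if ?z A # C = [] then 0 else h ((total_degree (?z A # C) +
          1, q (?z A # C)) # D)) =
          split_sum B (\<lambda>C D. ?X A C D)"
        by (intro split_sum_cong) (use False in \<open>simp add: ac_simps\<close>)
      moreover have "split_sum B (\<lambda>C D. signed (fst (?z A) * total_degree C) (if C = []
          then 0 else h (?z C # ?z A # D))) =
          split_sum B (\<lambda>C D. ?Y A C D)"
        by (intro split_sum_cong) (use False in simp)
      ultimately show ?thesis using False by (simp only: if_False split_sum.simps)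
    qed simp
  qed
  also have "\<dots> = split_sum xs (\<lambda>A B. split_sum B (\<lambda>C D. ?X A C D)) + ?Ys"
    by (rule split_sum_add)
  also have "?Ys = 0"
  proof -
    have "?Ys = split_sum xs (\<lambda>A B. split_sum B (\<lambda>C D. signed (total_degree A * total_degree C) (?Y C A D)))"
      by (rule split_sum_swap)
    also have "\<dots> = split_sum xs (\<lambda>A B. split_sum B (\<lambda>C D. - ?Y A C D))"
    proof (intro split_sum_cong, goal_cases)
      case (1 A B E D)
      show ?case
      proof (cases "A = [] \<or> E = []")
        case False
        have "hom C A" "hom C E" "hom C D" using 1 xs hom_subset[of C xs] by auto
        then have "hom C ([] @ ?z A # ?z E # D)"
          using False ops_degreeD[OF q] by auto
        from ops_symmetricD[OF h(1) this]
        have "h (?z A # ?z E # D) = signed ((total_degree A + 1) * (total_degree E + 1))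
            (h (?z E # ?z A # D))"
          by simp
        then show ?thesis
          using False by (auto simp: algebra_simps intro!: signed_minus_cong)
      qed auto
    qed
    also have "\<dots> = - ?Ys"
      by (simp only: split_sum_minus)
    finally show ?thesis by (rule assms(1)[OF eq_neg_iff_add_eq_0[THEN iffD1]])
  qed
  also have "split_sum xs (\<lambda>A B. split_sum B (\<lambda>C D. ?X A C D)) =
      split_sum xs (\<lambda>E D. split_sum E (\<lambda>A C. ?X A C D))"
    by (rule split_sum_coassoc)
  also have "\<dots> = compose_ops h 2 (compose_ops q 1 q) xs"
    unfolding compose_ops_def
  proof (intro split_sum_cong, goal_cases)
    case (1 E D)
    have homs: "hom C E" "hom C D" using 1 xs hom_subset[of C xs] by auto
    show ?case
    proof (cases "E = []")
      case False
      let ?d = "total_degree E + 2"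
      have "h ((?d, split_sum E (\<lambda>A B. if A = [] then 0 else q (?z A # B))) # D) =
          split_sum E (\<lambda>A B. h ((?d, if A = [] then 0 else q (?z A # B)) # D))"
      proof (rule split_sum_additive(2)[OF ops_additive_on[OF h(2) C homs(2)]], goal_cases)
        case (1 A B)
        then have "hom C A" "hom C B" using homs hom_subset[of C E] by auto
        then have "A \<noteq> [] \<Longrightarrow> hom C (?z A # B)" using ops_degreeD[OF q] by auto
        from ops_degreeD[OF q _ this] show ?case
          using C[of ?d] 1 by (auto simp: subgroup_set_def algebra_simps)
      qed
      also have "\<dots> = split_sum E (\<lambda>A C. ?X A C D)"
        by (intro split_sum_cong) (auto simp: ops_additive_0[OF h(2) C homs(2)])
      finally show ?thesis using False by simp
    qed simp
  qed
  finally show ?thesis by simp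
qed

text \<open>The output of \<open>q\<close> stands at the head of the list, so
  \<open>part_sum\<close> puts it into the first block. Coassociativity then joins its arguments
  with the rest of that block, which is the argument list of \<open>F \<circ> q\<close>.\<close>

lemma compose_push:
  assumes C: "\<And>d. subgroup_set (C d)" and D: "\<And>d. subgroup_set (D d)"
    and q: "ops_degree C C 1 q" and F: "ops_degree C D 0 F" and h: "ops_additive D h"
    and xs: "hom C xs"
  shows "compose_ops (push_ops h F) 1 q xs = push_along h 1 (compose_ops F 1 q) F xs"
proof -
  let ?z = "\<lambda>A. (total_degree A + 1, q A)"
  let ?X = "\<lambda>A E G. if A = [] then 0 else
    part_sum G (\<lambda>Bs. h ((total_degree A + total_degree E + 1, F (?z A # E)) # blocks F Bs))"
  have "compose_ops (push_ops h F) 1 q xs = split_sum xs (\<lambda>A B. split_sum B (\<lambda>E G. ?X A E G))"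
    unfolding compose_ops_def push_ops_def by (intro split_sum_cong) (auto simp: ac_simps)
  also have "\<dots> = split_sum xs (\<lambda>K G. split_sum K (\<lambda>A E. ?X A E G))"
    by (rule split_sum_coassoc)
  also have "\<dots> = push_along h 1 (compose_ops F 1 q) F xs"
    unfolding compose_ops_def push_along_def
  proof (intro split_sum_cong, goal_cases)
    case (1 K G)
    have homs: "hom C K" "hom C G" using 1 xs hom_subset[of C xs] by auto
    show ?case
    proof (cases "K = []")
      case False
      let ?d = "total_degree K + 1"
      have "part_sum G (\<lambda>Bs. h ((?d, split_sum K (\<lambda>A B. if A = [] then 0 else F (?z A # B))) # blocks F Bs)) =
         part_sum G (\<lambda>Bs. split_sum K (\<lambda>A B. h ((?d, if A = [] then 0 else F (?z A # B)) # blocks F Bs)))"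
      proof (intro part_sum_cong, goal_cases)
        case (1 Bs)
        have hB: "hom D (blocks F Bs)" by (rule hom_blocks[OF F]) (use 1 homs hom_subset[of C G] in auto)
        show ?case
        proof (rule split_sum_additive(2)[OF ops_additive_on[OF h D hB]], goal_cases)
          case (1 A B)
          then have "hom C A" "hom C B" using homs hom_subset[of C K] by auto
          then have "A \<noteq> [] \<Longrightarrow> hom C (?z A # B)" using ops_degreeD[OF q] by auto
          from ops_degreeD[OF F _ this] show ?case
            using D[of ?d] 1 by (auto simp: subgroup_set_def algebra_simps)
        qed
      qed
      also have "\<dots> = part_sum G (\<lambda>Bs. split_sum K (\<lambda>A E. if A = [] then 0 else
          h ((total_degree A + total_degree E + 1, F (?z A # E)) # blocks F Bs)))"
        apply (intro part_sum_cong split_sum_cong)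
        subgoal for Bs A E
          using ops_additive_0[OF h D hom_blocks[OF F, of Bs]] homs hom_subset[of C G "concat Bs"] by auto
        done
      also have "\<dots> = split_sum K (\<lambda>A E. ?X A E G)"
        unfolding part_sum_split_sum_interchange by (intro split_sum_cong) auto
      finally show ?thesis using False by simp
    qed simp
  qed
  finally show ?thesis .
qed

text \<open>Splitting the set of blocks amounts to splitting the arguments and partitioning both
  parts, so an inner \<open>h\<close> with its blocks is a single output inserted along
  \<open>F\<close>.\<close>

lemma push_along_push:
  assumes D: "\<And>d. subgroup_set (D d)" and F: "ops_degree C D 0 F"
    and h: "ops_additive D h" "ops_degree D D 1 h" and xs: "hom C xs"
  shows "push_along h 1 (push_ops h F) F xs = push_ops (compose_ops h 1 h) F xs"
proof -
  have "push_ops (compose_ops h 1 h) F xs =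
      split_sum xs (\<lambda>E G. part_sum E (\<lambda>As. part_sum G (\<lambda>Ds. if blocks F As = [] then 0 else
        h ((total_degree (blocks F As) + 1, h (blocks F As)) # blocks F Ds))))"
    unfolding push_ops_def compose_ops_def by (rule part_sum_split_sum) simp
  also have "\<dots> = push_along h 1 (push_ops h F) F xs"
    unfolding push_along_def push_ops_def
  proof (intro split_sum_cong, goal_cases)
    case (1 E G)
    have homs: "hom C E" "hom C G" using 1 xs hom_subset[of C xs] by auto
    show ?case
    proof (cases "E = []")
      case False
      let ?d = "total_degree E + 1"
      have "part_sum E (\<lambda>As. part_sum G (\<lambda>Ds. if blocks F As = [] then 0 else
          h ((total_degree (blocks F As) + 1, h (blocks F As)) # blocks F Ds))) =
        part_sum E (\<lambda>As. part_sum G (\<lambda>Ds. h ((?d, h (blocks F As)) # blocks F Ds)))"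
        apply (intro part_sum_cong)
        subgoal for As Ds using False by (auto simp: total_degree_blocks)
        done
      also have "\<dots> = part_sum G (\<lambda>Ds. part_sum E (\<lambda>As. h ((?d, h (blocks F As)) # blocks F Ds)))"
        by (rule part_sum_interchange[symmetric])
      also have "\<dots> = part_sum G (\<lambda>Ds. h ((?d, part_sum E (\<lambda>As. h (blocks F As))) # blocks F Ds))"
      proof (intro part_sum_cong, goal_cases)
        case (1 Ds)
        have hB: "hom D (blocks F Ds)" by (rule hom_blocks[OF F]) (use 1 homs hom_subset[of C G] in auto)
        show ?case
        proof (rule part_sum_additive(2)[OF ops_additive_on[OF h(1) D hB], symmetric], goal_cases)
          case (1 As)
          have "hom D (blocks F As)" by (rule hom_blocks[OF F]) (use 1 homs hom_subset[of C E] in auto)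
          moreover have "blocks F As \<noteq> []" using 1 False by auto
          ultimately show ?case using ops_degreeD[OF h(2), of "blocks F As"] 1
            by (simp add: total_degree_blocks)
        qed
      qed
      finally show ?thesis using False by simp
    qed simp
  qed
  finally show ?thesis by simp
qed

section \<open>Cocycle identities for curvature and defect\<close>

lemma part_sum_diff: "part_sum xs (\<lambda>Bs. \<phi> Bs - \<psi> Bs) = part_sum xs \<phi> - part_sum xs \<psi>"
  using part_sum_add[of xs \<phi> "\<lambda>Bs. - \<psi> Bs"] by (simp add: part_sum_minus)

lemma push_along_diff:
  assumes D: "\<And>d. subgroup_set (D d)" and F: "ops_degree C D 0 F" and h: "ops_additive D h"
    and G: "ops_degree C D c G" "ops_degree C D c G'" and xs: "hom C xs"
  shows "push_along h c (\<lambda>xs. G xs - G' xs) F xs = push_along h c G F xs - push_along h c G' F xs"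
  unfolding push_along_def split_sum_diff[symmetric]
proof (intro split_sum_cong, goal_cases)
  case (1 A B)
  have homs: "hom C A" "hom C B" using 1 xs hom_subset[of C xs] by auto
  show ?case
  proof (cases "A = []")
    case False
    have "part_sum B (\<lambda>Bs. h ((total_degree A + c, G A - G' A) # blocks F Bs)) =
      part_sum B (\<lambda>Bs. h ((total_degree A + c, G A) # blocks F Bs) - h ((total_degree A + c, G' A)
          # blocks F Bs))"
    proof (intro part_sum_cong, goal_cases)
      case (1 Bs)
      have hB: "hom D (blocks F Bs)" by (rule hom_blocks[OF F]) (use 1 homs hom_subset[of C B] in auto)
      show ?case
        using additive_on_diff[OF ops_additive_on[OF h D hB]] ops_degreeD[OF G(1) False homs(1)]
          ops_degreeD[OF G(2) False homs(1)] by simp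
    qed
    then show ?thesis using False by (simp add: part_sum_diff)
  qed simp
qed

text \<open>The Bianchi identity. In
  \<open>(q \<circ> q) \<circ> q = q \<circ> (q \<circ> q)\<close> the vanishing in lower arities
  leaves the terms with unary inner \<open>q\<close> on the left and the one with unary outer
  \<open>q\<close> on the right.\<close>

lemma curvature_cocycle:
  assumes "\<And>y :: 'm::ab_group_add. y + y = 0 \<Longrightarrow> y = 0"
    and C: "\<And>d. subgroup_set (C d)"
    and q: "ops_degree C C 1 q" "ops_symmetric C q" "ops_additive C q"
    and xs: "hom C xs" "xs \<noteq> []"
    and low: "\<And>ys. hom C ys \<Longrightarrow> ys \<noteq> [] \<Longrightarrow> length ys < length xs \<Longrightarrow> compose_ops q 1 q ys = 0"
  shows "q [(total_degree xs + 2, compose_ops q 1 q xs)] =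
    compose_unary (compose_ops q 1 q) 1 (q :: ('m, 'm) ops) xs"
proof -
  have "compose_unary (compose_ops q 1 q) 1 q xs = compose_ops (compose_ops q 1 q) 1 q xs"
    unfolding compose_unary_def compose_ops_def[of "compose_ops q 1 q"]
  proof (intro split_sum_cong, goal_cases)
    case (1 A B)
    have homs: "hom C A" "hom C B" using 1 xs hom_subset[of C xs] by auto
    then have "A \<noteq> [] \<Longrightarrow> hom C ((total_degree A + 1, q A) # B)"
      using ops_degreeD[OF q(1)] by auto
    \<comment> \<open>If \<open>A\<close> has at least two elements, the outer curvature has fewer
      arguments than \<open>xs\<close> and vanishes.\<close>
    with low[of "(total_degree A + 1, q A) # B"] 1 show ?case
      by (cases A; cases "tl A") auto
  qed
  also have "\<dots> = compose_ops q 2 (compose_ops q 1 q) xs"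
    by (rule compose_compose[OF assms(1) C q xs(1)])
  also have "\<dots> = q [(total_degree xs + 2, compose_ops q 1 q xs)]"
    unfolding compose_ops_def[of q 2]
  proof (subst split_sum_all_left, goal_cases)
    case (1 A B)
    have homs: "hom C A" "hom C B" using 1 xs hom_subset[of C xs] by auto
    show ?case
      using low[of A] 1 homs ops_additive_0[OF q(3) C homs(2)] by (cases B) auto
  qed (use xs in simp)
  finally show ?thesis by simp
qed

definition morphism_defect :: "('m, 'm) ops \<Rightarrow> ('n, 'n) ops \<Rightarrow> ('m, 'n::ab_group_add) ops \<Rightarrow> ('m, 'n) ops" where
  "morphism_defect q h F xs = compose_ops F 1 q xs - push_ops h F xs"

text \<open>Compose the defect with \<open>q\<close> once more. \<open>F \<circ> q \<circ> q\<close>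
  reduces to the unary part of \<open>F\<close> on the curvature. In
  \<open>h \<circ> F \<circ> q\<close> the composite \<open>F \<circ> q\<close> is inserted along
  \<open>F\<close>; it is the defect plus \<open>h \<circ> F\<close>, and the latter contributes
  \<open>h \<circ> h \<circ> F = 0\<close>. Together with \<open>curvature_cocycle\<close> this is
  the cocycle condition in the cone.\<close>

lemma morphism_defect_cocycle:
  fixes q :: "('m::ab_group_add, 'm) ops" and F :: "('m, 'n::ab_group_add) ops"
  assumes half: "\<And>y :: 'n. y + y = 0 \<Longrightarrow> y = 0"
    and C: "\<And>d. subgroup_set (C d)" and D: "\<And>d. subgroup_set (D d)"
    and q: "ops_degree C C 1 q"
    and F: "ops_degree C D 0 F" "ops_symmetric C F" "ops_additive C F"
    and h: "ops_degree D D 1 h" "ops_additive D h"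
    and flat: "\<And>ys. hom D ys \<Longrightarrow> ys \<noteq> [] \<Longrightarrow> compose_ops h 1 h ys = 0"
    and xs: "hom C xs" "xs \<noteq> []"
    and low_q: "\<And>ys. hom C ys \<Longrightarrow> ys \<noteq> [] \<Longrightarrow> length ys < length xs \<Longrightarrow> compose_ops q 1 q ys = 0"
    and low: "\<And>ys. hom C ys \<Longrightarrow> ys \<noteq> [] \<Longrightarrow> length ys < length xs \<Longrightarrow> morphism_defect q h F ys = 0"
  shows "F [(total_degree xs + 2, compose_ops q 1 q xs)] - h [(total_degree xs +
      1, morphism_defect q h F xs)] =
    compose_unary (morphism_defect q h F) 1 q xs"
proof -
  have "compose_unary (morphism_defect q h F) 1 q xs = compose_ops (morphism_defect q h F) 1 q xs"
    unfolding compose_unary_def compose_ops_def[of "morphism_defect q h F"]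
  proof (intro split_sum_cong, goal_cases)
    case (1 A B)
    have homs: "hom C A" "hom C B" using 1 xs hom_subset[of C xs] by auto
    then have "A \<noteq> [] \<Longrightarrow> hom C ((total_degree A + 1, q A) # B)"
      using ops_degreeD[OF q(1)] by auto
    with low[of "(total_degree A + 1, q A) # B"] 1 show ?case
      by (cases A; cases "tl A") auto
  qed
  also have "\<dots> = compose_ops (compose_ops F 1 q) 1 q xs - compose_ops (push_ops h F) 1 q xs"
    unfolding compose_ops_def[of "morphism_defect q h F"] compose_ops_def[of "compose_ops F 1 q"]
      compose_ops_def[of "push_ops h F"] split_sum_diff[symmetric]
    by (intro split_sum_cong) (simp add: morphism_defect_def)
  also have "compose_ops (compose_ops F 1 q) 1 q xs = compose_ops F 2 (compose_ops q 1 q) xs"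
    by (rule compose_compose[OF half C q F(2,3) xs(1)])
  also have "\<dots> = F [(total_degree xs + 2, compose_ops q 1 q xs)]"
    unfolding compose_ops_def[of F 2]
  proof (subst split_sum_all_left, goal_cases)
    case (1 A B)
    have homs: "hom C A" "hom C B" using 1 xs hom_subset[of C xs] by auto
    show ?case
      using low_q[of A] 1 homs ops_additive_0[OF F(3) C homs(2)] by (cases B) auto
  qed (use xs in simp)
  also have "compose_ops (push_ops h F) 1 q xs = push_along h 1 (compose_ops F 1 q) F xs"
    by (rule compose_push[OF C D q F(1) h(2) xs(1)])
  also have "push_along h 1 (compose_ops F 1 q) F xs =
      push_along h 1 (morphism_defect q h F) F xs + push_along h 1 (push_ops h F) F xs"
  proof -
    have "push_along h 1 (\<lambda>xs. compose_ops F 1 q xs - push_ops h F xs) F xs =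
        push_along h 1 (compose_ops F 1 q) F xs - push_along h 1 (push_ops h F) F xs"
      by (rule push_along_diff[OF D F(1) h(2) _ _ xs(1)])
        (use compose_ops_degree[OF F(1) q D] push_ops_degree[OF h(1) F(1) D] in auto)
    then show ?thesis unfolding morphism_defect_def[abs_def] by simp
  qed
  also have "push_along h 1 (push_ops h F) F xs = 0"
  proof -
    have "push_along h 1 (push_ops h F) F xs = part_sum xs (\<lambda>Bs. compose_ops h 1 h (blocks F Bs))"
      unfolding push_along_push[OF D F(1) h(2,1) xs(1)] push_ops_def ..
    also have "\<dots> = part_sum xs (\<lambda>Bs. 0)"
    proof (intro part_sum_cong, goal_cases)
      case (1 Bs)
      have "hom D (blocks F Bs)" by (rule hom_blocks[OF F(1)]) (use 1 xs hom_subset[of C xs] in auto)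
      moreover have "blocks F Bs \<noteq> []" using 1 xs by auto
      ultimately show ?case by (rule flat)
    qed
    finally show ?thesis by simp
  qed
  also have "push_along h 1 (morphism_defect q h F) F xs = h [(total_degree xs +
      1, morphism_defect q h F xs)]"
    unfolding push_along_def
  proof (subst split_sum_all_left, goal_cases)
    case (1 A B)
    have homs: "hom C A" "hom C B" using 1 xs hom_subset[of C xs] by auto
    show ?case
    proof (cases "A = []")
      case False
      have "part_sum B (\<lambda>Bs. h ((total_degree A + 1, morphism_defect q h F A) # blocks F Bs)) =
          part_sum B (\<lambda>Bs. 0)"
      proof (intro part_sum_cong, goal_cases)
        case prems: (1 Bs)
        have "hom D (blocks F Bs)" by (rule hom_blocks[OF F(1)]) (use prems homs hom_subset[of C B] in auto)
        from ops_additive_0[OF h(2) D this] low[of A] 1 homs False show ?case by (cases B) auto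
      qed
      then show ?thesis by simp
    qed simp
  qed (use xs in simp)
  finally show ?thesis by simp
qed

section \<open>Unshuffles and partitions as sets of positions\<close>

lemma koszul_Nil [simp]: "koszul ds [] = 0"
  by (simp add: koszul_def)

lemma koszul_Cons:
  "koszul ds (x # p) = (\<Sum>b\<leftarrow>p. if b < x then ds ! x * ds ! b else 0) + koszul ds p"
proof -
  let ?S = "\<lambda>p. {(a, b). a < b \<and> b < length p \<and> p ! b < p ! a}"
  let ?g = "\<lambda>p (a, b). ds ! (p ! a) * ds ! (p ! b)"
  let ?T = "{b. b < length p \<and> p ! b < x}"
  have fin: "finite (?S p)"
    by (rule finite_subset[of _ "{..<length p} \<times> {..<length p}"]) auto
  \<comment> \<open>An inversion either involves the head or is one of the tail.\<close>
  have S: "?S (x # p) = (\<lambda>b. (0, Suc b)) ` ?T \<union> (\<lambda>(a, b). (Suc a, Suc b)) ` ?S p" (is "?L = ?R")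
  proof (intro set_eqI iffI)
    fix z assume "z \<in> ?L"
    then obtain a b where z: "z = (a, b)" "a < b" "b < Suc (length p)" "(x # p) ! b < (x # p) ! a" by auto
    then obtain b' where b: "b = Suc b'" by (cases b) auto
    show "z \<in> ?R"
      using z b by (cases a) (auto simp: image_iff)
  qed auto
  have "koszul ds (x # p) = sum (?g (x # p)) ((\<lambda>b. (0, Suc b)) ` ?T) + sum (?g (x # p))
      ((\<lambda>(a, b). (Suc a, Suc b)) ` ?S p)"
    unfolding koszul_def S by (rule sum.union_disjoint) (use fin in auto)
  also have "sum (?g (x # p)) ((\<lambda>b. (0, Suc b)) ` ?T) = (\<Sum>b\<in>?T. ds ! x * ds ! (p ! b))"
    by (subst sum.reindex) (auto simp: inj_on_def)
  also have "\<dots> = (\<Sum>b<length p. if p ! b < x then ds ! x * ds ! (p ! b) else 0)"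
    by (intro sum.mono_neutral_cong_left) auto
  also have "\<dots> = (\<Sum>b\<leftarrow>p. if b < x then ds ! x * ds ! b else 0)"
    by (simp add: sum_list_sum_nth atLeast0LessThan)
  also have "sum (?g (x # p)) ((\<lambda>(a, b). (Suc a, Suc b)) ` ?S p) = koszul ds p"
    unfolding koszul_def by (subst sum.reindex) (auto simp: inj_on_def intro!: sum.cong)
  finally show ?thesis .
qed

lemma sum_list_if_none:
  "\<forall>b\<in>set p. m \<le> b \<Longrightarrow> (\<Sum>b\<leftarrow>p. if b < (m :: nat) then g b else (0 :: int)) = 0"
  by (induction p) auto

lemma koszul_least: "\<forall>b\<in>set p. m < b \<Longrightarrow> koszul ds (m # p) = koszul ds p"
  by (auto simp: koszul_Cons sum_list_if_none less_imp_le)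


lemma koszul_sorted: "sorted p \<Longrightarrow> koszul ds p = 0"
  by (induction p) (auto simp: koszul_Cons sum_list_if_none)

lemma koszul_insert_least:
  "\<forall>b\<in>set p \<union> set q. m < b \<Longrightarrow>
    koszul ds (p @ m # q) = koszul ds (p @ q) + (\<Sum>a\<leftarrow>p. ds ! a) * ds ! m"
  by (induction p) (auto simp: koszul_Cons algebra_simps sum_list_if_none less_imp_le)

text \<open>Inversions between \<open>p\<close> and \<open>q\<close> depend only on the set of
  entries of \<open>q\<close>, so sorting \<open>q\<close> costs exactly the inversions inside
  \<open>q\<close>.\<close>

lemma koszul_append_rearranged:
  assumes "distinct q" "distinct q'" "set q = set q'" "sorted q'"
  shows "koszul ds (p @ q) = koszul ds (p @ q') + koszul ds q"
  using assms
  by (induction p) (simp_all add: koszul_Cons koszul_sorted sum_list_distinct_conv_sum_set)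

section \<open>Sublists at sets of positions\<close>

lemma sorted_list_of_set_insert_least:
  assumes "finite J" "\<forall>b\<in>J. m < b"
  shows "sorted_list_of_set (insert m J) = m # sorted_list_of_set J"
proof -
  have "m \<notin> J" using assms(2) by auto
  then show ?thesis
    using assms by (auto simp: sorted_list_of_set_insert intro!: insort_is_Cons intro: less_imp_le)
qed

lemma nths_conv_sorted_list:
  assumes "A \<subseteq> {..<length xs}"
  shows "nths xs A = map ((!) xs) (sorted_list_of_set A)"
proof -
  have 1: "nths xs A = map ((!) xs) (filter (\<lambda>i. i \<in> A) [0..<length xs])"
    by (induction xs rule: rev_induct) (auto simp: nths_append nth_append intro!: map_cong)
  have "sorted_list_of_set A = filter (\<lambda>i. i \<in> A) [0..<length xs]"
  proof -
    have "set (filter (\<lambda>i. i \<in> A) [0..<length xs]) = A" using assms by auto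
    moreover have "sorted (filter (\<lambda>i. i \<in> A) [0..<length xs])" by (rule sorted_wrt_filter) simp
    ultimately show ?thesis
      using sorted_list_of_set.idem_if_sorted_distinct[of "filter (\<lambda>i. i \<in> A) [0..<length xs]"] by simp
  qed
  then show ?thesis using 1 by simp
qed

lemma total_degree_nths:
  assumes "A \<subseteq> {..<length xs}"
  shows "total_degree (nths xs A) = (\<Sum>a\<leftarrow>sorted_list_of_set A. map fst xs ! a)"
proof -
  have "finite A" using assms finite_subset by blast
  then show ?thesis
    unfolding nths_conv_sorted_list[OF assms] total_degree_def map_map
    using assms by (intro arg_cong[where f = sum_list] map_cong) auto
qed

lemma nths_insert_least:
  assumes "insert m J \<subseteq> {..<length xs}" "\<forall>b\<in>J. m < b"
  shows "nths xs (insert m J) = xs ! m # nths xs J"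
proof -
  have "finite J" using assms finite_subset[OF assms(1)] by simp
  with assms show ?thesis
    unfolding nths_conv_sorted_list[OF assms(1)]
    by (subst sorted_list_of_set_insert_least) (auto simp: nths_conv_sorted_list)
qed

text \<open>The induction removes the least position \<open>m\<close>, the head of
  \<open>nths xs I\<close>. In the first part \<open>m\<close> creates no inversion; in the second
  it creates one with every element of the first part, which is the sign of the recursion.\<close>

lemma split_sum_nths:
  assumes "finite I" "I \<subseteq> {..<length xs}"
  shows "split_sum (nths xs I) \<phi> =
    (\<Sum>A\<in>Pow I. signed (koszul (map fst xs) (sorted_list_of_set A @ sorted_list_of_set (I - A)))
      (\<phi> (nths xs A) (nths xs (I - A))))"
  using assms
proof (induction I arbitrary: \<phi> rule: finite_linorder_min_induct)
  case (insert m J)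
  let ?k = "\<lambda>A B. koszul (map fst xs) (sorted_list_of_set A @ sorted_list_of_set B)"
  let ?f = "\<lambda>A B. signed (?k A B) (\<phi> (nths xs A) (nths xs B))"
  have m: "m \<notin> J" using insert by auto
  have 1: "?f (insert m A) (insert m J - insert m A) =
      signed (?k A (J - A)) (\<phi> (xs ! m # nths xs A) (nths xs (J - A)))" if "A \<subseteq> J" for A
  proof -
    have A: "insert m J - insert m A = J - A" "finite A" using m that insert.hyps finite_subset by auto
    have "?k (insert m A) (J - A) = koszul (map fst xs) (m # sorted_list_of_set A @ sorted_list_of_set
        (J - A))"
      using that insert.hyps A by (subst sorted_list_of_set_insert_least) auto
    also have "\<dots> = ?k A (J - A)"
      using that insert.hyps A by (intro koszul_least) auto
    moreover have "nths xs (insert m A) = xs ! m # nths xs A"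
      by (rule nths_insert_least) (use that insert in auto)
    ultimately show ?thesis using A by simp
  qed
  have 2: "?f A (insert m J - A) = signed (?k A (J - A)) (signed (fst (xs ! m) * total_degree (nths xs A))
      (\<phi> (nths xs A) (xs ! m # nths xs (J - A))))" if "A \<subseteq> J" for A
  proof -
    have A: "insert m J - A = insert m (J - A)" "finite A" using m that insert.hyps finite_subset by auto
    have "?k A (insert m (J - A)) = ?k A (J - A) + total_degree (nths xs A) * fst (xs ! m)"
    proof -
      have "?k A (insert m (J - A)) = koszul (map fst xs) (sorted_list_of_set A @ m # sorted_list_of_set
          (J - A))"
        using insert.hyps by (subst sorted_list_of_set_insert_least) auto
      also have "\<dots> = ?k A (J - A) + (\<Sum>a\<leftarrow>sorted_list_of_set A. map fst xs ! a) * map fst xs ! m"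
        using insert.hyps that A by (intro koszul_insert_least) auto
      also have "(\<Sum>a\<leftarrow>sorted_list_of_set A. map fst xs ! a) = total_degree (nths xs A)"
        using insert.prems that by (intro total_degree_nths[symmetric]) auto
      finally show ?thesis using insert.prems by simp
    qed
    moreover have "nths xs (insert m (J - A)) = xs ! m # nths xs (J - A)"
      by (rule nths_insert_least) (use that insert in auto)
    ultimately show ?thesis using A by (simp add: mult.commute)
  qed
  have "(\<Sum>A\<in>Pow (insert m J). ?f A (insert m J - A)) =
      (\<Sum>A\<in>Pow J. ?f A (insert m J - A)) + (\<Sum>A\<in>insert m ` Pow J. ?f A (insert m J - A))"
    unfolding Pow_insert using insert.hyps m by (intro sum.union_disjoint) auto
  also have "(\<Sum>A\<in>insert m ` Pow J. ?f A (insert m J - A)) =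
      (\<Sum>A\<in>Pow J. ?f (insert m A) (insert m J - insert m A))"
    by (rule sum.reindex_cong[of "insert m"]) (use m in \<open>auto simp: inj_on_def\<close>)
  also have "\<dots> = split_sum (nths xs J) (\<lambda>A B. \<phi> (xs ! m # A) B)"
    using insert.prems by (subst insert.IH, simp, intro sum.cong[OF refl] 1, simp)
  also have "(\<Sum>A\<in>Pow J. ?f A (insert m J - A)) =
      split_sum (nths xs J) (\<lambda>A B. signed (fst (xs ! m) * total_degree A) (\<phi> A (xs ! m # B)))"
    using insert.prems by (subst insert.IH, simp, intro sum.cong[OF refl] 2, simp)
  also have "nths xs (insert m J) = xs ! m # nths xs J"
    using insert by (intro nths_insert_least) auto
  ultimately show ?case by (simp add: nths_insert_least insert.hyps insert.prems add.commute)
qed simp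

lemma nths_lessThan_length: "nths xs {..<length xs} = xs"
  by (rule nths_all) simp

lemma unshuffle_sum_conv: "unshuffle_sum h q xs = compose_ops h 1 q xs"
proof -
  let ?k = "\<lambda>A B. koszul (map fst xs) (sorted_list_of_set A @ sorted_list_of_set B)"
  let ?I = "{..<length xs}"
  let ?\<phi> = "\<lambda>A B. if A = [] then 0 else h ((total_degree A + 1, q A) # B)"
  have "nths xs A \<noteq> []" if "A \<subseteq> ?I" "A \<noteq> {}" for A
    using that finite_subset[OF that(1)] by (auto simp: nths_conv_sorted_list)
  then have "unshuffle_sum h q xs =
      (\<Sum>A\<in>Pow ?I - {{}}. signed (?k A (?I - A)) (?\<phi> (nths xs A) (nths xs (?I - A))))"
    unfolding unshuffle_sum_def by (auto simp: Let_def intro!: sum.cong)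
  also have "\<dots> = (\<Sum>A\<in>Pow ?I. signed (?k A (?I - A)) (?\<phi> (nths xs A) (nths xs (?I - A))))"
    by (intro sum.mono_neutral_left) auto
  also have "\<dots> = compose_ops h 1 q xs"
    unfolding compose_ops_def using split_sum_nths[of ?I xs ?\<phi>] by (simp add: nths_lessThan_length)
  finally show ?thesis .
qed

text \<open>\<open>block_partitions\<close> for arbitrary sets of positions: splitting off a block
  leaves a set with gaps, so the induction has to allow these.\<close>

definition partitions_of :: "nat set \<Rightarrow> nat set list set" where
  "partitions_of I =
     {Bs. {} \<notin> set Bs \<and> \<Union>(set Bs) = I \<and> sorted_wrt (\<lambda>A B. A \<inter> B = {} \<and> Min A < Min B) Bs}"

lemma partitions_of_empty: "partitions_of {} = {[]}"
proof -
  have "Bs = []" if "{} \<notin> set Bs" "\<forall>x\<in>set Bs. x = {}" for Bs :: "nat set list"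
    using that by (cases Bs) auto
  then show ?thesis by (auto simp: partitions_of_def)
qed

text \<open>Least elements increase along the list of blocks, so the overall minimum lies in the
  first block.\<close>

lemma partitions_of_insert:
  assumes "finite J" "\<forall>b\<in>J. m < b"
  shows "partitions_of (insert m J) =
    (\<lambda>(A, Bs). insert m A # Bs) ` (SIGMA A:Pow J. partitions_of (J - A))" (is "?L = ?R")
proof (intro set_eqI iffI)
  fix Ks assume "Ks \<in> ?L"
  then have K: "{} \<notin> set Ks" "\<Union>(set Ks) = insert m J"
    "sorted_wrt (\<lambda>A B. A \<inter> B = {} \<and> Min A < Min B) Ks"
    by (auto simp: partitions_of_def)
  then obtain B Bs where BBs: "Ks = B # Bs" by (cases Ks) auto
  have fin: "finite X" "X \<noteq> {}" if "X \<in> set Ks" for X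
    using that K assms(1) by (auto intro: finite_subset[of X "insert m J"])
  have "m \<in> B"
  proof (rule ccontr)
    assume "m \<notin> B"
    then obtain X where X: "X \<in> set Bs" "m \<in> X" using K BBs by auto
    have "Min X \<le> m" using X fin BBs by auto
    moreover have "Min B \<in> insert m J" using Min_in[OF fin[of B]] K BBs by auto
    moreover have "Min B < Min X" using X K BBs by auto
    ultimately show False using assms(2) by auto
  qed
  moreover have "Bs \<in> partitions_of (J - (B - {m}))"
    using K BBs assms(2) \<open>m \<in> B\<close> by (auto simp: partitions_of_def)
  moreover have "Ks = (\<lambda>(A, Bs). insert m A # Bs) (B - {m}, Bs)" "B - {m} \<subseteq> J"
    using K BBs \<open>m \<in> B\<close> by auto
  ultimately show "Ks \<in> ?R" by blast
next
  fix Ks assume "Ks \<in> ?R"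
  then obtain A Bs where A: "Ks = insert m A # Bs" "A \<subseteq> J" "Bs \<in> partitions_of (J - A)" by auto
  have "finite A" "\<forall>b\<in>A. m < b" using A assms finite_subset by auto
  then have "Min (insert m A) = m" by (intro Min_eqI) auto
  moreover have "m < Min X \<and> insert m A \<inter> X = {}" if "X \<in> set Bs" for X
  proof -
    have X: "X \<subseteq> J - A" "X \<noteq> {}" using A(3) that by (auto simp: partitions_of_def)
    then have "finite X" using assms(1) finite_subset by auto
    with X have "Min X \<in> J" using Min_in by blast
    then show ?thesis using X assms(2) by auto
  qed
  ultimately show "Ks \<in> ?L"
    using A by (auto simp: partitions_of_def)
qed

lemma finite_partitions_of: "finite I \<Longrightarrow> finite (partitions_of I)"
proof (induction "card I" arbitrary: I rule: less_induct)
  case less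
  show ?case
  proof (cases "I = {}")
    case False
    define m where "m = Min I"
    let ?J = "I - {m}"
    have I: "I = insert m ?J" "\<forall>b\<in>?J. m < b"
      using less.prems Min_in[OF less.prems False] by (auto simp: m_def order_less_le)
    have "finite (partitions_of (?J - A))" for A
      by (rule less.hyps) (use less.prems I(1) in \<open>auto intro!: psubset_card_mono\<close>)
    then have "finite (partitions_of (insert m ?J))"
      using less.prems I(2) by (subst partitions_of_insert) auto
    then show ?thesis using I(1) by simp
  qed (simp add: partitions_of_empty)
qed

lemma concat_partition:
  assumes "Bs \<in> partitions_of I" "finite I"
  shows "distinct (concat (map sorted_list_of_set Bs))" "set (concat (map sorted_list_of_set Bs)) = I"
proof -
  have fin: "finite X" if "X \<in> set Bs" for X
    using that assms by (auto simp: partitions_of_def intro: finite_subset[of X I])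
  then show "set (concat (map sorted_list_of_set Bs)) = I"
    using assms by (auto simp: partitions_of_def)
  have "sorted_wrt (\<lambda>A B. A \<inter> B = {} \<and> Min A < Min B) Bs" "\<forall>X\<in>set Bs. finite X"
    using assms fin by (auto simp: partitions_of_def)
  then show "distinct (concat (map sorted_list_of_set Bs))"
    by (induction Bs) auto
qed

text \<open>The block with the least position is split off on both sides. The sign of the whole
  rearrangement is that of this unshuffle times that of the remaining blocks, by
  \<open>koszul_append_rearranged\<close>.\<close>

lemma part_sum_nths:
  fixes \<psi> :: "(int \<times> 'm) list list \<Rightarrow> 'n::ab_group_add"
  assumes "finite I" "I \<subseteq> {..<length xs}"
  shows "part_sum (nths xs I) \<psi> =
    (\<Sum>Bs\<in>partitions_of I. signed (koszul (map fst xs) (concat (map sorted_list_of_set Bs)))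
      (\<psi> (map (nths xs) Bs)))"
  using assms
proof (induction "card I" arbitrary: I \<psi> rule: less_induct)
  case less
  show ?case
  proof (cases "I = {}")
    case False
    define m where "m = Min I"
    define J where "J = I - {m}"
    have I: "I = insert m J" "\<forall>b\<in>J. m < b" "finite J" "m \<notin> J" "J \<subseteq> {..<length xs}" "m < length xs"
      using less.prems Min_in[OF less.prems(1) False] by (auto simp: J_def m_def order_less_le)
    let ?k = "\<lambda>A B. koszul (map fst xs) (sorted_list_of_set A @ sorted_list_of_set B)"
    let ?kk = "\<lambda>Bs. koszul (map fst xs) (concat (map sorted_list_of_set Bs))"
    have IH: "part_sum (nths xs (J - A)) \<psi>' =
        (\<Sum>Bs\<in>partitions_of (J - A). signed (?kk Bs) (\<psi>' (map (nths xs) Bs)))" for A and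
            \<psi>' :: "(int \<times> 'm) list list \<Rightarrow> 'n"
      by (rule less.hyps) (use I card_mono[of J "J - A"] in auto)
    have k: "?kk (insert m A # Bs) = ?k A (J - A) + ?kk Bs"
      if "A \<subseteq> J" "Bs \<in> partitions_of (J - A)" for A Bs
    proof -
      have A: "finite A" "finite (J - A)" using that I finite_subset by auto
      note * = concat_partition[OF that(2) A(2)]
      have "?kk (insert m A # Bs) = koszul (map fst xs) (sorted_list_of_set A @ concat (map
          sorted_list_of_set Bs))"
      proof -
        have "\<forall>b\<in>set (sorted_list_of_set A @ concat (map sorted_list_of_set Bs)). m < b"
          unfolding set_append *(2) using A I that by auto
        from koszul_least[OF this] show ?thesis
          using A I that by (subst list.map, subst sorted_list_of_set_insert_least) auto
      qed
      also have "\<dots> = ?k A (J - A) + ?kk Bs"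
        by (rule koszul_append_rearranged) (use * A in auto)
      finally show ?thesis .
    qed
    have n: "nths xs (insert m A) = xs ! m # nths xs A" if "A \<subseteq> J" for A
      by (rule nths_insert_least) (use I that in auto)
    have "(\<Sum>Ks\<in>partitions_of I. signed (?kk Ks) (\<psi> (map (nths xs) Ks))) =
        (\<Sum>(A, Bs)\<in>(SIGMA A:Pow J. partitions_of (J - A)).
           signed (?kk (insert m A # Bs)) (\<psi> (map (nths xs) (insert m A # Bs))))"
      unfolding I(1) partitions_of_insert[OF I(3,2)]
    proof (subst sum.reindex)
      have "A = A'" if "insert m A = insert m A'" "A \<subseteq> J" "A' \<subseteq> J" for A A'
        using that I(4) by (metis insert_ident subsetD)
      then show "inj_on (\<lambda>(A, Bs). insert m A # Bs) (SIGMA A:Pow J. partitions_of (J - A))"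
        by (auto simp: inj_on_def)
    qed (auto intro!: sum.cong)
    also have "\<dots> = (\<Sum>A\<in>Pow J. \<Sum>Bs\<in>partitions_of (J - A).
           signed (?kk (insert m A # Bs)) (\<psi> (map (nths xs) (insert m A # Bs))))"
      using I(3) by (subst sum.Sigma) (auto simp: finite_partitions_of)
    also have "\<dots> = (\<Sum>A\<in>Pow J. signed (?k A (J - A))
        (part_sum (nths xs (J - A)) (\<lambda>Bs. \<psi> ((xs ! m # nths xs A) # Bs))))"
    proof (intro sum.cong refl)
      fix A assume "A \<in> Pow J"
      then have "(\<Sum>Bs\<in>partitions_of (J - A). signed (?kk (insert m A # Bs)) (\<psi> (map (nths xs)
          (insert m A # Bs)))) =
         (\<Sum>Bs\<in>partitions_of (J - A). signed (?k A (J - A)) (signed (?kk Bs) (\<psi> ((xs ! m # nths xs A)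
             # map (nths xs) Bs))))"
        by (intro sum.cong refl) (simp add: k[unfolded list.map] n del: concat.simps)
      also have "\<dots> = signed (?k A (J - A)) (part_sum (nths xs (J - A)) (\<lambda>Bs. \<psi> ((xs ! m # nths xs A) # Bs)))"
        unfolding IH by (simp add: signed_def sum_negf)
      finally show "(\<Sum>Bs\<in>partitions_of (J - A). signed (?kk (insert m A # Bs)) (\<psi> (map (nths xs)
          (insert m A # Bs)))) = \<dots>" .
    qed
    also have "\<dots> = split_sum (nths xs J) (\<lambda>A B. part_sum B (\<lambda>Bs. \<psi> ((xs ! m # A) # Bs)))"
      by (rule split_sum_nths[symmetric]) (use I in auto)
    also have "\<dots> = part_sum (nths xs I) \<psi>"
      using I(1) n[of J] by simp
    finally show ?thesis by simp
  qed (simp add: partitions_of_empty)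
qed

lemma partition_sum_conv: "partition_sum h g xs = push_ops h g xs"
  using part_sum_nths[of "{..<length xs}" xs "\<lambda>Bs. h (blocks g Bs)"]
  by (simp add: partition_sum_def push_ops_def nths_lessThan_length block_partitions_def
      partitions_of_def comp_def)

section \<open>Anchored modules\<close>

lemma signed_even: "even e \<Longrightarrow> signed e x = x"
  by (simp add: signed_def)

lemma signed_double [simp]: "signed (2 * e) x = x"
  by (simp add: signed_def)

lemma ops_move_front:
  assumes "ops_symmetric C g" "hom C (us @ x # vs)"
  shows "g (us @ x # vs) = signed (fst x * total_degree us) (g (x # us @ vs))"
  using assms(2)
proof (induction us arbitrary: vs rule: rev_induct)
  case (snoc u us)
  have "g (us @ u # x # vs) = signed (fst u * fst x) (g (us @ x # u # vs))"
    by (rule ops_symmetricD[OF assms(1)]) (use snoc.prems in auto)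
  moreover have "g (us @ x # u # vs) = signed (fst x * total_degree us) (g (x # us @ u # vs))"
    by (rule snoc.IH) (use snoc.prems in auto)
  ultimately show ?case by (simp add: algebra_simps)
qed simp

text \<open>The argument in question is zero; moved to the front, it meets additivity in the first
  argument.\<close>

lemma ops_nonneg_degree:
  assumes "ops_symmetric C g" "ops_additive C g" "\<And>d. subgroup_set (C d)"
    and nonpos: "\<And>d. d \<ge> 0 \<Longrightarrow> C d = {0}" and "hom C xs" "z \<in> set xs" "fst z \<ge> 0"
  shows "g xs = 0"
proof -
  obtain us vs where xs: "xs = us @ z # vs" using assms(6) by (auto simp: in_set_conv_decomp)
  have "snd z = 0" using assms(5) nonpos[OF assms(7)] xs by auto
  then have "g (z # us @ vs) = 0"
    using ops_additive_0[OF assms(2,3), of "us @ vs" "fst z"] assms(5) xs by (cases z) auto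
  then show ?thesis using ops_move_front[OF assms(1), of us z vs] assms(5) xs by simp
qed

lemma total_degree_le: "\<forall>z\<in>set xs. fst z < 0 \<Longrightarrow> total_degree xs \<le> - int (length xs)"
  by (induction xs) auto

section \<open>Additivity and symmetry of composites\<close>

lemma compose_ops_additive:
  assumes C: "\<And>d. subgroup_set (C d)" and q: "ops_degree C C c q" "ops_additive C q"
    and h: "ops_symmetric C h" "ops_additive C h"
  shows "ops_additive C (compose_ops h c q)"
  unfolding ops_additive_def
proof (intro allI impI)
  fix d x y vs assume *: "x \<in> C d" "y \<in> C d" "hom C vs"
  then have xy: "x + y \<in> C d" using C by (auto simp: subgroup_set_def)
  let ?T = "\<lambda>x A B. h ((d + total_degree A + c, q ((d, x) # A)) # B)"
  let ?S = "\<lambda>x A B. signed (d * total_degree A) (if A = [] then 0 else h ((total_degree A + c, q A)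
      # (d, x) # B))"
  have eq: "compose_ops h c q ((d, x) # vs) = split_sum vs (?T x) + split_sum vs (?S x)" for x
    by (simp add: compose_ops_def)
  have 1: "split_sum vs (?T (x + y)) = split_sum vs (\<lambda>A B. ?T x A B + ?T y A B)"
  proof (intro split_sum_cong, goal_cases)
    case (1 A B)
    have homs: "hom C A" "hom C B" using 1 * hom_subset[of C vs] by auto
    then have "q ((d, x) # A) \<in> C (d + total_degree A + c)" "q ((d, y) # A) \<in> C (d + total_degree A + c)"
      using * ops_degreeD[OF q(1), of "(d, x) # A"] ops_degreeD[OF q(1), of "(d, y) # A"] by auto
    moreover have "q ((d, x + y) # A) = q ((d, x) # A) + q ((d, y) # A)"
      using q(2) * homs by (auto simp: ops_additive_def)
    ultimately show ?case using h(2) homs by (auto simp: ops_additive_def)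
  qed
  have 2: "split_sum vs (?S (x + y)) = split_sum vs (\<lambda>A B. ?S x A B + ?S y A B)"
  proof (intro split_sum_cong, goal_cases)
    case (1 A B)
    show ?case
    proof (cases "A = []")
      case False
      have homs: "hom C A" "hom C B" using 1 * hom_subset[of C vs] by auto
      let ?z = "(total_degree A + c, q A)"
      have z: "snd ?z \<in> C (fst ?z)" using homs ops_degreeD[OF q(1) False] by simp
      have sw: "h (?z # (d, w) # B) = signed (fst ?z * d) (h ((d, w) # ?z # B))" if "w \<in> C d" for w
        using ops_symmetricD[OF h(1), of "[]" ?z "(d, w)" B] that homs z by simp
      have "h ((d, x + y) # ?z # B) = h ((d, x) # ?z # B) + h ((d, y) # ?z # B)"
        using h(2) * homs z by (auto simp: ops_additive_def)
      then show ?thesis using False sw[OF *(1)] sw[OF *(2)] sw[OF xy] by (simp add: signed_add)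
    qed simp
  qed
  show "compose_ops h c q ((d, x + y) # vs) = compose_ops h c q ((d, x) # vs) +
      compose_ops h c q ((d, y) # vs)"
    unfolding eq 1 2 split_sum_add by (simp add: algebra_simps)
qed

lemma push_ops_additive:
  assumes F: "ops_degree C D 0 F" "ops_additive C F" and h: "ops_additive D h"
  shows "ops_additive C (push_ops h F)"
  unfolding ops_additive_def
proof (intro allI impI)
  fix d x y vs assume *: "x \<in> C d" "y \<in> C d" "hom C vs"
  show "push_ops h F ((d, x + y) # vs) = push_ops h F ((d, x) # vs) + push_ops h F ((d, y) # vs)"
    unfolding push_ops_def part_sum.simps split_sum_add[symmetric] part_sum_add[symmetric]
  proof (intro split_sum_cong part_sum_cong, goal_cases)
    case (1 A B Bs)
    have homs: "hom C A" "hom C B" using 1 * hom_subset[of C vs] by auto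
    have "hom D (blocks F Bs)" by (rule hom_blocks[OF F(1)]) (use 1 homs hom_subset[of C B] in auto)
    moreover have "F ((d, x) # A) \<in> D (d + total_degree A)" "F ((d, y) # A) \<in> D (d + total_degree A)"
      using * homs ops_degreeD[OF F(1), of "(d, x) # A"] ops_degreeD[OF F(1), of "(d, y) # A"] by auto
    moreover have "F ((d, x + y) # A) = F ((d, x) # A) + F ((d, y) # A)"
      using F(2) * homs by (auto simp: ops_additive_def)
    ultimately show ?case using h by (auto simp: ops_additive_def)
  qed
qed

lemma push_ops_symmetric:
  assumes F: "ops_degree C D 0 F" "ops_symmetric C F" and h: "ops_symmetric D h" "ops_additive D h"
    and D: "\<And>d. subgroup_set (D d)"
  shows "ops_symmetric C (push_ops h F)"
  unfolding ops_symmetric_def push_ops_def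
proof (intro allI impI, rule part_sum_adjacent[where Z = "{z. snd z \<in> C (fst z)}"], goal_cases)
  case (1 us x y vs Bs us' vs' Bs')
  let ?d = "total_degree (us' @ y # x # vs')"
  have xy: "hom C [x, y]" using 1 by auto
  have Z: "hom C zs" if "set zs \<subseteq> {z. snd z \<in> C (fst z)}" for zs using that by (auto simp: hom_def)
  have b: "hom D (blocks F Bs)" "hom D (blocks F Bs')"
    by (intro hom_blocks[OF F(1)] Z; use 1 in simp)+
  have us: "hom C us'" "hom C vs'" by (intro Z; use 1 in simp)+
  then have "hom C (us' @ x # y # vs')" "hom C (us' @ y # x # vs')" using xy by auto
  then have eq: "F (us' @ x # y # vs') = signed (fst x * fst y) (F (us' @ y # x # vs'))"
    and mem: "F (us' @ y # x # vs') \<in> D ?d" "F (us' @ x # y # vs') \<in> D ?d"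
    using ops_symmetricD[OF F(2), of us' x y vs'] ops_degreeD[OF F(1), of "us' @ y # x # vs'"]
       ops_degreeD[OF F(1), of "us' @ x # y # vs'"] by (auto simp: algebra_simps)
  \<comment> \<open>Additivity of \<open>h\<close> is available in the first argument, so the block
    is brought to the front before the sign inside it is pulled out.\<close>
  have front: "h (blocks F Bs @ (?d, w) # blocks F Bs') =
      signed (?d * total_degree (blocks F Bs)) (h ((?d, w) # blocks F Bs @ blocks F Bs'))" if "w \<in> D ?d" for w
    using ops_move_front[OF h(1), of "blocks F Bs" "(?d, w)"] that b by simp
  have d: "total_degree (us' @ x # y # vs') = ?d" by simp
  have "h ((?d, F (us' @ x # y # vs')) # blocks F Bs @ blocks F Bs') =
      signed (fst x * fst y) (h ((?d, F (us' @ y # x # vs')) # blocks F Bs @ blocks F Bs'))"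
    unfolding eq using b
    by (intro additive_on_signed[OF ops_additive_on[OF h(2) D]] mem(1)) simp
  then show ?case
    unfolding list.map map_append d front[OF mem(1)] front[OF mem(2)] by (simp add: algebra_simps)
next
  case (2 us x y vs Bs A B Bs')
  have Z: "hom C zs" if "set zs \<subseteq> {z. snd z \<in> C (fst z)}" for zs using that by (auto simp: hom_def)
  have "hom D (blocks F (Bs @ A # B # Bs'))"
    by (intro hom_blocks[OF F(1)] Z; use 2 in simp)
  then have "hom D (blocks F Bs @ (total_degree A, F A) # (total_degree B, F B) # blocks F Bs')"
    by simp
  from ops_symmetricD[OF h(1) this] show ?case by simp
next
  case (3 us x y vs)
  then show ?case by (auto simp: hom_def)
qed

text \<open>Among the brackets only the binary one fails to be linear. Extending the anchor by zero
  to lists of other lengths lets a single Leibniz rule serve all arities.\<close>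

definition anchor_ops :: "(int \<Rightarrow> 'm \<Rightarrow> 'r \<Rightarrow> 'r::comm_ring_1) \<Rightarrow> (int \<times> 'm) list \<Rightarrow> 'r \<Rightarrow> 'r" where
  "anchor_ops \<alpha> xs r = (case xs of [z] \<Rightarrow> \<alpha> (fst z) (snd z) r | _ \<Rightarrow> 0)"

lemma anchor_ops_simps [simp]:
  "anchor_ops \<alpha> [] r = 0" "anchor_ops \<alpha> [z] r = \<alpha> (fst z) (snd z) r" "anchor_ops \<alpha> (x # y # zs) r = 0"
  by (simp_all add: anchor_ops_def)

text \<open>\<open>C\<close> is the complex after the shift: it vanishes from degree 0 on, and the
  anchor lives in degree -1, on the bundle that had degree 0 before the shift. Brackets are not part
  of the data, since several of them are considered for one anchor.\<close>

locale anchored_module = module s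
  for s :: "'r::comm_ring_1 \<Rightarrow> 'm::ab_group_add \<Rightarrow> 'm" +
  fixes C :: "int \<Rightarrow> 'm set" and \<alpha> :: "int \<Rightarrow> 'm \<Rightarrow> 'r \<Rightarrow> 'r"
  assumes subspace_C: "subspace (C d)"
    and C_nonneg: "d \<ge> 0 \<Longrightarrow> C d = {0}"
    and anchor_add: "x \<in> C d \<Longrightarrow> y \<in> C d \<Longrightarrow> \<alpha> d (x + y) r = \<alpha> d x r + \<alpha> d y r"
    and anchor_scale: "x \<in> C d \<Longrightarrow> \<alpha> d (s t x) r = t * \<alpha> d x r"
    and anchor_degree: "x \<in> C d \<Longrightarrow> d \<noteq> -1 \<Longrightarrow> \<alpha> d x r = 0"
    and derivation_add: "x \<in> C d \<Longrightarrow> \<alpha> d x (r + t) = \<alpha> d x r + \<alpha> d x t"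
    and derivation_mult: "x \<in> C d \<Longrightarrow> \<alpha> d x (r * t) = r * \<alpha> d x t + t * \<alpha> d x r"
begin

lemma subgroup_C: "subgroup_set (C d)"
  using subspace_C[of d] by (auto simp: subgroup_set_def subspace_0 subspace_add subspace_neg)

lemma scale_mem: "x \<in> C d \<Longrightarrow> s r x \<in> C d"
  using subspace_C subspace_scale by blast

lemma zero_mem: "0 \<in> C d"
  using subspace_C subspace_0 by blast

lemma anchor_zero: "\<alpha> d 0 r = 0"
  using anchor_scale[OF zero_mem, of d 0 r] by simp

lemma derivation_zero: "x \<in> C d \<Longrightarrow> \<alpha> d x 0 = 0"
  using derivation_mult[of x d 0 0] by simp

lemma derivation_minus: "x \<in> C d \<Longrightarrow> \<alpha> d x (- r) = - \<alpha> d x r"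
  using derivation_add[of x d r "- r"] derivation_zero[of x d] by (simp add: eq_neg_iff_add_eq_0 add.commute)

lemma signed_scale: "signed e (s r x) = s (signed e r) x"
  by (simp add: signed_def)

lemma scale_signed: "s r (signed e x) = signed e (s r x)"
  by (simp add: signed_def)

lemma split_sum_scale: "split_sum xs (\<lambda>A B. s r (\<phi> A B)) = s r (split_sum xs \<phi>)"
  by (rule split_sum_additive(2)[of UNIV "s r", symmetric])
    (auto simp: additive_on_def subgroup_set_def scale_right_distrib)

lemma split_sum_scale_left: "split_sum xs (\<lambda>A B. s (f A B) x) = s (split_sum xs f) x"
  by (rule split_sum_additive(2)[of UNIV "\<lambda>r. s r x", symmetric])
    (auto simp: additive_on_def subgroup_set_def scale_left_distrib)

lemma part_sum_scale: "part_sum xs (\<lambda>Bs. s r (\<phi> Bs)) = s r (part_sum xs \<phi>)"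
  by (rule part_sum_additive(2)[of UNIV "s r", symmetric])
    (auto simp: additive_on_def subgroup_set_def scale_right_distrib)

lemma part_sum_scale_left: "part_sum xs (\<lambda>Bs. s (f Bs) x) = s (part_sum xs f) x"
  by (rule part_sum_additive(2)[of UNIV "\<lambda>r. s r x", symmetric])
    (auto simp: additive_on_def subgroup_set_def scale_left_distrib)

lemma anchor_ops_degree: "hom C A \<Longrightarrow> total_degree A \<noteq> -1 \<Longrightarrow> anchor_ops \<alpha> A r = 0"
  by (cases A rule: remdups_adj.cases) (auto simp: anchor_degree)

lemma anchor_ops_0: "hom C A \<Longrightarrow> anchor_ops \<alpha> A 0 = 0"
  by (cases A rule: remdups_adj.cases) (auto simp: derivation_zero)

lemma anchor_ops_signed: "hom C A \<Longrightarrow> anchor_ops \<alpha> A (signed e r) = signed e (anchor_ops \<alpha> A r)"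
  by (cases A rule: remdups_adj.cases) (auto simp: signed_def derivation_minus)

text \<open>The Leibniz rule is imposed in the first argument, since this is the one on which the recursion
  of \<open>split_sum\<close> and \<open>part_sum\<close> operates; the sign comes from moving \<open>x\<close> past the
  derivation and back.\<close>

definition leibniz :: "('m, 'm) ops \<Rightarrow> bool" where
  "leibniz q \<longleftrightarrow> ops_degree C C 1 q \<and> ops_symmetric C q \<and> ops_additive C q \<and>
     (\<forall>d x vs r. x \<in> C d \<longrightarrow> hom C vs \<longrightarrow>
        q ((d, s r x) # vs) = s r (q ((d, x) # vs)) + s (signed d (anchor_ops \<alpha> vs r)) x)"

text \<open>On two arguments of degree -1 this compares the anchor of the bracket with the
  commutator of the anchors; on one argument it is the anchor of the differential. The uniform
  formula is the one that comes out of \<open>curvature_scale\<close>.\<close>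

definition anchor_defect :: "('m, 'm) ops \<Rightarrow> (int \<times> 'm) list \<Rightarrow> 'r \<Rightarrow> 'r" where
  "anchor_defect q xs r = split_sum xs (\<lambda>A B. anchor_ops \<alpha> B (anchor_ops \<alpha> A r)) +
     (if xs = [] then 0 else \<alpha> (total_degree xs + 1) (q xs) r)"

text \<open>The first derivatives of \<open>r\<close>, taken once in the inner and once in the outer
  bracket, cancel when the two parts are exchanged. What survives are the second derivatives and the
  derivatives along an inner bracket.\<close>

lemma curvature_scale:
  assumes q: "leibniz q" and x: "x \<in> C d" and xs: "hom C xs"
  shows "compose_ops q 1 q ((d, s r x) # xs) =
    s r (compose_ops q 1 q ((d, x) # xs)) + s (anchor_defect q xs r) x"
proof -
  note deg = q[unfolded leibniz_def, THEN conjunct1]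
    and sym = q[unfolded leibniz_def, THEN conjunct2, THEN conjunct1]
    and add = q[unfolded leibniz_def, THEN conjunct2, THEN conjunct2, THEN conjunct1]
  have leib: "q ((d, s r x) # vs) = s r (q ((d, x) # vs)) + s (signed d (anchor_ops \<alpha> vs r)) x"
    if "x \<in> C d" "hom C vs" for d x vs r
    using q that by (auto simp: leibniz_def)
  let ?T = "\<lambda>x A B. q ((d + total_degree A + 1, q ((d, x) # A)) # B)"
  let ?S = "\<lambda>x A B. signed (d * total_degree A) (if A = [] then 0 else q ((total_degree A + 1, q A)
      # (d, x) # B))"
  let ?U = "\<lambda>A B. s (signed (d + total_degree A + 1) (anchor_ops \<alpha> B r)) (q ((d, x) # A))"
  let ?V = "\<lambda>A B. s (signed d (anchor_ops \<alpha> A r)) (q ((d, x) # B))"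
  let ?W = "\<lambda>A B. s (anchor_ops \<alpha> B (anchor_ops \<alpha> A r)) x"
  let ?X = "\<lambda>A B. s (if A = [] then 0 else anchor_ops \<alpha> ((total_degree A + 1, q A) # B) r) x"
  have eq: "compose_ops q 1 q ((d, x) # xs) = split_sum xs (?T x) + split_sum xs (?S x)" for x
    by (simp add: compose_ops_def)
  have 1: "split_sum xs (?T (s r x)) = split_sum xs (\<lambda>A B. s r (?T x A B) + ?U A B + ?V A B + ?W A B)"
  proof (intro split_sum_cong, goal_cases)
    case (1 A B)
    have homs: "hom C A" "hom C B" using 1 xs hom_subset[of C xs] by auto
    let ?e = "d + total_degree A + 1"
    have m: "q ((d, x) # A) \<in> C ?e"
      using x homs ops_degreeD[OF deg, of "(d, x) # A"] by auto
    have "?T (s r x) A B = q ((?e, s r (q ((d, x) # A)) + s (signed d (anchor_ops \<alpha> A r)) x) # B)"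
      using leib[OF x homs(1)] by simp
    also have "\<dots> = q ((?e, s r (q ((d, x) # A))) # B) + q ((?e, s (signed d (anchor_ops \<alpha> A r)) x) # B)"
    proof -
      have "s (signed d (anchor_ops \<alpha> A r)) x \<in> C ?e"
        using anchor_ops_degree[OF homs(1)] scale_mem[OF x]
        by (cases "total_degree A = -1") (auto simp: zero_mem)
      then show ?thesis using add homs(2) scale_mem[OF m] by (auto simp: ops_additive_def)
    qed
    also have "q ((?e, s (signed d (anchor_ops \<alpha> A r)) x) # B) = ?V A B + ?W A B"
    proof (cases "total_degree A = -1")
      case True
      then show ?thesis
        using leib[OF x homs(2)] by (simp add: anchor_ops_signed[OF homs(2)])
    next
      case False
      then show ?thesis
        using anchor_ops_degree[OF homs(1) False] ops_additive_0[OF add subgroup_C homs(2)]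
        by (simp add: anchor_ops_0[OF homs(2)])
    qed
    finally show ?case using leib[OF m homs(2)] by (simp add: algebra_simps)
  qed
  have 2: "split_sum xs (?S (s r x)) = split_sum xs (\<lambda>A B. s r (?S x A B) + ?X A B)"
  proof (intro split_sum_cong, goal_cases)
    case (1 A B)
    show ?case
    proof (cases "A = []")
      case False
      have homs: "hom C A" "hom C B" using 1 xs hom_subset[of C xs] by auto
      let ?z = "(total_degree A + 1, q A)"
      have z: "snd ?z \<in> C (fst ?z)" using homs ops_degreeD[OF deg False] by simp
      have sw: "q (?z # (d, w) # B) = signed (fst ?z * d) (q ((d, w) # ?z # B))" if "w \<in> C d" for w
        using ops_symmetricD[OF sym, of "[]" ?z "(d, w)" B] that homs z by simp
      have "q ((d, s r x) # ?z # B) = s r (q ((d, x) # ?z # B)) + s (signed d (anchor_ops \<alpha> (?z # B) r)) x"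
        using leib[OF x, of "?z # B"] homs z by simp
      then show ?thesis using False sw[OF x] sw[OF scale_mem[OF x]]
        by (auto simp: signed_add scale_signed signed_scale algebra_simps intro!: signed_even
            arg_cong[where f = "\<lambda>r. s r x"])
    qed simp
  qed
  \<comment> \<open>\<open>?U\<close> differentiates in the outer bracket, \<open>?V\<close> in the
    inner one. An anchor needs total degree -1, which makes the exchange of the two parts
    odd.\<close>
  have 3: "split_sum xs ?U = - split_sum xs ?V"
    unfolding split_sum_minus[symmetric]
  proof (subst split_sum_comm, intro split_sum_cong, goal_cases)
    case (1 A B)
    have homs: "hom C A" "hom C B" using 1 xs hom_subset[of C xs] by auto
    show ?case
    proof (cases "total_degree A = -1")
      case True
      have "signed (total_degree A * total_degree B) (signed (d + total_degree B + 1) (anchor_ops \<alpha> A r)) =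
          - signed d (anchor_ops \<alpha> A r)"
        unfolding signed_signed by (rule signed_minus_cong) (simp add: True)
      then show ?thesis unfolding signed_scale by simp
    qed (simp add: anchor_ops_degree[OF homs(1)])
  qed
  have 4: "split_sum xs (\<lambda>A B. if A = [] then 0 else anchor_ops \<alpha> ((total_degree A + 1, q A) # B) r) =
      (if xs = [] then 0 else \<alpha> (total_degree xs + 1) (q xs) r)"
    by (subst split_sum_all_left) (auto simp: neq_Nil_conv)
  show ?thesis
    unfolding eq 1 2 split_sum_add 3 4 split_sum_scale split_sum_scale_left anchor_defect_def
    by (simp add: scale_right_distrib scale_left_distrib)
qed

text \<open>For degree reasons only pairs of arguments of degree \<open>-1\<close> contribute.\<close>

lemma anchor_defect_eq_0:
  assumes q: "leibniz q" and xs: "hom C xs"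
    and unary: "\<And>x r. x \<in> C (-2) \<Longrightarrow> \<alpha> (-1) (q [(-2, x)]) r = 0"
    and binary: "\<And>y z. xs = [(-1, y), (-1, z)] \<Longrightarrow> y \<in> C (-1) \<Longrightarrow> z \<in> C (-1) \<Longrightarrow>
      anchor_defect q xs r = 0"
  shows "anchor_defect q xs r = 0"
proof -
  note deg = q[unfolded leibniz_def, THEN conjunct1]
    and sym = q[unfolded leibniz_def, THEN conjunct2, THEN conjunct1]
    and add = q[unfolded leibniz_def, THEN conjunct2, THEN conjunct2, THEN conjunct1]
  have q0: "\<alpha> (total_degree xs + 1) (q xs) r = 0" if "length xs \<noteq> 1" "xs \<noteq> []" "length xs = 2 \<Longrightarrow>
      \<exists>z\<in>set xs. fst z \<noteq> -1"
  proof (cases "\<exists>z\<in>set xs. fst z \<ge> 0")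
    case True
    then show ?thesis using ops_nonneg_degree[OF sym add subgroup_C C_nonneg xs] anchor_zero by auto
  next
    case False
    \<comment> \<open>The anchor sees outputs of degree -1, hence arguments of total degree -2. With
      negative degrees this allows one argument of degree -2 or two of degree -1.\<close>
    have "total_degree xs \<noteq> -2"
    proof (cases "length xs = 2")
      case True
      then obtain x y where "xs = [x, y]" by (auto simp: length_Suc_conv numeral_2_eq_2)
      then show ?thesis using False that(3)[OF True] by auto
    next
      case len: False
      have "length xs \<ge> 3" using len that by (cases xs; cases "tl xs") (auto simp: Suc_le_eq)
      then show ?thesis using total_degree_le[of xs] False by (force simp: not_le)
    qed
    then show ?thesis
      using anchor_degree[OF ops_degreeD[OF deg that(2) xs]] by auto
  qed
  have split0: "split_sum xs (\<lambda>A B. anchor_ops \<alpha> B (anchor_ops \<alpha> A r)) = 0" if "length xs > 2"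
  proof -
    have *: "anchor_ops \<alpha> A t = 0" if "length A \<noteq> 1" for A t
      using that by (cases A rule: remdups_adj.cases) auto
    have "split_sum xs (\<lambda>A B. anchor_ops \<alpha> B (anchor_ops \<alpha> A r)) = split_sum xs (\<lambda>A B. 0)"
    proof (intro split_sum_cong, goal_cases)
      case (1 A B)
      have "hom C B" using 1 xs hom_subset[of C xs] by auto
      then show ?case
        using 1 that *[of A] *[of B] anchor_ops_0 by (cases "length A = 1") auto
    qed
    then show ?thesis by simp
  qed
  show ?thesis
  proof (cases xs rule: remdups_adj.cases)
    case (2 z)
    have "\<alpha> (fst z + 1) (q [z]) r = 0"
    proof (cases "fst z = -2")
      case True
      then show ?thesis using unary[of "snd z"] xs 2 by (cases z) auto
    next
      case False
      then show ?thesis using anchor_degree[OF ops_degreeD[OF deg, of "[z]"]] xs 2 by auto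
    qed
    then show ?thesis using 2 xs derivation_zero by (simp add: anchor_defect_def)
  next
    case (3 y z zs)
    show ?thesis
    proof (cases zs)
      case Nil
      show ?thesis
      proof (cases "fst y = -1 \<and> fst z = -1")
        case True
        then show ?thesis using binary[of "snd y" "snd z"] xs 3 Nil by (cases y; cases z) auto
      next
        case False
        then have "\<alpha> (total_degree xs + 1) (q xs) r = 0" using q0 3 Nil by auto
        then show ?thesis using 3 Nil xs False derivation_zero anchor_degree
          by (auto simp: anchor_defect_def)
      qed
    next
      case (Cons w ws)
      then show ?thesis using q0 split0 3 by (simp add: anchor_defect_def)
    qed
  qed (simp add: anchor_defect_def)
qed

lemma anchor_defect_pair:
  assumes "y \<in> C (-1)" "z \<in> C (-1)"
  shows "anchor_defect q [(-1, y), (-1, z)] r =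
    \<alpha> (-1) z (\<alpha> (-1) y r) - \<alpha> (-1) y (\<alpha> (-1) z r) + \<alpha> (-1) (q [(-1, y), (-1, z)]) r"
  using derivation_zero[OF assms(1)] derivation_zero[OF assms(2)]
  by (simp add: anchor_defect_def signed_def)

end

text \<open>The morphism defect is linear because the anomalies of the two brackets cancel.\<close>

lemma defect_scale:
  assumes "anchored_module s C \<alpha>" "anchored_module t D \<beta>"
    and q: "anchored_module.leibniz s C \<alpha> q" and h: "anchored_module.leibniz t D \<beta> h"
    and F: "ops_degree C D 0 F" "ops_symmetric C F" "ops_additive C F"
    and F_scale: "\<And>d x vs r. x \<in> C d \<Longrightarrow> hom C vs \<Longrightarrow> F ((d, s r x) # vs) = t r (F ((d, x) # vs))"
    and anchors: "\<And>d x r. x \<in> C d \<Longrightarrow> \<beta> d (F [(d, x)]) r = \<alpha> d x r"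
    and x: "x \<in> C d" and xs: "hom C xs"
  shows "morphism_defect q h F ((d, s r x) # xs) = t r (morphism_defect q h F ((d, x) # xs))"
proof -
  interpret M: anchored_module s C \<alpha> by fact
  interpret N: anchored_module t D \<beta> by fact
  note q_deg = q[unfolded M.leibniz_def, THEN conjunct1]
    and q_sym = q[unfolded M.leibniz_def, THEN conjunct2, THEN conjunct1]
    and q_add = q[unfolded M.leibniz_def, THEN conjunct2, THEN conjunct2, THEN conjunct1]
  have q_leib: "q ((d, s r x) # vs) = s r (q ((d, x) # vs)) + s (signed d (anchor_ops \<alpha> vs r)) x"
    if "x \<in> C d" "hom C vs" for d x vs r
    using q that by (auto simp: M.leibniz_def)
  have h_leib: "h ((d, t r x) # vs) = t r (h ((d, x) # vs)) + t (signed d (anchor_ops \<beta> vs r)) x"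
    if "x \<in> D d" "hom D vs" for d x vs r
    using h that by (auto simp: N.leibniz_def)
  let ?T = "\<lambda>x A B. F ((d + total_degree A + 1, q ((d, x) # A)) # B)"
  let ?S = "\<lambda>x A B. signed (d * total_degree A) (if A = [] then 0 else F ((total_degree A + 1, q A)
      # (d, x) # B))"
  let ?P = "\<lambda>x A Bs. h ((d + total_degree A, F ((d, x) # A)) # blocks F Bs)"
  let ?V = "\<lambda>A B. t (signed d (anchor_ops \<alpha> A r)) (F ((d, x) # B))"
  let ?U = "\<lambda>A B. t (signed (d + total_degree A) (anchor_ops \<alpha> B r)) (F ((d, x) # A))"
  have 1: "split_sum xs (?T (s r x)) = split_sum xs (\<lambda>A B. t r (?T x A B) + ?V A B)"
  proof (intro split_sum_cong, goal_cases)
    case (1 A B)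
    have homs: "hom C A" "hom C B" using 1 xs hom_subset[of C xs] by auto
    let ?e = "d + total_degree A + 1"
    have m: "q ((d, x) # A) \<in> C ?e"
      using x homs ops_degreeD[OF q_deg, of "(d, x) # A"] by auto
    have "?T (s r x) A B = F ((?e, s r (q ((d, x) # A)) + s (signed d (anchor_ops \<alpha> A r)) x) # B)"
      using q_leib[OF x homs(1)] by simp
    also have "\<dots> = F ((?e, s r (q ((d, x) # A))) # B) + F ((?e, s (signed d (anchor_ops \<alpha> A r)) x) # B)"
    proof -
      have "s (signed d (anchor_ops \<alpha> A r)) x \<in> C ?e"
        using M.anchor_ops_degree[OF homs(1)] M.scale_mem[OF x]
        by (cases "total_degree A = -1") (auto simp: M.zero_mem)
      then show ?thesis using F(3) homs(2) M.scale_mem[OF m] by (auto simp: ops_additive_def)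
    qed
    also have "F ((?e, s (signed d (anchor_ops \<alpha> A r)) x) # B) = ?V A B"
    proof (cases "total_degree A = -1")
      case True
      then show ?thesis using F_scale[OF x homs(2)] by simp
    next
      case False
      then show ?thesis
        using M.anchor_ops_degree[OF homs(1) False] ops_additive_0[OF F(3) M.subgroup_C homs(2)] by simp
    qed
    finally show ?case using F_scale[OF m homs(2)] by simp
  qed
  have 2: "split_sum xs (?S (s r x)) = split_sum xs (\<lambda>A B. t r (?S x A B))"
  proof (intro split_sum_cong, goal_cases)
    case (1 A B)
    show ?case
    proof (cases "A = []")
      case False
      have homs: "hom C A" "hom C B" using 1 xs hom_subset[of C xs] by auto
      let ?z = "(total_degree A + 1, q A)"
      have z: "snd ?z \<in> C (fst ?z)" using homs ops_degreeD[OF q_deg False] by simp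
      have sw: "F (?z # (d, w) # B) = signed (fst ?z * d) (F ((d, w) # ?z # B))" if "w \<in> C d" for w
        using ops_symmetricD[OF F(2), of "[]" ?z "(d, w)" B] that homs z by simp
      have "F ((d, s r x) # ?z # B) = t r (F ((d, x) # ?z # B))"
        using F_scale[OF x, of "?z # B"] homs z by simp
      then show ?thesis using False sw[OF x] sw[OF M.scale_mem[OF x]]
        by (simp add: N.scale_signed)
    qed simp
  qed
  \<comment> \<open>A single argument arises only from a single block. On two or more arguments of
    negative degree \<open>F\<close> lands in degree at most -2, where the anchor vanishes; on one
    argument \<open>F\<close> respects the anchors.\<close>
  have anchor_blocks: "part_sum B (\<lambda>Bs. anchor_ops \<beta> (blocks F Bs) r) = anchor_ops \<alpha> B r"
    if B: "hom C B" for B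
  proof (cases B)
    case (Cons y B')
    have "part_sum B (\<lambda>Bs. anchor_ops \<beta> (blocks F Bs) r) =
        split_sum B' (\<lambda>A' D'. part_sum D' (\<lambda>Bs. anchor_ops \<beta> (blocks F ((y # A') # Bs)) r))"
      by (simp add: Cons)
    also have "\<dots> = part_sum [] (\<lambda>Bs. anchor_ops \<beta> (blocks F ((y # B') # Bs)) r)"
    proof (rule split_sum_all_left, goal_cases)
      case (1 A' D')
      have "part_sum D' (\<lambda>Bs. anchor_ops \<beta> (blocks F ((y # A') # Bs)) r) = part_sum D' (\<lambda>Bs. 0)"
      proof (intro part_sum_cong, goal_cases)
        case prems: (1 Bs)
        then obtain K Ks where "Bs = K # Ks" using 1 by (cases Bs) auto
        then show ?case by simp
      qed
      then show ?case by simp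
    qed
    also have "\<dots> = \<beta> (total_degree B) (F B) r" by (simp add: Cons)
    also have "\<dots> = anchor_ops \<alpha> B r"
    proof (cases B')
      case Nil
      then show ?thesis using anchors[of "snd y" "fst y"] B Cons by simp
    next
      case (Cons y' B'')
      have "\<beta> (total_degree B) (F B) r = 0"
      proof (cases "\<exists>z\<in>set B. fst z \<ge> 0")
        case True
        then show ?thesis
          using ops_nonneg_degree[OF F(2,3) M.subgroup_C M.C_nonneg B] N.anchor_zero by auto
      next
        case False
        then have "total_degree B \<le> -2"
          using total_degree_le[of B] \<open>B = y # B'\<close> Cons by (force simp: not_le)
        then show ?thesis
          using N.anchor_degree[OF ops_degreeD[OF F(1) _ B]] \<open>B = y # B'\<close> by auto
      qed
      then show ?thesis using \<open>B = y # B'\<close> Cons by simp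
    qed
    finally show ?thesis .
  qed simp
  have 3: "split_sum xs (\<lambda>A B. part_sum B (?P (s r x) A)) =
      split_sum xs (\<lambda>A B. t r (part_sum B (?P x A)) + ?U A B)"
  proof (intro split_sum_cong, goal_cases)
    case (1 A B)
    have homs: "hom C A" "hom C B" using 1 xs hom_subset[of C xs] by auto
    have m: "F ((d, x) # A) \<in> D (d + total_degree A)"
      using x homs ops_degreeD[OF F(1), of "(d, x) # A"] by auto
    have "part_sum B (?P (s r x) A) = part_sum B (\<lambda>Bs. t r (?P x A Bs) +
        t (signed (d + total_degree A) (anchor_ops \<beta> (blocks F Bs) r)) (F ((d, x) # A)))"
    proof (intro part_sum_cong, goal_cases)
      case prems: (1 Bs)
      have "hom D (blocks F Bs)"
        by (rule hom_blocks[OF F(1)]) (use prems homs hom_subset[of C B] in auto)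
      then show ?case using h_leib[OF m] F_scale[OF x homs(1)] by simp
    qed
    then show ?case
      by (simp add: part_sum_add N.part_sum_scale N.part_sum_scale_left part_sum_signed anchor_blocks[OF
          homs(2)])
  qed
  \<comment> \<open>The anomaly of \<open>h \<circ> F\<close> comes from the part outside the block
    of \<open>x\<close>, that of \<open>F \<circ> q\<close> from the inner bracket; exchanging the
    two parts identifies them.\<close>
  have 4: "split_sum xs ?U = split_sum xs ?V"
  proof (subst split_sum_comm, intro split_sum_cong, goal_cases)
    case (1 A B)
    have homs: "hom C A" "hom C B" using 1 xs hom_subset[of C xs] by auto
    show ?case
    proof (cases "total_degree A = -1")
      case True
      have "signed (total_degree A * total_degree B) (signed (d + total_degree B) (anchor_ops \<alpha> A r)) =
          signed d (anchor_ops \<alpha> A r)"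
        unfolding signed_signed by (rule signed_cong) (simp add: True)
      then show ?thesis unfolding N.signed_scale by simp
    qed (simp add: M.anchor_ops_degree[OF homs(1)])
  qed
  have U: "compose_ops F 1 q ((d, x) # xs) = split_sum xs (?T x) + split_sum xs (?S x)" for x
    by (simp add: compose_ops_def)
  have P: "push_ops h F ((d, x) # xs) = split_sum xs (\<lambda>A B. part_sum B (?P x A))" for x
    by (simp add: push_ops_def)
  show ?thesis
    unfolding morphism_defect_def U P 1 2 3 split_sum_add 4 N.split_sum_scale
    by (simp add: N.scale_right_distrib N.scale_right_diff_distrib)
qed

section \<open>Projective modules\<close>

text \<open>Finite generation and projectivity in coordinates: generators \<open>b\<close> with
  coordinate functions \<open>\<phi>\<close>. Lifts, the trace ideal and connections are all built
  from these coordinates.\<close>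

definition dual_basis ::
  "('r::comm_ring_1 \<Rightarrow> 'm::ab_group_add \<Rightarrow> 'm) \<Rightarrow> 'm set \<Rightarrow> nat \<Rightarrow> (nat \<Rightarrow> 'm \<Rightarrow> 'r) \<Rightarrow> (nat \<Rightarrow> 'm) \<Rightarrow> bool" where
  "dual_basis s P n \<phi> b \<longleftrightarrow> (\<forall>j<n. b j \<in> P) \<and>
     (\<forall>j. \<forall>x\<in>P. \<forall>y\<in>P. \<phi> j (x + y) = \<phi> j x + \<phi> j y) \<and> (\<forall>j r. \<forall>x\<in>P. \<phi> j (s r x) = r * \<phi> j x) \<and>
     (\<forall>x\<in>P. x = (\<Sum>j<n. s (\<phi> j x) (b j)))"

lemma vector_bundle_dual_basis:
  assumes "module s" "vector_bundle s P"
  obtains n \<phi> b where "dual_basis s P n \<phi> b"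
proof -
  interpret module s by fact
  define t where "t = (\<lambda>(r :: 'a) (v :: nat \<Rightarrow> 'a) j. r * v j)"
  obtain n i p where
    i: "linear_on s P t {v. \<forall>j\<ge>n. v j = 0} i" and
    p: "linear_on t {v. \<forall>j\<ge>n. v j = 0} s P p" and pi: "\<forall>x\<in>P. p (i x) = x"
    using assms(2) by (auto simp: vector_bundle_def Let_def t_def)
  \<comment> \<open>The standard basis of the free module; its images under \<open>p\<close>
    generate the summand.\<close>
  define e where "e j = (\<lambda>k :: nat. if k = j then 1 else 0 :: 'a)" for j
  have te: "t c (e j) \<in> {v. \<forall>j\<ge>n. v j = 0}" if "j < n" for c j
    using that by (auto simp: t_def e_def)
  have p_sum: "(\<Sum>j<m. t (c j) (e j)) \<in> {v. \<forall>j\<ge>n. v j = 0} \<and>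
      p (\<Sum>j<m. t (c j) (e j)) = (\<Sum>j<m. s (c j) (p (e j)))" if "m \<le> n" for m c
    using that
  proof (induction m)
    case 0
    have "p (t 0 0) = s 0 (p 0)" using p by (auto simp: linear_on_def)
    then show ?case by (simp add: t_def zero_fun_def)
  next
    case (Suc m)
    have "p ((\<Sum>j<m. t (c j) (e j)) + t (c m) (e m)) = p (\<Sum>j<m. t (c j) (e j)) + p (t (c m) (e m))"
      using p te[of m] Suc by (auto simp: linear_on_def)
    moreover have "p (t (c m) (e m)) = s (c m) (p (e m))"
      using p Suc.prems by (auto simp: linear_on_def e_def)
    moreover have "(\<Sum>j<m. t (c j) (e j)) + t (c m) (e m) \<in> {v. \<forall>j\<ge>n. v j = 0}"
      using Suc te[of m "c m"] by auto
    moreover have "p (\<Sum>j<m. t (c j) (e j)) = (\<Sum>j<m. s (c j) (p (e j)))" using Suc by simp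
    ultimately show ?case unfolding sum.lessThan_Suc by (simp only: simp_thms)
  qed
  have expand: "v = (\<Sum>j<n. t (v j) (e j))" if "\<forall>j\<ge>n. v j = 0" for v
  proof
    fix k
    have "(\<Sum>j<n. t (v j) (e j)) k = (\<Sum>j<n. t (v j) (e j) k)"
      by (induction n) auto
    also have "\<dots> = (\<Sum>j<n. if j = k then v k else 0)"
      by (intro sum.cong) (auto simp: t_def e_def)
    also have "\<dots> = v k" using that by (auto simp: sum.delta)
    finally show "v k = (\<Sum>j<n. t (v j) (e j)) k" by simp
  qed
  have "dual_basis s P n (\<lambda>j x. i x j) (\<lambda>j. p (e j))"
    unfolding dual_basis_def
  proof (intro conjI allI impI ballI)
    fix j assume "j < n"
    then show "p (e j) \<in> P" using p by (auto simp: linear_on_def e_def)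
  next
    fix j x y assume "x \<in> P" "y \<in> P"
    then show "i (x + y) j = i x j + i y j" using i by (auto simp: linear_on_def)
  next
    fix j r x assume "x \<in> P"
    then show "i (s r x) j = r * i x j" using i by (auto simp: linear_on_def t_def)
  next
    fix x assume x: "x \<in> P"
    then have "i x = (\<Sum>j<n. t (i x j) (e j))" using i by (intro expand) (auto simp: linear_on_def)
    then have "p (i x) = (\<Sum>j<n. s (i x j) (p (e j)))" using p_sum[of n "i x"] by simp
    then show "x = (\<Sum>j<n. s (i x j) (p (e j)))" using pi x by simp
  qed
  then show ?thesis by (rule that)
qed

section \<open>Maps out of projective modules\<close>

lemma linear_on_0:
  assumes "linear_on s P t Q g" "module s" "module t" "0 \<in> P"
  shows "g 0 = 0"
proof -
  interpret s: module s by fact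
  interpret t: module t by fact
  have "g (s 0 0) = t 0 (g 0)" using assms(1,4) unfolding linear_on_def by blast
  then show ?thesis by simp
qed

lemma linear_on_sum:
  assumes "linear_on s P t Q g" "module s" "module t" "module.subspace s P"
    and "\<forall>j<n. b j \<in> P"
  shows "g (\<Sum>j<(n::nat). s (c j) (b j)) = (\<Sum>j<n. t (c j) (g (b j)))"
proof -
  interpret s: module s by fact
  have "(\<Sum>j<m. s (c j) (b j)) \<in> P \<and> g (\<Sum>j<m. s (c j) (b j)) = (\<Sum>j<m. t (c j) (g (b j)))" if "m \<le> n" for m
    using that
  proof (induction m)
    case 0
    then show ?case using linear_on_0[OF assms(1-3)] s.subspace_0[OF assms(4)] by simp
  next
    case (Suc m)
    then show ?case
      using assms(1,5) s.subspace_add[OF assms(4)] s.subspace_scale[OF assms(4)]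
      by (auto simp: linear_on_def)
  qed
  then show ?thesis by simp
qed

text \<open>Preimages are chosen for the values on the generators and extended by the coordinate
  functions.\<close>

lemma projective_lift:
  assumes P: "dual_basis s P n \<phi> b" "module s" "module.subspace s P"
    and N: "module.subspace t N" "module t" and u: "module u"
    and \<psi>: "linear_on t N u Q \<psi>" and g: "linear_on s P u Q g" and im: "\<forall>x\<in>P. g x \<in> \<psi> ` N"
  obtains \<theta> where "linear_on s P t N \<theta>" "\<And>x. x \<in> P \<Longrightarrow> \<psi> (\<theta> x) = g x"
proof -
  interpret t: module t by fact
  have b: "\<forall>j<n. b j \<in> P" using P(1) by (auto simp: dual_basis_def)
  have "\<forall>j. \<exists>y. j < n \<longrightarrow> y \<in> N \<and> \<psi> y = g (b j)"
    using b im by (metis imageE)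
  then obtain y where y: "\<And>j. j < n \<Longrightarrow> y j \<in> N" "\<And>j. j < n \<Longrightarrow> \<psi> (y j) = g (b j)" by metis
  let ?\<theta> = "\<lambda>x. \<Sum>j<n. t (\<phi> j x) (y j)"
  have "linear_on s P t N ?\<theta>"
    using P(1) y(1) unfolding linear_on_def dual_basis_def
    by (auto simp: t.scale_left_distrib sum.distrib t.scale_sum_right intro!: t.subspace_sum[OF N(1)]
        t.subspace_scale[OF N(1)])
  moreover have "\<psi> (?\<theta> x) = g x" if "x \<in> P" for x
  proof -
    have "\<psi> (?\<theta> x) = (\<Sum>j<n. u (\<phi> j x) (\<psi> (y j)))"
      by (rule linear_on_sum[OF \<psi> N(2) u N(1)]) (use y in auto)
    also have "\<dots> = (\<Sum>j<n. u (\<phi> j x) (g (b j)))" using y by simp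
    also have "\<dots> = g (\<Sum>j<n. s (\<phi> j x) (b j))"
      by (rule linear_on_sum[OF g P(2) u P(3) b, symmetric])
    also have "(\<Sum>j<n. s (\<phi> j x) (b j)) = x" using P(1) that by (auto simp: dual_basis_def)
    finally show ?thesis .
  qed
  ultimately show ?thesis by (rule that)
qed

text \<open>The trace ideal of a projective module is idempotent, so by Nakayama some element \<open>e\<close> of it
  acts as the identity on the module; the annihilator is thus generated by \<open>1 - e\<close>.\<close>

lemma annihilator_complement:
  assumes "module s" "module.subspace s P" "dual_basis s P n \<phi> b"
  obtains e where "\<And>x. x \<in> P \<Longrightarrow> s e x = x" "\<And>u. (\<And>x. x \<in> P \<Longrightarrow> s u x = 0) \<Longrightarrow> u * e = 0"
proof -
  interpret module s by fact
  \<comment> \<open>\<open>J\<close> is the annihilator of the annihilator of \<open>P\<close>. All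
    coordinates lie in it, hence so does the trace ideal, and membership of \<open>e\<close> in
    \<open>J\<close> is exactly the second claim.\<close>
  define J where "J = {v. \<forall>u. (\<forall>x\<in>P. s u x = 0) \<longrightarrow> u * v = 0}"
  have J: "0 \<in> J" "\<And>v w. v \<in> J \<Longrightarrow> w \<in> J \<Longrightarrow> v + w \<in> J" "\<And>v r. v \<in> J \<Longrightarrow> r * v \<in> J"
    by (auto simp: J_def distrib_left mult.left_commute)
  then have "\<And>v r. v \<in> J \<Longrightarrow> v * r \<in> J"
    by (simp add: mult.commute)
  note J = J this
  have b: "\<And>j. j < n \<Longrightarrow> b j \<in> P" using assms(3) by (auto simp: dual_basis_def)
  have \<phi>: "\<phi> j x \<in> J" if "x \<in> P" for j x
  proof -
    have "u * \<phi> j x = 0" if u: "\<forall>x\<in>P. s u x = 0" for u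
    proof -
      have "u * \<phi> j x = \<phi> j (s u x)" using assms(3) \<open>x \<in> P\<close> by (auto simp: dual_basis_def)
      also have "s u x = s 0 x" using u \<open>x \<in> P\<close> by simp
      also have "\<phi> j (s 0 x) = 0 * \<phi> j x" using assms(3) \<open>x \<in> P\<close> unfolding dual_basis_def by blast
      finally show ?thesis by simp
    qed
    then show ?thesis by (auto simp: J_def)
  qed
  \<comment> \<open>Generators are eliminated one at a time, from the last downwards:
    \<open>1 - e\<close> maps \<open>P\<close> into combinations of the first \<open>k\<close> of
    them with coefficients in \<open>J\<close>. For \<open>k = n\<close> take \<open>e = 0\<close>;
    for \<open>k = 0\<close> the module is killed by \<open>1 - e\<close>.\<close>
  have "\<exists>e\<in>J. \<forall>x\<in>P. \<exists>c. (\<forall>j. c j \<in> J) \<and> s (1 - e) x = (\<Sum>j<k. s (c j) (b j))" if "k \<le> n" for k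
    using that
  proof (induction k rule: inc_induct)
    case base
    have "\<exists>c. (\<forall>j. c j \<in> J) \<and> s (1 - 0) x = (\<Sum>j<n. s (c j) (b j))" if "x \<in> P" for x
      using \<phi>[OF that] assms(3) that by (intro exI[of _ "\<lambda>j. \<phi> j x"]) (auto simp: dual_basis_def)
    then show ?case using J(1) by blast
  next
    case (step k)
    then obtain e where e: "e \<in> J"
      "\<And>x. x \<in> P \<Longrightarrow> \<exists>c. (\<forall>j. c j \<in> J) \<and> s (1 - e) x = (\<Sum>j<Suc k. s (c j) (b j))" by auto
    obtain c where c: "\<And>j. c j \<in> J" "s (1 - e) (b k) = (\<Sum>j<Suc k. s (c j) (b j))"
      using e(2)[OF b] step.hyps by blast
    \<comment> \<open>The relation for \<open>b k\<close> expresses \<open>?g\<close> times this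
      generator by the earlier ones. \<open>e'\<close> is determined by
      \<open>1 - e' = ?g * (1 - e)\<close> and stays in \<open>J\<close>.\<close>
    let ?g = "1 - e - c k"
    define e' where "e' = e + (e + c k) * (1 - e)"
    have e': "1 - e' = ?g * (1 - e)" by (simp add: e'_def algebra_simps)
    have bk: "s ?g (b k) = (\<Sum>j<k. s (c j) (b j))"
      using c(2) by (simp add: scale_left_diff_distrib algebra_simps)
    have "\<exists>c. (\<forall>j. c j \<in> J) \<and> s (1 - e') x = (\<Sum>j<k. s (c j) (b j))" if x: "x \<in> P" for x
    proof -
      obtain d where d: "\<And>j. d j \<in> J" "s (1 - e) x = (\<Sum>j<Suc k. s (d j) (b j))"
        using e(2)[OF x] by blast
      have "s (1 - e') x = s ?g (s (1 - e) x)" by (simp add: e')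
      also have "\<dots> = (\<Sum>j<k. s (?g * d j) (b j)) + s (d k) (s ?g (b k))"
        by (simp add: d(2) scale_right_distrib scale_sum_right mult.commute)
      also have "\<dots> = (\<Sum>j<k. s (?g * d j + d k * c j) (b j))"
        by (simp add: bk scale_sum_right scale_left_distrib sum.distrib)
      finally show ?thesis using J c(1) d(1) by (intro exI[of _ "\<lambda>j. ?g * d j + d k * c j"]) auto
    qed
    moreover have "e' \<in> J" using J e(1) c(1) by (auto simp: e'_def)
    ultimately show ?case by blast
  qed
  from this[of 0] obtain e where e: "e \<in> J" "\<And>x. x \<in> P \<Longrightarrow> s (1 - e) x = 0" by auto
  show ?thesis
  proof (rule that[of e])
    show "s e x = x" if "x \<in> P" for x
      using e(2)[OF that] by (simp add: scale_left_diff_distrib)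
    show "u * e = 0" if "\<And>x. x \<in> P \<Longrightarrow> s u x = 0" for u
      using e(1) that by (auto simp: J_def)
  qed
qed

lemma dual_basis_Times:
  assumes "dual_basis s P n \<phi> b" "dual_basis t Q m \<psi> c" "module s" "module t"
    and "0 \<in> P" "0 \<in> Q"
  shows "dual_basis (\<lambda>r z. (s r (fst z), t r (snd z))) (P \<times> Q) (n + m)
    (\<lambda>j z. if j < n then \<phi> j (fst z) else \<psi> (j - n) (snd z))
    (\<lambda>j. if j < n then (b j, 0) else (0, c (j - n)))"
proof -
  interpret s: module s by fact
  interpret t: module t by fact
  have "z = (\<Sum>j<n + m. (s (if j < n then \<phi> j (fst z) else \<psi> (j - n) (snd z))
      (fst (if j < n then (b j, 0) else (0, c (j - n)))),
      t (if j < n then \<phi> j (fst z) else \<psi> (j - n) (snd z)) (snd (if j < n then (b j, 0)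
          else (0, c (j - n))))))"
    (is "z = (\<Sum>j<n + m. ?g j)") if "z \<in> P \<times> Q" for z
  proof -
    have "(\<Sum>j<n + m. ?g j) = (\<Sum>j<n. ?g j) + (\<Sum>j<m. ?g (n + j))"
      by (induction m) (auto simp: add.assoc)
    also have "(\<Sum>j<n. ?g j) = (\<Sum>j<n. (s (\<phi> j (fst z)) (b j), 0))"
      by (intro sum.cong) auto
    also have "\<dots> = (\<Sum>j<n. s (\<phi> j (fst z)) (b j), 0)"
      by (simp add: sum_prod)
    also have "(\<Sum>j<m. ?g (n + j)) = (0, \<Sum>j<m. t (\<psi> j (snd z)) (c j))"
      by (simp add: sum_prod)
    finally show ?thesis using assms(1,2) that by (auto simp: dual_basis_def)
  qed
  then show ?thesis
    using assms by (auto simp: dual_basis_def)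
qed

section \<open>Contracting an acyclic complex of projective modules\<close>

text \<open>Descending from degree 0, the contraction in each degree is a lift of
  \<open>x - g (\<Delta> x)\<close> through the differential, where \<open>g\<close> is the
  contraction one degree higher. This element is a cycle, hence a boundary by exactness, and
  projectivity gives a linear lift.\<close>

lemma contraction_exists:
  fixes s :: "'r::comm_ring_1 \<Rightarrow> 'm::ab_group_add \<Rightarrow> 'm" and K :: "int \<Rightarrow> 'm set"
  assumes s: "module s" and K: "\<And>d. module.subspace s (K d)" "\<And>d. \<exists>n \<phi> b. dual_basis s (K d) n \<phi> b"
    and top: "\<And>d. d \<ge> 0 \<Longrightarrow> K d = {0}"
    and \<Delta>: "\<And>d. linear_on s (K d) s (K (d + 1)) (\<Delta> d)"
    and sq: "\<And>d x. x \<in> K d \<Longrightarrow> \<Delta> (d + 1) (\<Delta> d x) = 0"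
    and exact: "\<And>d x. x \<in> K d \<Longrightarrow> \<Delta> d x = 0 \<Longrightarrow> x \<in> \<Delta> (d - 1) ` K (d - 1)"
  obtains h where "\<And>d. linear_on s (K d) s (K (d - 1)) (h d)"
    "\<And>d x. x \<in> K d \<Longrightarrow> \<Delta> (d - 1) (h d x) + h (d + 1) (\<Delta> d x) = x"
proof -
  interpret module s by fact
  have K0: "0 \<in> K d" for d using subspace_0[OF K(1)] .
  have \<Delta>0: "\<Delta> d 0 = 0" for d by (rule linear_on_0[OF \<Delta> s s K0])
  \<comment> \<open>The second half of \<open>P\<close> is what makes
    \<open>x - g (\<Delta> x)\<close> a cycle one degree below; \<open>Q\<close> is the homotopy
    identity linking two consecutive degrees.\<close>
  define P where "P n g \<longleftrightarrow> linear_on s (K (- int n)) s (K (- int n - 1)) g \<and>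
    (\<forall>x\<in>K (- int n). \<Delta> (- int n) x = 0 \<longrightarrow> \<Delta> (- int n - 1) (g x) = x)" for n g
  define Q where "Q n g g' \<longleftrightarrow> (\<forall>x\<in>K (- int n - 1). \<Delta> (- int n - 2) (g' x) + g (\<Delta> (- int n - 1) x) = x)"
      for n g g'
  have "\<exists>h. \<forall>n. P n (h n) \<and> Q n (h n) (h (Suc n))"
  proof (rule dependent_nat_choice)
    show "\<exists>g. P 0 g"
      by (rule exI[of _ "\<lambda>_. 0"]) (auto simp: P_def linear_on_def top K0 \<Delta>0)
  next
    fix g n assume g: "P n g"
    let ?d = "- int n - 1"
    have lin: "linear_on s (K (?d + 1)) s (K ?d) g" using g by (simp add: P_def)
    let ?k = "\<lambda>x. x - g (\<Delta> ?d x)"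
    have k: "linear_on s (K ?d) s (K ?d) ?k"
      unfolding linear_on_def
    proof (intro conjI ballI allI)
      fix x assume x: "x \<in> K ?d"
      then have D: "\<Delta> ?d x \<in> K (?d + 1)" using \<Delta>[of ?d] unfolding linear_on_def by blast
      then have "g (\<Delta> ?d x) \<in> K ?d" using lin unfolding linear_on_def by blast
      then show "?k x \<in> K ?d" using x subspace_diff[OF K(1)] by blast
      fix r
      have "\<Delta> ?d (s r x) = s r (\<Delta> ?d x)" using \<Delta>[of ?d] x unfolding linear_on_def by blast
      moreover have "g (s r (\<Delta> ?d x)) = s r (g (\<Delta> ?d x))" using lin D unfolding linear_on_def by blast
      ultimately show "?k (s r x) = s r (?k x)" by (simp add: scale_right_diff_distrib)
    next
      fix x y assume xy: "x \<in> K ?d" "y \<in> K ?d"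
      then have D: "\<Delta> ?d x \<in> K (?d + 1)" "\<Delta> ?d y \<in> K (?d + 1)" "\<Delta> ?d (x + y) = \<Delta> ?d x + \<Delta> ?d y"
        using \<Delta>[of ?d] unfolding linear_on_def by blast+
      then have "g (\<Delta> ?d x + \<Delta> ?d y) = g (\<Delta> ?d x) + g (\<Delta> ?d y)"
        using lin unfolding linear_on_def by blast
      then show "?k (x + y) = ?k x + ?k y" using D by simp
    qed
    have im: "?k x \<in> \<Delta> (?d - 1) ` K (?d - 1)" if x: "x \<in> K ?d" for x
    proof (rule exact)
      show kx: "?k x \<in> K ?d" using k x unfolding linear_on_def by blast
      have D: "\<Delta> ?d x \<in> K (?d + 1)" using \<Delta>[of ?d] x unfolding linear_on_def by blast
      then have gD: "g (\<Delta> ?d x) \<in> K ?d" using lin unfolding linear_on_def by blast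
      have "\<Delta> ?d (?k x + g (\<Delta> ?d x)) = \<Delta> ?d (?k x) + \<Delta> ?d (g (\<Delta> ?d x))"
        using \<Delta>[of ?d] kx gD unfolding linear_on_def by blast
      moreover have "\<Delta> ?d (g (\<Delta> ?d x)) = \<Delta> ?d x"
        using g D sq[OF x] by (simp add: P_def)
      ultimately show "\<Delta> ?d (?k x) = 0" by simp
    qed
    have \<Delta>': "linear_on s (K (?d - 1)) s (K ?d) (\<Delta> (?d - 1))"
      using \<Delta>[of "?d - 1"] by (simp only: diff_add_cancel)
    obtain m \<phi> b where "dual_basis s (K ?d) m \<phi> b" using K(2) by blast
    from projective_lift[OF this s K(1) K(1) s s \<Delta>' k] im obtain g' where
      g': "linear_on s (K ?d) s (K (?d - 1)) g'" "\<And>x. x \<in> K ?d \<Longrightarrow> \<Delta> (?d - 1) (g' x) = ?k x" by blast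
    have g0: "g 0 = 0" by (rule linear_on_0[OF lin s s K0])
    have e: "- int (Suc n) = ?d" "- int n - 2 = ?d - 1" by simp_all
    have "P (Suc n) g'" unfolding P_def e using g' g0 by auto
    moreover have "Q n g g'" unfolding Q_def e using g'(2) by auto
    ultimately show "\<exists>g'. P (Suc n) g' \<and> Q n g g'" by blast
  qed
  then obtain h where h: "\<And>n. P n (h n)" "\<And>n. Q n (h n) (h (Suc n))" by blast
  define H where "H d = (if d > 0 then (\<lambda>_. 0) else h (nat (- d)))" for d :: int
  have lin: "linear_on s (K d) s (K (d - 1)) (H d)" for d
  proof (cases "d > 0")
    case True
    then show ?thesis by (auto simp: H_def linear_on_def K0)
  next
    case False
    then show ?thesis using h(1)[of "nat (- d)"] by (auto simp: H_def P_def)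
  qed
  moreover have "\<Delta> (d - 1) (H d x) + H (d + 1) (\<Delta> d x) = x" if x: "x \<in> K d" for d x
  proof (cases "d \<ge> 0")
    case True
    then have "x = 0" using x top by auto
    then show ?thesis
      using \<Delta>0 linear_on_0[OF lin s s K0, of d] linear_on_0[OF lin s s K0, of "d + 1"] by simp
  next
    case False
    define n where "n = nat (- d - 1)"
    have d: "d = - int n - 1" "nat (- d) = Suc n" "nat (- (d + 1)) = n" using False by (auto simp: n_def)
    have "\<Delta> (- int n - 2) (h (Suc n) x) + h n (\<Delta> (- int n - 1) x) = x"
      using h(2)[of n] x d(1) by (auto simp: Q_def)
    moreover have "H d = h (Suc n)" "H (d + 1) = h n" using False d by (auto simp: H_def)
    moreover have "d - 1 = - int n - 2" using d(1) by simp
    ultimately show ?thesis using d(1) by metis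
  qed
  ultimately show ?thesis by (rule that)
qed

section \<open>Transfer along a quasi-isomorphism\<close>

text \<open>Flatness with first argument \<open>x\<close> and with \<open>r x\<close> forces the
  anomaly to annihilate the component of degree -1. Where that bundle is zero this says nothing, but
  there the anchors vanish too. Algebraically, \<open>e\<close> fixes all values of the anchor,
  hence the anomaly, while the product of the anomaly with \<open>e\<close> is zero.\<close>

lemma (in anchored_module) anchor_defect_flat:
  assumes q: "leibniz q" and flat: "\<And>ys. hom C ys \<Longrightarrow> ys \<noteq> [] \<Longrightarrow> compose_ops q 1 q ys = 0"
    and unary: "\<And>x r. x \<in> C (-2) \<Longrightarrow> \<alpha> (-1) (q [(-2, x)]) r = 0"
    and basis: "dual_basis s (C (-1)) n \<phi> b" and xs: "hom C xs"
  shows "anchor_defect q xs r = 0"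
proof (rule anchor_defect_eq_0[OF q xs unary])
  fix y z assume xs_eq: "xs = [(-1, y), (-1, z)]" and yz: "y \<in> C (-1)" "z \<in> C (-1)"
  let ?u = "anchor_defect q xs r"
  obtain e where e: "\<And>x. x \<in> C (-1) \<Longrightarrow> s e x = x" "\<And>u. (\<And>x. x \<in> C (-1) \<Longrightarrow> s u x = 0) \<Longrightarrow> u * e = 0"
    by (rule annihilator_complement[OF module_axioms subspace_C basis]) blast
  have "s ?u x = 0" if "x \<in> C (-1)" for x
    using curvature_scale[OF q that xs, of r] flat[of "(-1, x) # xs"] flat[of "(-1, s r x) # xs"]
      scale_mem[OF that, of r] that xs by simp
  then have "?u * e = 0" by (rule e(2))
  moreover have "?u = e * ?u"
  proof -
    have "q xs \<in> C (-1)"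
      using ops_degreeD[of C C 1 q xs] q xs xs_eq by (auto simp: leibniz_def)
    moreover have "\<alpha> (-1) w t = e * \<alpha> (-1) w t" if "w \<in> C (-1)" for w t
      using anchor_scale[OF that, of e t] e(1)[OF that] by simp
    ultimately show ?thesis
      using yz unfolding xs_eq anchor_defect_pair[OF yz] distrib_left right_diff_distrib by metis
  qed
  ultimately show "?u = 0" by (simp add: mult.commute)
qed

section \<open>Changing operations in a single arity\<close>

lemma compose_ops_cong:
  assumes "\<And>zs. length zs \<le> length xs \<Longrightarrow> h zs = h' zs" "\<And>zs. length zs \<le> length xs \<Longrightarrow> q zs = q' zs"
  shows "compose_ops h c q xs = compose_ops h' c q' xs"
  unfolding compose_ops_def
proof (intro split_sum_cong, goal_cases)
  case (1 A B)
  then show ?case using assms(1)[of "(total_degree A + c, q' A) # B"] assms(2)[of A]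
    by (cases A) auto
qed

lemma length_block_le: "B \<in> set Bs \<Longrightarrow> length B \<le> length (concat Bs)"
  by (induction Bs) auto

lemma push_ops_cong:
  assumes "\<And>zs. length zs \<le> length xs \<Longrightarrow> F zs = F' zs"
  shows "push_ops h F xs = push_ops h F' xs"
  unfolding push_ops_def
proof (intro part_sum_cong, goal_cases)
  case (1 Bs)
  have "F B = F' B" if "B \<in> set Bs" for B
    by (rule assms) (use length_block_le[OF that] 1 in simp)
  then have "blocks F Bs = blocks F' Bs" by simp
  then show ?case by (rule arg_cong)
qed

lemma morphism_defect_cong:
  assumes "\<And>zs. length zs \<le> length xs \<Longrightarrow> F zs = F' zs" "\<And>zs. length zs \<le> length xs \<Longrightarrow> q zs = q' zs"
  shows "morphism_defect q h F xs = morphism_defect q' h F' xs"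
  unfolding morphism_defect_def
  using compose_ops_cong[of xs F F' q q' 1, OF assms] push_ops_cong[of xs F F' h, OF assms(1)] by (simp only:)

text \<open>On \<open>xs\<close>, a change of \<open>q\<close> in this arity is felt only under the
  unary part of \<open>h\<close>, and a change of \<open>h\<close> only around unary
  \<open>q\<close>. As the arity is at least 2, the unary parts are untouched and the two changes
  never meet in one term.\<close>

lemma compose_ops_perturb:
  assumes N: "length xs \<ge> 2"
    and h': "\<And>zs. length zs \<noteq> length xs \<Longrightarrow> h' zs = h zs"
      "\<And>zs. length zs = length xs \<Longrightarrow> h' zs = h zs - v zs"
    and q': "\<And>zs. length zs \<noteq> length xs \<Longrightarrow> q' zs = q zs"
      "\<And>zs. length zs = length xs \<Longrightarrow> q' zs = q zs - u zs"
    and h_diff: "\<And>A. set A \<subseteq> set xs \<Longrightarrow> length A = length xs \<Longrightarrow>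
      h [(total_degree A + c, q A - u A)] = h [(total_degree A + c, q A)] - h [(total_degree A + c, u A)]"
  shows "compose_ops h' c q' xs =
    compose_ops h c q xs - compose_unary v c q xs - h [(total_degree xs + c, u xs)]"
proof -
  let ?E = "\<lambda>A B. if B = [] then h [(total_degree A + c, u A)] else 0"
  have "compose_ops h' c q' xs = split_sum xs (\<lambda>A B. (if A = [] then 0 else h ((total_degree A + c, q A)
      # B)) -
      (if length A = 1 then v ((total_degree A + c, q A) # B) else 0) - ?E A B)"
    unfolding compose_ops_def
  proof (intro split_sum_cong, goal_cases)
    case (1 A B)
    consider "A = []" "B \<noteq> []" | "length A = 1" "B \<noteq> []" | "length A = length xs" "length A \<ge> 2" "B = []"
      | "length A \<ge> 2" "length A \<noteq> length xs" "Suc (length B) \<noteq> length xs" "B \<noteq> []"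
      using 1 N by (cases A; cases "tl A"; cases B) auto
    then show ?case
    proof cases
      case 2
      then have "length A \<noteq> length xs" "length ((total_degree A + c, q A) # B) = length xs"
        using 1 N by auto
      then show ?thesis using 2 h'(2) q'(1)[of A] by auto
    next
      case 3
      then have "h' [(total_degree A + c, q' A)] = h [(total_degree A + c, q A - u A)]"
        using h'(1)[of "[(total_degree A + c, q' A)]"] q'(2)[of A] by simp
      then show ?thesis using 3 h_diff[of A] 1 by auto
    next
      case 4
      then show ?thesis using h'(1)[of "(total_degree A + c, q A) # B"] q'(1)[of A] by auto
    qed simp
  qed
  also have "\<dots> = compose_ops h c q xs - compose_unary v c q xs - split_sum xs ?E"
    unfolding compose_ops_def compose_unary_def split_sum_diff ..
  also have "split_sum xs ?E = h [(total_degree xs + c, u xs)]"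
    by (subst split_sum_all_left) auto
  finally show ?thesis .
qed

text \<open>A block of full length leaves room for no other, so the change of \<open>F\<close> meets
  only the unary part of \<open>h\<close>.\<close>

lemma push_ops_perturb:
  assumes "xs \<noteq> []"
    and F': "\<And>zs. length zs \<noteq> length xs \<Longrightarrow> F' zs = F zs"
      "\<And>zs. length zs = length xs \<Longrightarrow> F' zs = F zs - v zs"
    and h_diff: "\<And>A. set A \<subseteq> set xs \<Longrightarrow> length A = length xs \<Longrightarrow>
      h [(total_degree A, F A - v A)] = h [(total_degree A, F A)] - h [(total_degree A, v A)]"
  shows "push_ops h F' xs = push_ops h F xs - h [(total_degree xs, v xs)]"
proof -
  obtain x ys where xs: "xs = x # ys" using assms(1) by (cases xs) auto
  let ?E = "\<lambda>A B. if B = [] then h [(total_degree (x # A), v (x # A))] else 0"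
  have "push_ops h F' xs = split_sum ys (\<lambda>A B. part_sum B (\<lambda>Bs. h (blocks F ((x # A) # Bs))) - ?E A B)"
    unfolding push_ops_def xs part_sum.simps
  proof (intro split_sum_cong, goal_cases)
    case (1 A B)
    show ?case
    proof (cases "B = []")
      case True
      then show ?thesis using F'(2)[of "x # A"] h_diff[of "x # A"] 1 xs by auto
    next
      case False
      have "part_sum B (\<lambda>Bs. h (blocks F' ((x # A) # Bs))) = part_sum B (\<lambda>Bs. h (blocks F ((x # A) # Bs)))"
      proof (intro part_sum_cong, goal_cases)
        case prems: (1 Bs)
        have "F' K = F K" if "K \<in> set ((x # A) # Bs)" for K
        proof (rule F'(1))
          have "length K \<le> length B \<or> length K \<le> Suc (length A)"
            using that prems length_block_le[of K Bs] by auto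
          then show "length K \<noteq> length xs" using 1 False xs by (cases B) auto
        qed
        then have "blocks F' ((x # A) # Bs) = blocks F ((x # A) # Bs)" by simp
        then show ?case by (rule arg_cong)
      qed
      then show ?thesis using False by simp
    qed
  qed
  also have "\<dots> = push_ops h F xs - split_sum ys ?E"
    unfolding split_sum_diff push_ops_def xs part_sum.simps ..
  also have "split_sum ys ?E = h [(total_degree xs, v xs)]"
    by (subst split_sum_all_left) (auto simp: xs)
  finally show ?thesis .
qed

text \<open>Lets the contraction, which acts on values, pass the differential, which acts on
  arguments.\<close>

lemma compose_unary_additive:
  assumes K: "\<And>d. additive_on (K d) (g d)" and q: "ops_degree C C 1 q" and xs: "hom C xs"
    and Z: "\<And>zs. hom C zs \<Longrightarrow> zs \<noteq> [] \<Longrightarrow> Z zs \<in> K (total_degree zs)"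
  shows "compose_unary (\<lambda>zs. g (total_degree zs) (Z zs)) 1 q xs =
    g (total_degree xs + 1) (compose_unary Z 1 q xs)"
proof -
  let ?z = "\<lambda>A B. (total_degree A + 1, q A) # B"
  have eq: "g (total_degree xs + 1) (split_sum xs (\<lambda>A B. if length A = 1 then Z (?z A B) else 0)) =
      split_sum xs (\<lambda>A B. g (total_degree xs + 1) (if length A = 1 then Z (?z A B) else 0))"
  proof (rule split_sum_additive(2)[OF K], goal_cases)
    case (1 A B)
    have homs: "hom C A" "hom C B" using 1 xs hom_subset[of C xs] by auto
    show ?case
    proof (cases "length A = 1")
      case True
      then have "A \<noteq> []" by auto
      then have "hom C (?z A B)" using ops_degreeD[OF q _ homs(1)] homs by auto
      then show ?thesis using Z[of "?z A B"] 1 True by (auto simp: algebra_simps)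
    next
      case False
      then show ?thesis using K by (auto simp: additive_on_def subgroup_set_def)
    qed
  qed
  show ?thesis
    unfolding compose_unary_def eq
    by (intro split_sum_cong) (auto simp: algebra_simps additive_on_0[OF K])
qed

text \<open>\<open>H\<close> contracts the cone of \<open>f\<close>, whose part of degree
  \<open>d\<close> is \<open>C (d + 1) \<times> D d\<close>; its differential sends
  \<open>(x, y)\<close> to the pair of \<open>\<delta> x\<close> and \<open>f x\<close> minus the
  unary \<open>h\<close> of \<open>y\<close>. The minus sign fits the cocycle identity for the
  defect.\<close>

locale homotopy_transfer =
  M: anchored_module s C \<alpha> + N: anchored_module t D \<beta>
  for s :: "'r::comm_ring_1 \<Rightarrow> 'm::ab_group_add \<Rightarrow> 'm" and C \<alpha>
    and t :: "'r \<Rightarrow> 'n::ab_group_add \<Rightarrow> 'n" and D \<beta> +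
  fixes \<delta> :: "int \<Rightarrow> 'm \<Rightarrow> 'm" and f :: "int \<Rightarrow> 'm \<Rightarrow> 'n" and h :: "('n, 'n) ops"
    and H :: "int \<Rightarrow> 'm \<times> 'n \<Rightarrow> 'm \<times> 'n"
  assumes half_m: "\<And>y :: 'm. y + y = 0 \<Longrightarrow> y = 0" and half_n: "\<And>y :: 'n. y + y = 0 \<Longrightarrow> y = 0"
    and h_leibniz: "N.leibniz h" and h_flat: "hom D ys \<Longrightarrow> ys \<noteq> [] \<Longrightarrow> compose_ops h 1 h ys = 0"
    and h_anchor: "hom D ys \<Longrightarrow> N.anchor_defect h ys r = 0"
    and \<delta>_linear: "linear_on s (C d) s (C (d + 1)) (\<delta> d)"
    and \<delta>_square: "x \<in> C d \<Longrightarrow> \<delta> (d + 1) (\<delta> d x) = 0"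
    and f_linear: "linear_on s (C d) t (D d) (f d)"
    and f_chain: "x \<in> C d \<Longrightarrow> f (d + 1) (\<delta> d x) = h [(d, f d x)]"
    and f_anchor: "x \<in> C d \<Longrightarrow> \<beta> d (f d x) r = \<alpha> d x r"
    and H_linear: "linear_on (\<lambda>r z. (s r (fst z), t r (snd z))) (C (d + 1) \<times> D d)
        (\<lambda>r z. (s r (fst z), t r (snd z))) (C d \<times> D (d - 1)) (H d)"
    and H_homotopy: "x \<in> C (d + 1) \<Longrightarrow> y \<in> D d \<Longrightarrow>
        (\<delta> d (fst (H d (x, y))), f d (fst (H d (x, y))) - h [(d - 1, snd (H d (x, y)))]) +
        H (d + 1) (\<delta> (d + 1) x, f (d + 1) x - h [(d, y)]) = (x, y)"
begin

text \<open>\<open>q\<close> and \<open>F\<close> are complete families at every stage, so that a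
  step may alter one arity and leave the rest alone; \<open>n\<close> bounds only the arities in
  which the equations are known.\<close>

definition transfer_state :: "nat \<Rightarrow> ('m, 'm) ops \<Rightarrow> ('m, 'n) ops \<Rightarrow> bool" where
  "transfer_state n q F \<longleftrightarrow>
     M.leibniz q \<and> ops_degree C D 0 F \<and> ops_symmetric C F \<and> ops_additive C F \<and>
     (\<forall>d x vs r. x \<in> C d \<longrightarrow> hom C vs \<longrightarrow> F ((d, s r x) # vs) = t r (F ((d, x) # vs))) \<and>
     (\<forall>d. \<forall>x\<in>C d. q [(d, x)] = \<delta> d x \<and> F [(d, x)] = f d x) \<and>
     (\<forall>ys. hom C ys \<longrightarrow> ys \<noteq> [] \<longrightarrow> length ys \<le> n \<longrightarrow>
        compose_ops q 1 q ys = 0 \<and> morphism_defect q h F ys = 0)"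

text \<open>As the binary defect vanishes, \<open>f\<close> of the bracket of \<open>y\<close> and
  \<open>z\<close> differs from the bracket of their images by a boundary, which the anchor kills.
  The anomaly of \<open>q\<close> is therefore that of \<open>h\<close>, which is zero. Pairs occur
  only for \<open>n \<ge> 2\<close>, which is when this defect is under control.\<close>

lemma anchor_defect_transfer:
  assumes st: "transfer_state n q F" and xs: "hom C xs" "length xs \<le> n"
  shows "M.anchor_defect q xs r = 0"
proof (rule M.anchor_defect_eq_0)
  show q: "M.leibniz q" and "hom C xs" using st xs by (auto simp: transfer_state_def)
  have q1: "q [(d, x)] = \<delta> d x" "F [(d, x)] = f d x" if "x \<in> C d" for d x
    using st that by (auto simp: transfer_state_def)
  have h_unary: "\<beta> (-1) (h [(-2, y)]) r = 0" if "y \<in> D (-2)" for y r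
    using h_anchor[of "[(-2, y)]" r] that N.derivation_zero by (simp add: N.anchor_defect_def)
  have \<delta>D: "\<delta> d x \<in> C (d + 1)" if "x \<in> C d" for d x using \<delta>_linear[of d] that by (auto simp: linear_on_def)
  have fD: "f d x \<in> D d" if "x \<in> C d" for d x using f_linear[of d] that by (auto simp: linear_on_def)
  show "\<alpha> (-1) (q [(-2, x)]) r = 0" if x: "x \<in> C (-2)" for x r
  proof -
    have "\<alpha> (-1) (\<delta> (-2) x) r = \<beta> (-1) (f (-1) (\<delta> (-2) x)) r"
      using f_anchor[of "\<delta> (-2) x" "-1" r] \<delta>D[OF x] by simp
    also have "f (-1) (\<delta> (-2) x) = h [(-2, f (-2) x)]" using f_chain[OF x] by simp
    finally show ?thesis using h_unary fD[OF x] q1[OF x] by simp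
  qed
  fix y z assume xs_eq: "xs = [(-1, y), (-1, z)]" and yz: "y \<in> C (-1)" "z \<in> C (-1)"
  have F: "ops_degree C D 0 F" "ops_additive C F" using st by (auto simp: transfer_state_def)
  \<comment> \<open>After the shift the component of degree 0 is zero, so insertions of the unary
    bracket drop out.\<close>
  have "q [(-1, y)] \<in> C 0" "q [(-1, z)] \<in> C 0" using q1 \<delta>D yz by fastforce+
  then have "q [(-1, y)] = 0" "q [(-1, z)] = 0" using M.C_nonneg by auto
  then have U: "compose_ops F 1 q xs = F [(-1, q xs)]"
    using ops_additive_0[OF F(2) M.subgroup_C, of "[(-1, y)]" 0] ops_additive_0[OF F(2)
        M.subgroup_C, of "[(-1, z)]" 0] yz
    by (simp add: compose_ops_def xs_eq)
  have P: "push_ops h F xs = h [(-2, F xs)] + h [(-1, f (-1) y), (-1, f (-1) z)]"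
    using q1 yz by (simp add: push_ops_def xs_eq)
  have "q xs \<in> C (-1)" "F xs \<in> D (-2)"
    using ops_degreeD[of C C 1 q xs] ops_degreeD[OF F(1), of xs] q xs xs_eq by (auto simp: M.leibniz_def)
  have "morphism_defect q h F xs = 0" using st xs xs_eq by (auto simp: transfer_state_def)
  then have "f (-1) (q xs) = h [(-2, F xs)] + h [(-1, f (-1) y), (-1, f (-1) z)]"
    using U P q1 \<open>q xs \<in> C (-1)\<close> by (simp add: morphism_defect_def)
  moreover have "h [(-2, F xs)] \<in> D (-1)" "h [(-1, f (-1) y), (-1, f (-1) z)] \<in> D (-1)"
    using ops_degreeD[of D D 1 h "[(-2, F xs)]"] ops_degreeD[of D D 1 h "[(-1, f (-1) y), (-1, f (-1) z)]"]
      h_leibniz \<open>F xs \<in> D (-2)\<close> fD yz by (auto simp: N.leibniz_def)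
  ultimately have "\<alpha> (-1) (q xs) r = \<beta> (-1) (h [(-1, f (-1) y), (-1, f (-1) z)]) r"
    using f_anchor[OF \<open>q xs \<in> C (-1)\<close>, of r] N.anchor_add h_unary \<open>F xs \<in> D (-2)\<close> by simp
  then show "M.anchor_defect q xs r = 0"
    using h_anchor[of "[(-1, f (-1) y), (-1, f (-1) z)]" r] fD yz f_anchor
    by (simp add: xs_eq M.anchor_defect_pair N.anchor_defect_pair)
qed

end

section \<open>The inductive step\<close>

lemma split_sum_Pair: "split_sum xs (\<lambda>A B. (\<phi> A B, \<psi> A B)) = (split_sum xs \<phi>, split_sum xs \<psi>)"
proof -
  have "fst (split_sum xs (\<lambda>A B. (\<phi> A B, \<psi> A B))) = split_sum xs (\<lambda>A B. fst (\<phi> A B, \<psi> A B))"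
    "snd (split_sum xs (\<lambda>A B. (\<phi> A B, \<psi> A B))) = split_sum xs (\<lambda>A B. snd (\<phi> A B, \<psi> A B))"
    by (rule split_sum_additive(2)[of UNIV]; simp add: additive_on_def subgroup_set_def)+
  then show ?thesis by (simp add: prod_eq_iff)
qed

lemma compose_unary_Pair:
  "compose_unary (\<lambda>zs. (u zs, v zs)) c q xs = (compose_unary u c q xs, compose_unary v c q xs)"
  unfolding compose_unary_def split_sum_Pair[symmetric]
  by (intro split_sum_cong) (auto simp: zero_prod_def)

lemma ops_symmetric_diff:
  assumes "ops_symmetric C g" "ops_symmetric C g'"
  shows "ops_symmetric C (\<lambda>xs. g xs - g' xs)"
  unfolding ops_symmetric_def
proof (intro allI impI)
  fix us x y vs assume hm: "hom C (us @ x # y # vs)"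
  show "g (us @ x # y # vs) - g' (us @ x # y # vs) =
      signed (fst x * fst y) (g (us @ y # x # vs) - g' (us @ y # x # vs))"
    unfolding ops_symmetricD[OF assms(1) hm] ops_symmetricD[OF assms(2) hm] by (simp add: signed_def)
qed

lemma ops_symmetric_restrict:
  assumes "ops_symmetric C g"
  shows "ops_symmetric C (\<lambda>xs. if length xs = n then g xs else 0)"
  unfolding ops_symmetric_def
proof (intro allI impI)
  fix us x y vs assume hm: "hom C (us @ x # y # vs)"
  show "(if length (us @ x # y # vs) = n then g (us @ x # y # vs) else 0) =
      signed (fst x * fst y) (if length (us @ y # x # vs) = n then g (us @ y # x # vs) else 0)"
    unfolding ops_symmetricD[OF assms hm] by simp
qed

context homotopy_transfer
begin

text \<open>The contraction acts on values and is linear, so the correction inherits symmetry and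
  multilinearity from curvature and defect. In arity \<open>n + 1\<close> the curvature is linear
  because the anomaly involved has only \<open>n\<close> arguments, where
  \<open>anchor_defect_transfer\<close> applies.\<close>

lemma transfer_step:
  assumes st: "transfer_state n q F" and n: "n \<ge> 1"
  shows "\<exists>q' F'. transfer_state (Suc n) q' F' \<and> (\<forall>zs. length zs \<le> n \<longrightarrow> q' zs = q zs \<and> F' zs = F zs)"
proof -
  have q: "M.leibniz q" and F: "ops_degree C D 0 F" "ops_symmetric C F" "ops_additive C F"
    and F_scale: "\<And>d x vs r. x \<in> C d \<Longrightarrow> hom C vs \<Longrightarrow> F ((d, s r x) # vs) = t r (F ((d, x) # vs))"
    and unary: "\<And>d x. x \<in> C d \<Longrightarrow> q [(d, x)] = \<delta> d x" "\<And>d x. x \<in> C d \<Longrightarrow> F [(d, x)] = f d x"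
    and low: "\<And>ys. hom C ys \<Longrightarrow> ys \<noteq> [] \<Longrightarrow> length ys \<le> n \<Longrightarrow> compose_ops q 1 q ys = 0"
      "\<And>ys. hom C ys \<Longrightarrow> ys \<noteq> [] \<Longrightarrow> length ys \<le> n \<Longrightarrow> morphism_defect q h F ys = 0"
    using st by (auto simp: transfer_state_def)
  have q_ops: "ops_degree C C 1 q" "ops_symmetric C q" "ops_additive C q"
    and q_scale: "\<And>d x vs r. x \<in> C d \<Longrightarrow> hom C vs \<Longrightarrow>
        q ((d, s r x) # vs) = s r (q ((d, x) # vs)) + s (signed d (anchor_ops \<alpha> vs r)) x"
    using q by (auto simp: M.leibniz_def)
  have h_ops: "ops_degree D D 1 h" "ops_symmetric D h" "ops_additive D h"
    using h_leibniz by (auto simp: N.leibniz_def)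
  note C = M.subgroup_C and D = N.subgroup_C
  define R where "R = compose_ops q 1 q"
  define Q where "Q = morphism_defect q h F"
  have R_ops: "ops_degree C C 2 R" "ops_symmetric C R" "ops_additive C R"
    using compose_ops_degree[OF q_ops(1,1) C] compose_ops_symmetric[OF q_ops(2,2,1,3) C]
      compose_ops_additive[OF C q_ops(1,3,2,3)] by (simp_all add: R_def)
  have Q_ops: "ops_degree C D 1 Q" "ops_symmetric C Q" "ops_additive C Q"
  proof -
    have U: "ops_degree C D 1 (compose_ops F 1 q)" "ops_symmetric C (compose_ops F 1 q)"
        "ops_additive C (compose_ops F 1 q)"
      using compose_ops_degree[OF F(1) q_ops(1) D] compose_ops_symmetric[OF F(2) q_ops(2,1) F(3) C]
        compose_ops_additive[OF C q_ops(1,3) F(2,3)] by simp_all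
    have P: "ops_degree C D 1 (push_ops h F)" "ops_symmetric C (push_ops h F)" "ops_additive C (push_ops h F)"
      using push_ops_degree[OF h_ops(1) F(1) D] push_ops_symmetric[OF F(1,2) h_ops(2,3) D]
        push_ops_additive[OF F(1,3) h_ops(3)] by simp_all
    show "ops_degree C D 1 Q"
      using U(1) P(1) N.subspace_diff[OF N.subspace_C] by (simp add: ops_degree_def Q_def morphism_defect_def)
    show "ops_symmetric C Q"
      using ops_symmetric_diff[OF U(2) P(2)] by (simp add: Q_def morphism_defect_def[abs_def])
    show "ops_additive C Q"
      using U(3) P(3) by (simp add: ops_additive_def Q_def morphism_defect_def)
  qed
  \<comment> \<open>\<open>R\<close> has degree 2 and \<open>Q\<close> degree 1, so
    \<open>Z xs\<close> lies in the cone in degree \<open>total_degree xs + 1\<close>, which is the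
    degree in which \<open>H\<close> is applied below.\<close>
  define Z where "Z xs = (R xs, Q xs)" for xs
  let ?sc = "\<lambda>r z. (s r (fst z), t r (snd z))"
  let ?K = "\<lambda>d. C (d + 2) \<times> D (d + 1)"
  have H_lin: "linear_on ?sc (?K d) ?sc (C (d + 1) \<times> D d) (H (d + 1))" for d
    using H_linear[of "d + 1"] by (simp add: add.assoc)
  have K: "subgroup_set (?K d)" for d
    using C[of "d + 2"] D[of "d + 1"] by (auto simp: subgroup_set_def zero_prod_def)
  have H_mem: "H (d + 1) z \<in> C (d + 1) \<times> D d" if "z \<in> ?K d" for d z
    by (rule bspec[OF H_lin[of d, unfolded linear_on_def, THEN conjunct1] that])
  have H_scale: "H (d + 1) (?sc r z) = ?sc r (H (d + 1) z)" if "z \<in> ?K d" for d z r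
    using H_lin[of d, unfolded linear_on_def, THEN conjunct2, THEN conjunct2, rule_format, OF that] .
  have H_add: "additive_on (?K d) (H (d + 1))" for d
    using H_lin[of d] K[of d] unfolding additive_on_def linear_on_def by blast
  have Z_mem: "Z xs \<in> ?K (total_degree xs)" if "hom C xs" "xs \<noteq> []" for xs
    using ops_degreeD[OF R_ops(1) that(2,1)] ops_degreeD[OF Q_ops(1) that(2,1)] by (simp add: Z_def)
  define W where "W xs = H (total_degree xs + 1) (Z xs)" for xs
  define u where "u xs = fst (W xs)" for xs
  define v where "v xs = snd (W xs)" for xs
  have W_mem: "W xs \<in> C (total_degree xs + 1) \<times> D (total_degree xs)" if "hom C xs" "xs \<noteq> []" for xs
    unfolding W_def by (rule H_mem[OF Z_mem[OF that]])
  have u_mem: "u xs \<in> C (total_degree xs + 1)" and v_mem: "v xs \<in> D (total_degree xs)"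
    if "hom C xs" "xs \<noteq> []" for xs
    using W_mem[OF that] by (auto simp: u_def v_def mem_Times_iff)
  have W_sym: "W (us @ x # y # vs) = signed (fst x * fst y) (W (us @ y # x # vs))"
    if hm: "hom C (us @ x # y # vs)" for us x y vs
  proof -
    let ?xs = "us @ y # x # vs"
    have "Z (us @ x # y # vs) = signed (fst x * fst y) (Z ?xs)"
      unfolding Z_def ops_symmetricD[OF R_ops(2) hm] ops_symmetricD[OF Q_ops(2) hm] by (simp add: signed_def)
    moreover have "Z ?xs \<in> ?K (total_degree ?xs)" using hm by (intro Z_mem) auto
    ultimately have "H (total_degree ?xs + 1) (Z (us @ x # y # vs)) =
        signed (fst x * fst y) (H (total_degree ?xs + 1) (Z ?xs))"
      using additive_on_signed[OF H_add] by metis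
    moreover have "total_degree (us @ x # y # vs) = total_degree ?xs" by simp
    ultimately show ?thesis unfolding W_def by metis
  qed
  have u_sym: "ops_symmetric C u" and v_sym: "ops_symmetric C v"
    unfolding ops_symmetric_def u_def v_def by (intro allI impI; subst W_sym; simp add: signed_def)+
  have W_add: "W ((d, x + y) # vs) = W ((d, x) # vs) + W ((d, y) # vs)"
    if "x \<in> C d" "y \<in> C d" "hom C vs" for d x y vs
  proof -
    have "Z ((d, x + y) # vs) = Z ((d, x) # vs) + Z ((d, y) # vs)"
      using R_ops(3) Q_ops(3) that by (simp add: Z_def ops_additive_def)
    then show ?thesis
      using H_add[of "d + total_degree vs"] Z_mem[of "(d, x) # vs"] Z_mem[of "(d, y) # vs"] that
      by (auto simp: W_def additive_on_def)
  qed
  have W_scale: "W ((d, s r x) # vs) = ?sc r (W ((d, x) # vs))"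
    if "x \<in> C d" "hom C vs" "length vs \<le> n" for d x vs r
  proof -
    have "Z ((d, s r x) # vs) = ?sc r (Z ((d, x) # vs))"
      using M.curvature_scale[OF q that(1,2), of r] anchor_defect_transfer[OF st that(2,3), of r]
        defect_scale[OF M.anchored_module_axioms N.anchored_module_axioms q h_leibniz F F_scale _
            that(1,2), of r]
        f_anchor unary(2)
      by (simp add: Z_def R_def Q_def)
    moreover have "Z ((d, x) # vs) \<in> ?K (d + total_degree vs)"
      using Z_mem[of "(d, x) # vs"] that by simp
    then have "H (d + total_degree vs + 1) (?sc r (Z ((d, x) # vs))) = ?sc r (H (d + total_degree vs +
        1) (Z ((d, x) # vs)))"
      by (rule H_scale)
    ultimately show ?thesis unfolding W_def by simp
  qed
  \<comment> \<open>Exhibits the correction as subtraction of a family supported in one arity, whose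
    symmetry is known.\<close>
  have diff_if: "(if P then a - b else a) = a - (if P then b else 0)" for P and a b :: "'x::ab_group_add"
    by simp
  define q' where "q' xs = (if length xs = Suc n then q xs - u xs else q xs)" for xs
  define F' where "F' xs = (if length xs = Suc n then F xs - v xs else F xs)" for xs
  have q'_leibniz: "M.leibniz q'"
    unfolding M.leibniz_def
  proof (intro conjI)
    show "ops_degree C C 1 q'"
      using ops_degreeD[OF q_ops(1)] u_mem M.subspace_diff[OF M.subspace_C]
          by (simp add: ops_degree_def q'_def)
    show "ops_symmetric C q'"
      using ops_symmetric_diff[OF q_ops(2) ops_symmetric_restrict[OF u_sym]]
      unfolding q'_def[abs_def] diff_if .
    show "ops_additive C q'"
      using q_ops(3) W_add by (auto simp: ops_additive_def q'_def u_def)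
    show "\<forall>d x vs r. x \<in> C d \<longrightarrow> hom C vs \<longrightarrow>
        q' ((d, s r x) # vs) = s r (q' ((d, x) # vs)) + s (signed d (anchor_ops \<alpha> vs r)) x"
      using q_scale W_scale by (auto simp: q'_def u_def M.scale_right_diff_distrib algebra_simps)
  qed
  have F'_ops: "ops_degree C D 0 F'" "ops_symmetric C F'" "ops_additive C F'"
  proof -
    show "ops_degree C D 0 F'"
      using ops_degreeD[OF F(1)] v_mem N.subspace_diff[OF N.subspace_C] by (simp add: ops_degree_def F'_def)
    show "ops_symmetric C F'"
      using ops_symmetric_diff[OF F(2) ops_symmetric_restrict[OF v_sym]]
      unfolding F'_def[abs_def] diff_if .
    show "ops_additive C F'"
      using F(3) W_add by (auto simp: ops_additive_def F'_def v_def)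
  qed
  have F'_scale: "F' ((d, s r x) # vs) = t r (F' ((d, x) # vs))" if "x \<in> C d" "hom C vs" for d x vs r
    using F_scale[OF that] W_scale[OF that] by (auto simp: F'_def v_def N.scale_right_diff_distrib)
  have agree: "q' zs = q zs" "F' zs = F zs" if "length zs \<le> n" for zs
    using that by (auto simp: q'_def F'_def)
  have top: "compose_ops q' 1 q' xs = 0 \<and> morphism_defect q' h F' xs = 0"
    if xs: "hom C xs" and len: "length xs = Suc n" for xs
  proof -
    let ?d = "total_degree xs"
    have ne: "xs \<noteq> []" using len by auto
    have lowR: "compose_ops q 1 q ys = 0" and lowQ: "morphism_defect q h F ys = 0"
      if "hom C ys" "ys \<noteq> []" "length ys < length xs" for ys
      using low that len by auto
    have R_mem: "R xs \<in> C (?d + 2)" and Q_mem: "Q xs \<in> D (?d + 1)"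
      using Z_mem[OF xs ne] by (auto simp: Z_def)
    have R_cocycle: "\<delta> (?d + 2) (R xs) = compose_unary R 1 q xs"
      using curvature_cocycle[OF half_m C q_ops xs ne lowR] unary(1)[OF R_mem] unfolding R_def by simp
    have Q_cocycle: "f (?d + 2) (R xs) - h [(?d + 1, Q xs)] = compose_unary Q 1 q xs"
      using morphism_defect_cocycle[OF half_n C D q_ops(1) F h_ops(1,3) h_flat xs ne lowR lowQ]
        unary(2)[OF R_mem] unfolding R_def Q_def by simp
    \<comment> \<open>The contraction is moved past the differential on the arguments.\<close>
    have "H (?d + 1 + 1) (compose_unary Z 1 q xs) = compose_unary W 1 q xs"
      using compose_unary_additive[of ?K "\<lambda>d. H (d + 1)", OF H_add q_ops(1) xs Z_mem]
      by (simp add: W_def[abs_def])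
    moreover have "compose_unary Z 1 q xs = (compose_unary R 1 q xs, compose_unary Q 1 q xs)"
      unfolding Z_def[abs_def] by (rule compose_unary_Pair)
    moreover have "W = (\<lambda>zs. (u zs, v zs))" by (simp add: u_def v_def)
    then have "compose_unary W 1 q xs = (compose_unary u 1 q xs, compose_unary v 1 q xs)"
      using compose_unary_Pair[of u v] by metis
    ultimately have HU: "H (?d + 1 + 1) (compose_unary R 1 q xs, compose_unary Q 1 q xs) =
        (compose_unary u 1 q xs, compose_unary v 1 q xs)"
      by metis
    \<comment> \<open>The homotopy identity at \<open>Z xs\<close>, with the differential of
      \<open>Z xs\<close> in the cone rewritten by the cocycle identities.\<close>
    have "(\<delta> (?d + 1) (u xs), f (?d + 1) (u xs) - h [(?d, v xs)]) +
        (compose_unary u 1 q xs, compose_unary v 1 q xs) = (R xs, Q xs)"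
      using H_homotopy[of "R xs" "?d + 1" "Q xs"] R_mem Q_mem R_cocycle Q_cocycle HU
      by (simp add: u_def v_def W_def Z_def add.assoc)
    then have dW: "\<delta> (?d + 1) (u xs) + compose_unary u 1 q xs = R xs"
      "f (?d + 1) (u xs) - h [(?d, v xs)] + compose_unary v 1 q xs = Q xs"
      by auto
    have q': "q' zs = q zs" "F' zs = F zs" if "length zs \<noteq> length xs" for zs
      using that len by (auto simp: q'_def F'_def)
    have q'': "q' zs = q zs - u zs" "F' zs = F zs - v zs" if "length zs = length xs" for zs
      using that len by (auto simp: q'_def F'_def)
    have homA: "hom C A" "A \<noteq> []" if "set A \<subseteq> set xs" "length A = length xs" for A
      using that xs hom_subset ne by auto
    have "compose_ops q' 1 q' xs = compose_ops q 1 q xs - compose_unary u 1 q xs - q [(?d + 1, u xs)]"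
    proof (rule compose_ops_perturb[OF _ q'(1) q''(1) q'(1) q''(1)])
      show "2 \<le> length xs" using len n by simp
      show "q [(total_degree A + 1, q A - u A)] = q [(total_degree A + 1, q A)] - q [(total_degree A +
          1, u A)]"
        if "set A \<subseteq> set xs" "length A = length xs" for A
        using additive_on_diff[OF ops_additive_on[OF q_ops(3) C, of "[]"]] homA[OF that]
          ops_degreeD[OF q_ops(1)] u_mem by simp
    qed auto
    then have 1: "compose_ops q' 1 q' xs = 0"
      using dW(1) unary(1)[OF u_mem[OF xs ne]] unfolding R_def by (simp add: algebra_simps)
    have U': "compose_ops F' 1 q' xs = compose_ops F 1 q xs - compose_unary v 1 q xs - F [(?d + 1, u xs)]"
    proof (rule compose_ops_perturb[OF _ q'(2) q''(2) q'(1) q''(1)])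
      show "2 \<le> length xs" using len n by simp
      show "F [(total_degree A + 1, q A - u A)] = F [(total_degree A + 1, q A)] - F [(total_degree A +
          1, u A)]"
        if "set A \<subseteq> set xs" "length A = length xs" for A
        using additive_on_diff[OF ops_additive_on[OF F(3) C, of "[]"]] homA[OF that]
          ops_degreeD[OF q_ops(1)] u_mem by simp
    qed auto
    have P': "push_ops h F' xs = push_ops h F xs - h [(?d, v xs)]"
    proof (rule push_ops_perturb[OF ne q'(2) q''(2)])
      show "h [(total_degree A, F A - v A)] = h [(total_degree A, F A)] - h [(total_degree A, v A)]"
        if "set A \<subseteq> set xs" "length A = length xs" for A
        using additive_on_diff[OF ops_additive_on[OF h_ops(3) D, of "[]"]] homA[OF that]
          ops_degreeD[OF F(1)] v_mem by simp
    qed auto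
    have "morphism_defect q' h F' xs =
        Q xs - (f (?d + 1) (u xs) - h [(?d, v xs)] + compose_unary v 1 q xs)"
      unfolding morphism_defect_def Q_def U' P' unary(2)[OF u_mem[OF xs ne]] by (simp only: algebra_simps)
    then have "morphism_defect q' h F' xs = 0" unfolding dW(2) by simp
    with 1 show ?thesis ..
  qed
  have "transfer_state (Suc n) q' F'"
    unfolding transfer_state_def
  proof (intro conjI allI impI ballI)
    fix d x assume "x \<in> C d"
    then show "q' [(d, x)] = \<delta> d x" "F' [(d, x)] = f d x" using agree n unary by auto
  next
    fix ys assume ys: "hom C ys" "ys \<noteq> []" "length ys \<le> Suc n"
    have "compose_ops q' 1 q' ys = 0 \<and> morphism_defect q' h F' ys = 0"
    proof (cases "length ys = Suc n")
      case False
      then have len: "length ys \<le> n" using ys by simp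
      then have "compose_ops q' 1 q' ys = compose_ops q 1 q ys" "morphism_defect q' h F' ys =
          morphism_defect q h F ys"
        using agree by (auto intro!: compose_ops_cong morphism_defect_cong)
      then show ?thesis using low[OF ys(1,2) len] by simp
    qed (use top ys in auto)
    then show "compose_ops q' 1 q' ys = 0" "morphism_defect q' h F' ys = 0" by auto
  qed (use q'_leibniz F'_ops F'_scale in auto)
  then show ?thesis using agree by blast
qed

text \<open>A step leaves the earlier arities alone and every equation on a list involves only
  arities up to its length, so the stages have a limit that satisfies all equations.\<close>

lemma transfer_exists:
  assumes q0: "M.leibniz q0" "\<And>d x. x \<in> C d \<Longrightarrow> q0 [(d, x)] = \<delta> d x"
  obtains q F where "\<And>n. transfer_state n q F"
proof -
  \<comment> \<open>The map \<open>f\<close> without higher terms. In arity 1 the equations say that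
    \<open>\<delta>\<close> squares to zero and that \<open>f\<close> is a chain map.\<close>
  define F0 where "F0 xs = (case xs of [z] \<Rightarrow> f (fst z) (snd z) | _ \<Rightarrow> 0)" for xs
  have F0: "F0 [] = 0" "F0 [z] = f (fst z) (snd z)" "F0 (x # y # zs) = 0" for x y z zs
    by (simp_all add: F0_def)
  have f0: "f d 0 = 0" for d
    by (rule linear_on_0[OF f_linear M.module_axioms N.module_axioms M.zero_mem])
  have "transfer_state 1 q0 F0"
    unfolding transfer_state_def
  proof (intro conjI allI impI ballI)
    show "ops_degree C D 0 F0"
      unfolding ops_degree_def
    proof (intro allI impI)
      fix xs assume "xs \<noteq> []" "hom C xs"
      then show "F0 xs \<in> D (total_degree xs + 0)"
        using f_linear by (cases xs rule: remdups_adj.cases) (auto simp: F0 N.zero_mem linear_on_def)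
    qed
    show "ops_symmetric C F0"
      unfolding ops_symmetric_def
    proof (intro allI impI)
      fix us x y vs
      show "F0 (us @ x # y # vs) = signed (fst x * fst y) (F0 (us @ y # x # vs))"
        by (cases us; cases "tl us") (auto simp: F0)
    qed
    show "ops_additive C F0"
      unfolding ops_additive_def
    proof (intro allI impI)
      fix d x y vs assume "x \<in> C d" "y \<in> C d" "hom C vs"
      then show "F0 ((d, x + y) # vs) = F0 ((d, x) # vs) + F0 ((d, y) # vs)"
        using f_linear[of d] by (cases vs) (auto simp: F0 linear_on_def)
    qed
    fix d x vs r assume "x \<in> C d" "hom C vs"
    then show "F0 ((d, s r x) # vs) = t r (F0 ((d, x) # vs))"
      using f_linear[of d] by (cases vs) (auto simp: F0 linear_on_def)
  next
    fix ys assume ys: "hom C ys" "ys \<noteq> []" "length ys \<le> 1"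
    then obtain d x where dx: "ys = [(d, x)]" "x \<in> C d" by (cases ys) auto
    have "\<delta> d x \<in> C (d + 1)" using \<delta>_linear[of d] dx by (auto simp: linear_on_def)
    then show "compose_ops q0 1 q0 ys = 0" "morphism_defect q0 h F0 ys = 0"
      using dx q0(2) \<delta>_square f_chain by (simp_all add: compose_ops_def morphism_defect_def push_ops_def F0)
  qed (use q0 in \<open>auto simp: F0\<close>)
  then obtain S where S: "\<And>n. transfer_state (Suc n) (fst (S n)) (snd (S n))"
    "\<And>n zs. length zs \<le> Suc n \<Longrightarrow> fst (S (Suc n)) zs = fst (S n) zs \<and> snd (S (Suc n)) zs = snd (S n) zs"
  proof -
    assume st: "transfer_state 1 q0 F0"
    have "\<exists>S. \<forall>n. transfer_state (Suc n) (fst (S n)) (snd (S n)) \<and>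
        (\<forall>zs. length zs \<le> Suc n \<longrightarrow> fst (S (Suc n)) zs = fst (S n) zs \<and> snd (S (Suc n)) zs = snd (S n) zs)"
    proof (rule dependent_nat_choice)
      show "\<exists>p. transfer_state (Suc 0) (fst p) (snd p)" using st by auto
    next
      fix p n assume "transfer_state (Suc n) (fst p) (snd p)"
      from transfer_step[OF this] show "\<exists>p'. transfer_state (Suc (Suc n)) (fst p') (snd p') \<and>
          (\<forall>zs. length zs \<le> Suc n \<longrightarrow> fst p' zs = fst p zs \<and> snd p' zs = snd p zs)" by auto
    qed
    then show ?thesis using that by blast
  qed
  have stable: "fst (S (m + k)) zs = fst (S m) zs \<and> snd (S (m + k)) zs = snd (S m) zs"
      if "length zs \<le> Suc m" for m k zs
    using that S(2)[of zs "m + _"] by (induction k) auto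
  \<comment> \<open>Stage \<open>S m\<close> satisfies the equations up to arity
    \<open>m + 1\<close> and later stages keep these arities, so arity \<open>m\<close> can be read
    off at \<open>S m\<close>.\<close>
  define q where "q zs = fst (S (length zs)) zs" for zs
  define F where "F zs = snd (S (length zs)) zs" for zs
  have eq: "q zs = fst (S m) zs" "F zs = snd (S m) zs" if "length zs \<le> m" for zs m
    using stable[of zs "length zs" "m - length zs"] that by (auto simp: q_def F_def)
  have leib: "M.leibniz (fst (S m))" and F_ops: "ops_degree C D 0 (snd (S m))"
      "ops_symmetric C (snd (S m))" "ops_additive C (snd (S m))"
    for m using S(1)[of m] by (auto simp: transfer_state_def)
  have "transfer_state n q F" for n
    unfolding transfer_state_def
  proof (intro conjI allI impI ballI)
    show "M.leibniz q"
      unfolding M.leibniz_def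
    proof (intro conjI allI impI)
      show "ops_degree C C 1 q"
        using leib by (auto simp: ops_degree_def q_def M.leibniz_def)
      show "ops_symmetric C q"
        unfolding ops_symmetric_def
      proof (intro allI impI)
        fix us x y vs assume hm: "hom C (us @ x # y # vs)"
        let ?m = "length (us @ x # y # vs)"
        have "ops_symmetric C (fst (S ?m))" using leib by (simp add: M.leibniz_def)
        from ops_symmetricD[OF this hm] show "q (us @ x # y # vs) = signed (fst x * fst y)
            (q (us @ y # x # vs))"
          using eq(1)[of "us @ x # y # vs" ?m] eq(1)[of "us @ y # x # vs" ?m] by simp
      qed
      show "ops_additive C q"
        using leib by (auto simp: ops_additive_def q_def M.leibniz_def)
      fix d x vs r assume "x \<in> C d" "hom C vs"
      then show "q ((d, s r x) # vs) = s r (q ((d, x) # vs)) + s (signed d (anchor_ops \<alpha> vs r)) x"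
        using leib[of "Suc (length vs)"] by (auto simp: q_def M.leibniz_def)
    qed
    show "ops_degree C D 0 F"
      using F_ops by (auto simp: ops_degree_def F_def)
    show "ops_symmetric C F"
      unfolding ops_symmetric_def
    proof (intro allI impI)
      fix us x y vs assume hm: "hom C (us @ x # y # vs)"
      let ?m = "length (us @ x # y # vs)"
      from ops_symmetricD[OF F_ops(2)[of ?m] hm] show "F (us @ x # y # vs) = signed (fst x * fst y)
          (F (us @ y # x # vs))"
        using eq(2)[of "us @ x # y # vs" ?m] eq(2)[of "us @ y # x # vs" ?m] by simp
    qed
    show "ops_additive C F"
      using F_ops by (auto simp: ops_additive_def F_def)
    show "F ((d, s r x) # vs) = t r (F ((d, x) # vs))" if "x \<in> C d" "hom C vs" for d x vs r
      using S(1)[of "Suc (length vs)"] that by (auto simp: F_def transfer_state_def)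
    show "q [(d, x)] = \<delta> d x" "F [(d, x)] = f d x" if "x \<in> C d" for d x
      using S(1)[of 1] that by (auto simp: q_def F_def transfer_state_def)
    fix ys assume ys: "hom C ys" "ys \<noteq> []" "length ys \<le> n"
    have "compose_ops q 1 q ys = compose_ops (fst (S (length ys))) 1 (fst (S (length ys))) ys"
      "morphism_defect q h F ys = morphism_defect (fst (S (length ys))) h (snd (S (length ys))) ys"
      using eq by (auto intro!: compose_ops_cong morphism_defect_cong)
    then show "compose_ops q 1 q ys = 0" "morphism_defect q h F ys = 0"
      using S(1)[of "length ys"] ys by (auto simp: transfer_state_def)
  qed
  then show ?thesis by (rule that)
qed

end

section \<open>A bracket from connections\<close>

text \<open>\<open>leibniz\<close> asks for no Jacobi identity, so a torsion-free style bracket of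
  connections suffices: \<open>nab\<close> is the Grassmann connection of the dual basis, which
  differentiates coordinates along the anchor, and the bracket is its graded symmetrisation after
  the shift.\<close>

lemma (in anchored_module) leibniz_exists:
  assumes basis: "\<And>d. dual_basis s (C d) (n d) (\<phi> d) (b d)"
    and \<delta>: "\<And>d. linear_on s (C d) s (C (d + 1)) (\<delta> d)"
  obtains q where "leibniz q" "\<And>d x. q [(d, x)] = \<delta> d x"
proof -
  define nab where "nab e y d x = (\<Sum>j<n d. s (\<alpha> e y (\<phi> d j x)) (b d j))" for e y d x
  have b: "b d j \<in> C d" if "j < n d" for d j using basis[of d] that by (auto simp: dual_basis_def)
  have \<phi>_add: "\<phi> d j (x + x') = \<phi> d j x + \<phi> d j x'" if "x \<in> C d" "x' \<in> C d" for d j x x'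
    using basis[of d] that by (auto simp: dual_basis_def)
  have \<phi>_scale: "\<phi> d j (s r x) = r * \<phi> d j x" if "x \<in> C d" for d j r x
    using basis[of d] that by (auto simp: dual_basis_def)
  have expand: "(\<Sum>j<n d. s (\<phi> d j x) (b d j)) = x" if "x \<in> C d" for d x
    using basis[of d] that by (auto simp: dual_basis_def)
  have nabla_mem: "nab e y d x \<in> C d" for e y d x
    unfolding nab_def by (intro subspace_sum[OF subspace_C] subspace_scale[OF subspace_C] b) auto
  have nabla_degree: "nab e y d x = 0" if "y \<in> C e" "e \<noteq> -1" for e y d x
    unfolding nab_def using anchor_degree[OF that] by simp
  have nabla_add: "nab e y d (x + x') = nab e y d x + nab e y d x'" if "y \<in> C e" "x \<in> C d" "x' \<in> C d"
      for e y d x x'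
    unfolding nab_def using that by (simp add: \<phi>_add derivation_add scale_left_distrib sum.distrib)
  have nabla_scale: "nab e y d (s r x) = s r (nab e y d x) + s (\<alpha> e y r) x" if "y \<in> C e" "x \<in> C d"
      for e y d x r
  proof -
    have "nab e y d (s r x) = (\<Sum>j<n d. s r (s (\<alpha> e y (\<phi> d j x)) (b d j)) + s (\<alpha> e y r) (s (\<phi> d j x) (b d j)))"
      unfolding nab_def using that
      by (intro sum.cong) (simp_all add: \<phi>_scale derivation_mult scale_left_distrib mult.commute)
    also have "\<dots> = s r (nab e y d x) + s (\<alpha> e y r) (\<Sum>j<n d. s (\<phi> d j x) (b d j))"
      by (simp add: nab_def sum.distrib scale_sum_right)
    finally show ?thesis using expand[OF that(2)] by simp
  qed
  have nabla_anchor_add: "nab d (x + x') e y = nab d x e y + nab d x' e y" if "x \<in> C d" "x' \<in> C d"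
      for d x x' e y
    unfolding nab_def using that by (simp add: anchor_add scale_left_distrib sum.distrib)
  have nabla_anchor_scale: "nab d (s r x) e y = s r (nab d x e y)" if "x \<in> C d" for d x e y r
    unfolding nab_def using that by (simp add: anchor_scale scale_sum_right)
  \<comment> \<open>The exponents make the bracket symmetric in the shifted degrees; the first term,
    which differentiates the first argument, carries the sign required by
    \<open>leibniz\<close>.\<close>
  define q where "q xs = (case xs of [x] \<Rightarrow> \<delta> (fst x) (snd x)
      | [x, y] \<Rightarrow> signed (fst x) (nab (fst y) (snd y) (fst x) (snd x)) +
          signed (fst x * fst y + fst y) (nab (fst x) (snd x) (fst y) (snd y))
      | _ \<Rightarrow> 0)" for xs
  have q_simps: "q [] = 0" "q [x] = \<delta> (fst x) (snd x)"
    "q [x, y] = signed (fst x) (nab (fst y) (snd y) (fst x) (snd x)) +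
          signed (fst x * fst y + fst y) (nab (fst x) (snd x) (fst y) (snd y))"
    "q (x # y # z # zs) = 0" for x y z zs
    by (simp_all add: q_def)
  have q_long: "q xs = 0" if "length xs > 2" for xs
    using that by (auto simp: q_def split: list.split)
  have "leibniz q"
    unfolding leibniz_def
  proof (intro conjI allI impI)
    show "ops_degree C C 1 q"
      unfolding ops_degree_def
    proof (intro allI impI)
      fix xs assume xs: "xs \<noteq> []" "hom C xs"
      consider x where "xs = [x]" | x y where "xs = [x, y]" | x y z zs where "xs = x # y # z # zs"
        using xs(1) by (metis neq_Nil_conv)
      then show "q xs \<in> C (total_degree xs + 1)"
      proof cases
        case 1
        then show ?thesis using xs \<delta>[of "fst (hd xs)"] by (auto simp: q_simps linear_on_def)
      next
        case (2 x y)
        have "nab (fst y) (snd y) (fst x) (snd x) \<in> C (fst x + fst y + 1)"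
          using nabla_mem[of "fst y" "snd y" "fst x" "snd x"] nabla_degree[of "snd y" "fst y"] xs 2 zero_mem
          by (cases "fst y = -1") auto
        moreover have "nab (fst x) (snd x) (fst y) (snd y) \<in> C (fst x + fst y + 1)"
          using nabla_mem[of "fst x" "snd x" "fst y" "snd y"] nabla_degree[of "snd x" "fst x"] xs 2 zero_mem
          by (cases "fst x = -1") auto
        ultimately show ?thesis
          using 2 subgroup_C[of "fst x + fst y + 1"]
          by (simp add: q_simps) (auto simp: subgroup_set_def intro: subgroup_set_signed[OF subgroup_C])
      qed (simp add: q_simps zero_mem)
    qed
    show "ops_symmetric C q"
      unfolding ops_symmetric_def
    proof (intro allI impI)
      fix us x y vs
      show "q (us @ x # y # vs) = signed (fst x * fst y) (q (us @ y # x # vs))"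
      proof (cases us)
        case Nil
        then show ?thesis
          by (cases vs) (auto simp: q_simps signed_add add.commute algebra_simps intro!: arg_cong2[where
              f = "(+)"] signed_cong)
      next
        case (Cons u us')
        then have "q (us @ x # y # vs) = 0" "q (us @ y # x # vs) = 0" by (auto intro: q_long)
        then show ?thesis by simp
      qed
    qed
    show "ops_additive C q"
      unfolding ops_additive_def
    proof (intro allI impI)
      fix d x y vs assume xy: "x \<in> C d" "y \<in> C d" "hom C vs"
      consider "vs = []" | z where "vs = [z]" | z w zs where "vs = z # w # zs" by (metis neq_Nil_conv)
      then show "q ((d, x + y) # vs) = q ((d, x) # vs) + q ((d, y) # vs)"
      proof cases
        case 1
        then show ?thesis using \<delta>[of d] xy by (auto simp: q_simps linear_on_def)
      next
        case (2 z)
        then show ?thesis using xy by (simp add: q_simps nabla_add nabla_anchor_add signed_add)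
      qed (simp add: q_simps)
    qed
    fix d x vs r assume xv: "x \<in> C d" "hom C vs"
    consider "vs = []" | z where "vs = [z]" | z w zs where "vs = z # w # zs" by (metis neq_Nil_conv)
    then show "q ((d, s r x) # vs) = s r (q ((d, x) # vs)) + s (signed d (anchor_ops \<alpha> vs r)) x"
    proof cases
      case 1
      then show ?thesis using \<delta>[of d] xv by (auto simp: q_simps linear_on_def)
    next
      case (2 z)
      then show ?thesis using xv
        by (simp add: q_simps nabla_scale nabla_anchor_scale signed_add scale_right_distrib scale_signed
            signed_scale)
    qed (simp add: q_simps)
  qed
  moreover have "q [(d, x)] = \<delta> d x" for d x by (simp add: q_simps)
  ultimately show ?thesis by (rule that)
qed

section \<open>Shifting\<close>

text \<open>The exponent in \<open>shifted\<close> as a function of the degrees alone, so that it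
  can be computed by recursion.\<close>

definition shift_exp :: "int list \<Rightarrow> int" where
  "shift_exp ds = (\<Sum>k<length ds. int (length ds - 1 - k) * ds ! k)"

lemma shift_exp_simps [simp]:
  "shift_exp [] = 0" "shift_exp (d # ds) = int (length ds) * d + shift_exp ds"
  by (simp_all add: shift_exp_def sum.lessThan_Suc_shift del: sum.lessThan_Suc)

lemma shift_exp_swap: "shift_exp (us @ x # y # vs) = shift_exp (us @ y # x # vs) + x - y"
  by (induction us) (auto simp: algebra_simps)

abbreviation up :: "int \<times> 'm \<Rightarrow> int \<times> 'm" where "up \<equiv> \<lambda>(d, x). (d + 1, x)"
abbreviation down :: "int \<times> 'm \<Rightarrow> int \<times> 'm" where "down \<equiv> \<lambda>(d, x). (d - 1, x)"

text \<open>The sign is again taken from the degrees before the shift, so it cancels the one in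
  \<open>shifted\<close>.\<close>

definition unshifted :: "('m, 'n::ab_group_add) ops \<Rightarrow> ('m, 'n) ops" where
  "unshifted g xs = signed (shift_exp (map fst xs)) (g (map down xs))"

lemma shifted_conv: "shifted g xs = signed (shift_exp (map fst (map up xs))) (g (map up xs))"
proof -
  have "(\<Sum>k<length xs. int (length xs - 1 - k) * (fst (xs ! k) + 1)) = shift_exp (map fst (map up xs))"
    unfolding shift_exp_def by (intro sum.cong) (auto simp: case_prod_beta)
  then show ?thesis by (simp add: shifted_def)
qed

lemma up_down [simp]: "map up (map down xs) = xs" "map down (map up xs) = xs"
  by (induction xs) auto

lemma shifted_unshifted: "shifted (unshifted g) = g"
  by (rule ext) (simp only: shifted_conv unshifted_def up_down signed_signed signed_even even_add)

abbreviation shift_component :: "('r, 'm) module_complex \<Rightarrow> int \<Rightarrow> 'm set" where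
  "shift_component L d \<equiv> component L (d + 1)"

lemma shift_homogeneous_conv: "shift_homogeneous L xs \<longleftrightarrow> hom (shift_component L) xs"
  by (auto simp: shift_homogeneous_def hom_def)

lemma homogeneous_up: "homogeneous L (map up xs) \<longleftrightarrow> hom (shift_component L) xs"
  by (induction xs) (auto simp: homogeneous_def)

lemma homogeneous_down: "homogeneous L xs \<longleftrightarrow> hom (shift_component L) (map down xs)"
  by (induction xs) (auto simp: homogeneous_def)

lemma total_degree_up: "total_degree (map up xs) = total_degree xs + int (length xs)"
  by (induction xs) auto

lemma total_degree_down: "total_degree (map down xs) = total_degree xs - int (length xs)"
  by (induction xs) auto

lemma ops_degree_shifted:
  assumes "\<forall>n\<ge>1. has_degree M L n (k - int n) g" "\<And>d. subgroup_set (component L d)"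
  shows "ops_degree (shift_component M) (shift_component L) (k - 1) (shifted g)"
  unfolding ops_degree_def
proof (intro allI impI)
  fix xs assume xs: "xs \<noteq> []" "hom (shift_component M) xs"
  have "has_degree M L (length xs) (k - int (length xs)) g"
    using assms(1) xs(1) by (simp add: Suc_le_eq)
  then have "g (map up xs) \<in> component L (total_degree (map up xs) + (k - int (length xs)))"
    using xs(2) unfolding has_degree_def homogeneous_up[symmetric] by simp
  then show "shifted g xs \<in> shift_component L (total_degree xs + (k - 1))"
    unfolding shifted_conv total_degree_up
    by (intro subgroup_set_signed[OF assms(2)]) (simp add: algebra_simps)
qed

lemma has_degree_unshifted:
  assumes "ops_degree (shift_component M) (shift_component L) (k - 1) q" "n \<ge> 1"
    "\<And>d. subgroup_set (component L d)"
  shows "has_degree M L n (k - int n) (unshifted q)"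
  unfolding has_degree_def
proof (intro allI impI)
  fix xs assume xs: "homogeneous M xs \<and> length xs = n"
  have "q (map down xs) \<in> shift_component L (total_degree (map down xs) + (k - 1))"
    by (rule ops_degreeD[OF assms(1)]) (use xs assms(2) homogeneous_down in auto)
  then show "unshifted q xs \<in> component L (total_degree xs + (k - int n))"
    unfolding unshifted_def total_degree_down
    by (intro subgroup_set_signed[OF assms(3)]) (use xs in \<open>simp add: algebra_simps\<close>)
qed

text \<open>For shifted degrees \<open>p\<close> and \<open>q\<close> the exponents combine to
  \<open>1 + (p + 1) * (q + 1) + p - q\<close>, which has the parity of
  \<open>p * q\<close>.\<close>

lemma ops_symmetric_shifted:
  assumes "\<forall>n\<ge>1. graded_skew M n g"
  shows "ops_symmetric (shift_component M) (shifted g)"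
  unfolding ops_symmetric_def
proof (intro allI impI)
  fix us x y vs
  assume xs: "hom (shift_component M) (us @ x # y # vs)"
  let ?n = "length us + 2 + length vs"
  have "graded_skew M ?n g" using assms by auto
  moreover have "homogeneous M (map up us @ [(fst x + 1, snd x), (fst y + 1, snd y)] @ map up vs)"
    using xs homogeneous_up[of M "us @ x # y # vs"] by (simp add: case_prod_beta)
  ultimately have "g (map up us @ [(fst x + 1, snd x), (fst y + 1, snd y)] @ map up vs) =
      signed (1 + (fst x + 1) * (fst y + 1)) (g (map up us @ [(fst y + 1, snd y), (fst x + 1, snd x)]
          @ map up vs))"
    unfolding graded_skew_def by simp
  then have g: "g (map up (us @ x # y # vs)) = signed (1 + (fst x + 1) * (fst y + 1))
      (g (map up (us @ y # x # vs)))"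
    by (simp add: case_prod_beta)
  have e: "shift_exp (map fst (map up (us @ x # y # vs))) =
      shift_exp (map fst (map up (us @ y # x # vs))) + fst x - fst y"
    using shift_exp_swap[of "map fst (map up us)" "fst x + 1" "fst y + 1" "map fst (map up vs)"]
    by (simp add: case_prod_beta)
  show "shifted g (us @ x # y # vs) = signed (fst x * fst y) (shifted g (us @ y # x # vs))"
    unfolding shifted_conv g e signed_signed by (rule signed_cong) auto
qed

lemma graded_skew_unshifted:
  assumes "ops_symmetric (shift_component M) q"
  shows "graded_skew M n (unshifted q)"
  unfolding graded_skew_def
proof (intro allI impI)
  fix us d x e y vs
  assume xs: "homogeneous M (us @ [(d, x), (e, y)] @ vs) \<and> length us + 2 + length vs = n"
  then have "hom (shift_component M) (map down us @ (d - 1, x) # (e - 1, y) # map down vs)"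
    using homogeneous_down[of M "us @ [(d, x), (e, y)] @ vs"] by simp
  from ops_symmetricD[OF assms this]
  have q: "q (map down (us @ [(d, x), (e, y)] @ vs)) =
      signed ((d - 1) * (e - 1)) (q (map down (us @ [(e, y), (d, x)] @ vs)))"
    by simp
  have ex: "shift_exp (map fst (us @ [(d, x), (e, y)] @ vs)) =
      shift_exp (map fst (us @ [(e, y), (d, x)] @ vs)) + d - e"
    using shift_exp_swap[of "map fst us" d e "map fst vs"] by simp
  show "unshifted q (us @ [(d, x), (e, y)] @ vs) = signed (1 + d * e)
      (unshifted q (us @ [(e, y), (d, x)] @ vs))"
    unfolding unshifted_def q ex signed_signed by (rule signed_cong) auto
qed

text \<open>Reduces multilinearity in every argument to linearity in the first; the sign does not
  involve the value \<open>x\<close>.\<close>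

lemma unshifted_front:
  assumes "ops_symmetric (shift_component M) q" "homogeneous M (us @ [(d, x)] @ vs)"
  shows "unshifted q (us @ [(d, x)] @ vs) =
    signed (shift_exp (map fst us @ d # map fst vs) + (d - 1) * total_degree (map down us))
      (q ((d - 1, x) # map down us @ map down vs))"
proof -
  have "hom (shift_component M) (map down us @ (d - 1, x) # map down vs)"
    using assms(2) homogeneous_down[of M "us @ [(d, x)] @ vs"] by simp
  from ops_move_front[OF assms(1) this] show ?thesis
    by (simp add: unshifted_def)
qed

text \<open>The parameters \<open>S\<close> and \<open>n\<close> serve both linearity over the
  ground field for the binary bracket and linearity over all functions for the other
  operations.\<close>

lemma multilinear_over_unshifted:
  assumes M: "\<And>d. module.subspace (scl M) (component M d)" "module (scl M)" "module (scl L)"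
    and q: "ops_symmetric (shift_component M) q" "ops_additive (shift_component M) q"
    and scale: "\<And>d x vs r. x \<in> shift_component M d \<Longrightarrow> hom (shift_component M) vs \<Longrightarrow>
      Suc (length vs) = n \<Longrightarrow> r \<in> S \<Longrightarrow> q ((d, scl M r x) # vs) = scl L r (q ((d, x) # vs))"
  shows "multilinear_over S M L n (unshifted q)"
  unfolding multilinear_over_def
proof (intro allI impI conjI ballI)
  interpret M: module "scl M" by fact
  interpret L: module "scl L" by fact
  have sg: "scl L r (signed e y) = signed e (scl L r y)" for r e y by (simp add: signed_def)
  fix us d x vs assume xs: "homogeneous M (us @ [(d, x)] @ vs) \<and> length us + 1 + length vs = n"
  then have x: "x \<in> shift_component M (d - 1)" and rest: "hom (shift_component M) (map down us @ map down vs)"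
    using homogeneous_down[of M "us @ [(d, x)] @ vs"] by auto
  have other: "homogeneous M (us @ [(d, y)] @ vs)" if "y \<in> component M d" for y
    using xs that by (auto simp: homogeneous_def)
  { fix y assume y: "y \<in> component M d"
    then have "x + y \<in> component M d" using x M.subspace_add[OF M(1)] by simp
    then show "unshifted q (us @ [(d, x + y)] @ vs) = unshifted q (us @ [(d, x)] @ vs) +
        unshifted q (us @ [(d, y)] @ vs)"
      using unshifted_front[OF q(1) other] x y rest q(2) by (simp add: ops_additive_def signed_add) }
  { fix r assume "r \<in> S"
    then have "q ((d - 1, scl M r x) # map down us @ map down vs) = scl L r (q ((d - 1, x)
        # map down us @ map down vs))"
      using scale[OF x rest] xs by simp
    moreover have "scl M r x \<in> component M d" using x M.subspace_scale[OF M(1)] by simp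
    ultimately show "unshifted q (us @ [(d, scl M r x)] @ vs) = scl L r (unshifted q (us @ [(d, x)] @ vs))"
      using unshifted_front[OF q(1) other] x by (simp add: sg) }
qed

section \<open>The mapping cone\<close>

lemma bundle_complexD:
  assumes "bundle_complex L"
  shows "module (scl L)" "module.subspace (scl L) (component L d)" "d > 0 \<Longrightarrow> component L d = {0}"
    "linear_on (scl L) (component L d) (scl L) (component L (d + 1)) (differential L d)"
    "x \<in> component L d \<Longrightarrow> differential L (d + 1) (differential L d x) = 0"
    "subgroup_set (component L d)" "\<exists>n \<phi> b. dual_basis (scl L) (component L d) n \<phi> b"
proof -
  show m: "module (scl L)" and sub: "module.subspace (scl L) (component L d)"
    and "d > 0 \<Longrightarrow> component L d = {0}"
    and "linear_on (scl L) (component L d) (scl L) (component L (d + 1)) (differential L d)"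
    and "x \<in> component L d \<Longrightarrow> differential L (d + 1) (differential L d x) = 0"
    using assms by (auto simp: bundle_complex_def vector_bundle_def)
  interpret module "scl L" by (rule m)
  show "subgroup_set (component L d)"
    using subspace_0[OF sub] subspace_add[OF sub] subspace_neg[OF sub] by (auto simp: subgroup_set_def)
  have "vector_bundle (scl L) (component L d)" using assms by (auto simp: bundle_complex_def)
  then show "\<exists>n \<phi> b. dual_basis (scl L) (component L d) n \<phi> b"
    using vector_bundle_dual_basis[OF m] by metis
qed

text \<open>Sums such as \<open>d + 1 + 1\<close> are left unevaluated so that they match the
  instances of \<open>shift_component\<close> in \<open>homotopy_transfer\<close>.\<close>

definition contracts_cone ::
  "('r, 'm::ab_group_add) module_complex \<Rightarrow> ('r, 'n::ab_group_add) module_complex \<Rightarrow> (int \<Rightarrow> 'm \<Rightarrow> 'n) \<Rightarrow>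
   (int \<Rightarrow> 'm \<times> 'n \<Rightarrow> 'm \<times> 'n) \<Rightarrow> bool" where
  "contracts_cone M L f H \<longleftrightarrow>
     (\<forall>d. linear_on (\<lambda>r z. (scl M r (fst z), scl L r (snd z))) (component M (d + 1 + 1) \<times> component L (d + 1))
        (\<lambda>r z. (scl M r (fst z), scl L r (snd z))) (component M (d + 1) \<times> component L (d - 1 + 1)) (H d)) \<and>
     (\<forall>d. \<forall>x\<in>component M (d + 1 + 1). \<forall>y\<in>component L (d + 1).
        (differential M (d + 1) (fst (H d (x, y))),
         f (d + 1) (fst (H d (x, y))) - differential L (d - 1 + 1) (snd (H d (x, y)))) +
        H (d + 1) (differential M (d + 1 + 1) x, f (d + 1 + 1) x - differential L (d + 1) y) = (x, y))"

lemma cone_contraction: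
  assumes M: "bundle_complex M" and L: "bundle_complex L" and qi: "quasi_isomorphism M L f"
  shows "\<exists>H. contracts_cone M L f H"
proof -
  interpret M: module "scl M" by (rule bundle_complexD[OF M])
  interpret L: module "scl L" by (rule bundle_complexD[OF L])
  note subM = bundle_complexD(2)[OF M] and subL = bundle_complexD(2)[OF L]
  define sc where "sc = (\<lambda>r z. (scl M r (fst z), scl L r (snd z)))"
  define K where "K d = component M (d + 1 + 1) \<times> component L (d + 1)" for d
  define \<Delta> where "\<Delta> d z = (differential M (d + 1 + 1) (fst z),
      f (d + 1 + 1) (fst z) - differential L (d + 1) (snd z))" for d z
  have cm: "chain_map M L f" using qi by (simp add: quasi_isomorphism_def)
  have f: "linear_on (scl M) (component M d) (scl L) (component L d) (f d)" for d
    using cm by (simp add: chain_map_def)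
  have f_mem: "f d x \<in> component L d" and f_add: "f d (x + y) = f d x + f d y" and
      f_scale: "f d (scl M r x) = scl L r (f d x)"
    if "x \<in> component M d" "y \<in> component M d" for d x y r using f[of d] that by (auto simp: linear_on_def)
  have chain: "f (d + 1) (differential M d x) = differential L d (f d x)" if "x \<in> component M d" for d x
    using cm that by (simp add: chain_map_def)
  have dM: "differential M d x \<in> component M (d + 1)" "differential M d (x + y) = differential M d x +
      differential M d y"
    "differential M d (scl M r x) = scl M r (differential M d x)"
    if "x \<in> component M d" "y \<in> component M d" for d x y r
    using bundle_complexD(4)[OF M, of d] that by (auto simp: linear_on_def)
  have dL: "differential L d x \<in> component L (d + 1)" "differential L d (x + y) = differential L d x +
      differential L d y"
    "differential L d (scl L r x) = scl L r (differential L d x)"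
    if "x \<in> component L d" "y \<in> component L d" for d x y r
    using bundle_complexD(4)[OF L, of d] that by (auto simp: linear_on_def)
  have dL_diff: "differential L d (x - y) = differential L d x - differential L d y"
    if "x \<in> component L d" "y \<in> component L d" for d x y
    using additive_on_diff[of "component L d" "differential L d" x y] that dL(2) bundle_complexD(6)[OF L]
    by (simp add: additive_on_def)
  have dM_diff: "differential M d (x - y) = differential M d x - differential M d y"
    and f_diff: "f d (x - y) = f d x - f d y"
    if "x \<in> component M d" "y \<in> component M d" for d x y
    using additive_on_diff[of "component M d" "differential M d" x y]
        additive_on_diff[of "component M d" "f d" x y]
      that dM(2) f_add bundle_complexD(6)[OF M] by (simp_all add: additive_on_def)
  have module_sc: "module sc"
    by unfold_locales (auto simp: sc_def M.scale_right_distrib L.scale_right_distrib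
        M.scale_left_distrib L.scale_left_distrib)
  have subspace_K: "module.subspace sc (K d)" for d
    unfolding module.subspace_def[OF module_sc]
    using M.subspace_0[OF subM] L.subspace_0[OF subL] M.subspace_add[OF subM] L.subspace_add[OF subL]
      M.subspace_scale[OF subM] L.subspace_scale[OF subL]
    by (auto simp: K_def sc_def zero_prod_def)
  have basis: "\<exists>n \<phi> b. dual_basis sc (K d) n \<phi> b" for d
  proof -
    obtain n \<phi> b where 1: "dual_basis (scl M) (component M (d + 1 + 1)) n \<phi> b"
      using bundle_complexD(7)[OF M] by blast
    obtain m \<psi> c where 2: "dual_basis (scl L) (component L (d + 1)) m \<psi> c"
      using bundle_complexD(7)[OF L] by blast
    show ?thesis
      using dual_basis_Times[OF 1 2 M.module_axioms L.module_axioms M.subspace_0[OF subM]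
          L.subspace_0[OF subL]]
      unfolding sc_def K_def by blast
  qed
  have top: "K d = {0}" if "d \<ge> 0" for d
    using bundle_complexD(3)[OF M, of "d + 1 + 1"] bundle_complexD(3)[OF L, of "d + 1"] that
    by (auto simp: K_def zero_prod_def)
  have \<Delta>_lin: "linear_on sc (K d) sc (K (d + 1)) (\<Delta> d)" for d
    unfolding linear_on_def
  proof (intro conjI ballI allI)
    fix z assume z: "z \<in> K d"
    then have zM: "fst z \<in> component M (d + 1 + 1)" and zL: "snd z \<in> component L (d + 1)"
      by (auto simp: K_def)
    show "\<Delta> d z \<in> K (d + 1)"
      unfolding \<Delta>_def K_def using dM(1)[OF zM zM] L.subspace_diff[OF subL f_mem[OF zM zM] dL(1)[OF zL zL]]
      by simp
    show "\<Delta> d (sc r z) = sc r (\<Delta> d z)" for r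
      using z dM(3) dL(3) f_scale by (auto simp: K_def \<Delta>_def sc_def L.scale_right_diff_distrib)
    fix z' assume "z' \<in> K d"
    then show "\<Delta> d (z + z') = \<Delta> d z + \<Delta> d z'"
      using z dM(2) dL(2) f_add by (auto simp: K_def \<Delta>_def)
  qed
  have sq: "\<Delta> (d + 1) (\<Delta> d z) = 0" if "z \<in> K d" for d z
  proof -
    have x: "fst z \<in> component M (d + 1 + 1)" and y: "snd z \<in> component L (d + 1)"
        using that by (auto simp: K_def)
    have "differential L (d + 1 + 1) (f (d + 1 + 1) (fst z) - differential L (d + 1) (snd z)) =
        differential L (d + 1 + 1) (f (d + 1 + 1) (fst z)) - differential L (d + 1 + 1)
            (differential L (d + 1) (snd z))"
      by (rule dL_diff[OF f_mem[OF x x] dL(1)[OF y y]])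
    then show ?thesis
      using bundle_complexD(5)[OF M x] bundle_complexD(5)[OF L y] chain[OF x]
          by (simp add: \<Delta>_def zero_prod_def)
  qed
  have inj: "x \<in> differential M (d - 1) ` component M (d - 1)"
    if "x \<in> component M d" "differential M d x = 0" "f d x \<in> differential L (d - 1)
        ` component L (d - 1)" for d x
    using qi that by (auto simp: quasi_isomorphism_def)
  have surj: "\<exists>x\<in>component M d. differential M d x = 0 \<and> y - f d x \<in> differential L (d - 1)
      ` component L (d - 1)"
    if "y \<in> component L d" "differential L d y = 0" for d y
    using qi that by (auto simp: quasi_isomorphism_def)
  have exact: "z \<in> \<Delta> (d - 1) ` K (d - 1)" if z: "z \<in> K d" "\<Delta> d z = 0" for d z
  proof -
    obtain x y where xy: "z = (x, y)" "x \<in> component M (d + 1 + 1)" "y \<in> component L (d + 1)"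
      using z(1) by (auto simp: K_def)
    have dx: "differential M (d + 1 + 1) x = 0" "f (d + 1 + 1) x = differential L (d + 1) y"
      using z(2) by (auto simp: \<Delta>_def xy zero_prod_def)
    have "x \<in> differential M (d + 1) ` component M (d + 1)"
      using inj[of x "d + 1 + 1", unfolded add_diff_cancel_right'] xy dx by blast
    then obtain x1 where x1: "x1 \<in> component M (d + 1)" "x = differential M (d + 1) x1" by auto
    \<comment> \<open>\<open>f x1\<close> and \<open>y\<close> have the same differential, so they
      differ by a cycle, which up to a boundary is the image of a cycle \<open>x2\<close>.
      Subtracting \<open>x2\<close> from \<open>x1\<close> keeps the first coordinate and repairs
      the second.\<close>
    let ?y = "f (d + 1) x1 - y"
    have y: "?y \<in> component L (d + 1)" using f_mem x1(1) xy L.subspace_diff[OF subL] by blast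
    have "differential L (d + 1) ?y = 0"
      using dL_diff[of "f (d + 1) x1" "d + 1" y] f_mem x1 xy dx chain[OF x1(1)] by simp
    from surj[OF y this] obtain x2 w where x2: "x2 \<in> component M (d + 1)" "differential M (d + 1) x2 = 0"
      and w: "w \<in> component L d" "?y - f (d + 1) x2 = differential L d w" by auto
    have "(x1 - x2, w) \<in> K (d - 1)" using x1 x2 w M.subspace_diff[OF subM] by (simp add: K_def)
    moreover have "z = \<Delta> (d - 1) (x1 - x2, w)"
      using dM_diff[OF x1(1) x2(1)] f_diff[OF x1(1) x2(1)] x1 x2 w(2) by (simp add: \<Delta>_def xy algebra_simps)
    ultimately show ?thesis by blast
  qed
  have "\<exists>H. (\<forall>d. linear_on sc (K d) sc (K (d - 1)) (H d)) \<and>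
      (\<forall>d. \<forall>x\<in>K d. \<Delta> (d - 1) (H d x) + H (d + 1) (\<Delta> d x) = x)"
    by (rule contraction_exists[OF module_sc subspace_K basis top \<Delta>_lin sq exact]) (assumption | blast)+
  then obtain H where H: "\<And>d. linear_on sc (K d) sc (K (d - 1)) (H d)"
    "\<And>d x. x \<in> K d \<Longrightarrow> \<Delta> (d - 1) (H d x) + H (d + 1) (\<Delta> d x) = x" by blast
  have "contracts_cone M L f H"
    unfolding contracts_cone_def
  proof (intro conjI allI ballI)
    show "linear_on (\<lambda>r z. (scl M r (fst z), scl L r (snd z))) (component M (d + 1 + 1) \<times> component L (d + 1))
        (\<lambda>r z. (scl M r (fst z), scl L r (snd z))) (component M (d + 1) \<times> component L (d - 1 + 1))
            (H d)" for d
      using H(1)[of d] by (simp add: sc_def K_def)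
    show "(differential M (d + 1) (fst (H d (x, y))),
         f (d + 1) (fst (H d (x, y))) - differential L (d - 1 + 1) (snd (H d (x, y)))) +
        H (d + 1) (differential M (d + 1 + 1) x, f (d + 1 + 1) x - differential L (d + 1) y) = (x, y)"
      if "x \<in> component M (d + 1 + 1)" "y \<in> component L (d + 1)" for d x y
      using H(2)[of "(x, y)" d] that by (simp add: K_def \<Delta>_def)
  qed
  then show ?thesis by blast
qed

section \<open>The theorem\<close>

lemma derivation_constant:
  assumes "algebra_map \<eta>" "X \<in> derivations \<eta>"
  shows "X (\<eta> c) = 0"
proof -
  have "X (1 * 1) = 1 * X 1 + 1 * X 1" using assms(2) unfolding derivations_def by blast
  then have "X 1 = 0" by simp
  moreover have "X (\<eta> c * 1) = \<eta> c * X 1" using assms(2) unfolding derivations_def by blast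
  ultimately show ?thesis by simp
qed

text \<open>The ground field contains one half, which supplies the absence of 2-torsion for
  \<open>compose_compose\<close>.\<close>

lemma module_half:
  fixes \<eta> :: "'k::field_char_0 \<Rightarrow> 'r::comm_ring_1" and s :: "'r \<Rightarrow> 'm::ab_group_add \<Rightarrow> 'm" and y :: 'm
  assumes \<eta>: "algebra_map \<eta>" and "module s" and y: "y + y = 0"
  shows "y = 0"
proof -
  interpret module s by fact
  have "\<eta> (1 / 2) + \<eta> (1 / 2) = \<eta> (1 / 2 + 1 / 2)"
    using \<eta> unfolding algebra_map_def by (simp only: simp_thms)
  also have "\<dots> = 1" using \<eta> by (simp add: algebra_map_def)
  finally have "y = s (\<eta> (1 / 2) + \<eta> (1 / 2)) y" by simp
  also have "\<dots> = s (\<eta> (1 / 2)) (y + y)"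
    by (simp only: scale_left_distrib scale_right_distrib)
  finally show ?thesis using y by simp
qed

text \<open>The tangent complex sits in degree 0, so after the shift the anchor is supported in
  degree -1.\<close>

lemma anchored_module_tangent:
  assumes L: "bundle_complex L" and a: "chain_map L (tangent_complex \<eta>) a"
  shows "anchored_module (scl L) (shift_component L) (\<lambda>d. a (d + 1))"
proof -
  interpret module "scl L" by (rule bundle_complexD[OF L])
  have mem: "a d x \<in> (if d = 0 then derivations \<eta> else {0})"
    and add: "a d (x + y) = a d x + a d y" and scale: "a d (scl L r x) = (\<lambda>f. r * a d x f)"
    if "x \<in> component L d" "y \<in> component L d" for d x y r
    using a that by (auto simp: chain_map_def linear_on_def tangent_complex_def)
  have der: "a d x (r + t) = a d x r + a d x t" "a d x (r * t) = r * a d x t + t * a d x r"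
    if "x \<in> component L d" for d x r t
    using mem[OF that that] by (auto simp: derivations_def split: if_splits)
  have zero: "a d x r = 0" if "x \<in> component L d" "d \<noteq> 0" for d x r
    using mem[OF that(1) that(1)] that(2) by simp
  show ?thesis
    by unfold_locales (use bundle_complexD(2,3)[OF L] add scale der zero in \<open>auto simp: fun_eq_iff
        split: if_splits\<close>)
qed

lemma multilinear_over_front:
  assumes "multilinear_over S M L n g" "homogeneous M ((d, x) # vs)" "n = Suc (length vs)"
  shows "y \<in> component M d \<Longrightarrow> g ((d, x + y) # vs) = g ((d, x) # vs) + g ((d, y) # vs)"
    and "r \<in> S \<Longrightarrow> g ((d, scl M r x) # vs) = scl L r (g ((d, x) # vs))"
  using assms(1)[unfolded multilinear_over_def, rule_format, of "[]" d x vs] assms(2,3) by simp_all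

text \<open>The Leibniz rule of an algebroid concerns the second argument, that of
  \<open>leibniz\<close> the first; symmetry of the shifted bracket converts one into the
  other.\<close>

lemma Linf_algebroid_leibniz:
  assumes L: "bundle_complex L" and l: "Linf_algebroid \<eta> L l a"
  shows "anchored_module.leibniz (scl L) (shift_component L) (\<lambda>d. a (d + 1)) (shifted l)"
    and "x \<in> shift_component L d \<Longrightarrow> shifted l [(d, x)] = differential L (d + 1) x"
proof -
  have a: "chain_map L (tangent_complex \<eta>) a" using l by (simp add: Linf_algebroid_def)
  interpret anchored_module "scl L" "shift_component L" "\<lambda>d. a (d + 1)"
    by (rule anchored_module_tangent[OF L a])
  have unary: "l [(d, x)] = differential L d x" if "x \<in> component L d" for d x
    using l that by (simp add: Linf_algebroid_def)
  show sunary: "shifted l [(d, x)] = differential L (d + 1) x" if "x \<in> shift_component L d" for d x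
    using unary[OF that] by (simp add: shifted_conv)
  have deg: "\<forall>n\<ge>1. has_degree L L n (2 - int n) l" and skew: "\<forall>n\<ge>1. graded_skew L n l"
    and lin2: "multilinear_over (range \<eta>) L L 2 l" and lin: "\<And>n. n > 2 \<Longrightarrow> multilinear_over UNIV L L n l"
    and leib: "\<And>d e x y r. x \<in> component L d \<Longrightarrow> y \<in> component L e \<Longrightarrow>
      l [(d, x), (e, scl L r y)] = scl L (a d x r) y + scl L r (l [(d, x), (e, y)])"
    using l by (auto simp: Linf_algebroid_def)
  have sym: "ops_symmetric (shift_component L) (shifted l)"
    by (rule ops_symmetric_shifted[OF skew])
  have front: "shifted l ((d, x) # vs) = signed (shift_exp (map fst (map up ((d, 0) # vs)))) (l ((d +
      1, x) # map up vs))"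
    for d x vs by (simp add: shifted_conv)
  have hom_up: "homogeneous L ((d + 1, x) # map up vs)" if "x \<in> shift_component L d"
      "hom (shift_component L) vs" for d x vs
    using that homogeneous_up[of L "(d, x) # vs"] by simp
  have dlin: "linear_on (scl L) (component L d) (scl L) (component L (d + 1)) (differential L d)" for d
    by (rule bundle_complexD(4)[OF L])
  show "leibniz (shifted l)"
    unfolding leibniz_def
  proof (intro conjI allI impI)
    show "ops_degree (shift_component L) (shift_component L) 1 (shifted l)"
      using ops_degree_shifted[OF deg bundle_complexD(6)[OF L]] by simp
    show "ops_symmetric (shift_component L) (shifted l)" by (rule sym)
    show "ops_additive (shift_component L) (shifted l)"
      unfolding ops_additive_def
    proof (intro allI impI)
      fix d x y vs assume xy: "x \<in> shift_component L d" "y \<in> shift_component L d" "hom (shift_component L) vs"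
      show "shifted l ((d, x + y) # vs) = shifted l ((d, x) # vs) + shifted l ((d, y) # vs)"
      proof (cases vs)
        case Nil
        have "x + y \<in> shift_component L d" using xy subspace_add[OF subspace_C] by blast
        then show ?thesis using xy Nil sunary dlin[of "d + 1"] by (auto simp: linear_on_def)
      next
        case (Cons z zs)
        have "\<exists>S. multilinear_over S L L (Suc (length (map up vs))) l"
          using lin2 lin[of "Suc (length vs)"] Cons by (cases zs) (auto simp: numeral_2_eq_2)
        then obtain S where "multilinear_over S L L (Suc (length (map up vs))) l" ..
        from multilinear_over_front(1)[OF this hom_up[OF xy(1,3)] refl xy(2)]
        have "l ((d + 1, x + y) # map up vs) = l ((d + 1, x) # map up vs) + l ((d + 1, y) # map up vs)" .
        then show ?thesis unfolding front by (simp add: signed_add)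
      qed
    qed
    fix d x vs r assume xv: "x \<in> shift_component L d" "hom (shift_component L) vs"
    have rx: "scl L r x \<in> shift_component L d" by (rule scale_mem[OF xv(1)])
    consider "vs = []" | z where "vs = [z]" | z w zs where "vs = z # w # zs" by (metis neq_Nil_conv)
    then show "shifted l ((d, scl L r x) # vs) = scl L r (shifted l ((d, x) # vs)) +
        scl L (signed d (anchor_ops (\<lambda>d. a (d + 1)) vs r)) x"
    proof cases
      case 1
      then show ?thesis using xv rx sunary dlin[of "d + 1"] by (auto simp: linear_on_def)
    next
      case (2 z)
      obtain e y where z: "z = (e, y)" by (cases z)
      have y: "y \<in> shift_component L e" using xv 2 z by simp
      have sw: "shifted l [(d, w), (e, y)] = signed (d * e + e + 1) (l [(e + 1, y), (d + 1, w)])"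
        if "w \<in> shift_component L d" for w
        using ops_symmetricD[OF sym, of "[]" "(d, w)" "(e, y)" "[]"]
            that y by (simp add: shifted_conv algebra_simps)
      \<comment> \<open>The two signs agree for \<open>e = -1\<close>; in all other degrees the
        anchor is zero.\<close>
      have "scl L (signed (d * e + e + 1) (a (e + 1) y r)) x = scl L (signed d (a (e + 1) y r)) x"
      proof (cases "e = -1")
        case False
        then show ?thesis using anchor_degree[OF y] by simp
      qed (auto intro!: arg_cong[where f = "\<lambda>r. scl L r x"] signed_cong)
      then show ?thesis
        using sw[OF rx] sw[OF xv(1)] leib[OF y xv(1)] 2 z
        by (simp add: signed_add scale_signed signed_scale add.commute)
    next
      case (3 z w zs)
      have "multilinear_over UNIV L L (Suc (length (map up vs))) l"
        by (rule lin) (simp add: 3)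
      from multilinear_over_front(2)[OF this hom_up[OF xv] refl UNIV_I]
      have "l ((d + 1, scl L r x) # map up vs) = scl L r (l ((d + 1, x) # map up vs))" .
      then show ?thesis unfolding front by (simp add: scale_signed 3)
    qed
  qed
qed

theorem theorem2p5:
  fixes \<eta> :: "'k::field_char_0 \<Rightarrow> 'r::comm_ring_1"
    and L' :: "('r, 'm::ab_group_add) module_complex"
    and L'' :: "('r, 'n::ab_group_add) module_complex"
    and f :: "int \<Rightarrow> 'm \<Rightarrow> 'n"
    and l'' :: "('n, 'n) ops"
    and a'' :: "int \<Rightarrow> 'n \<Rightarrow> 'r \<Rightarrow> 'r"
  assumes "affine_manifold TYPE('p) \<eta>"
    and "bundle_complex L'" and "bundle_complex L''"
    and "quasi_isomorphism L' L'' f"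
    and "Linf_algebroid \<eta> L'' l'' a''"
  shows "\<exists>l' a' F. Linf_algebroid \<eta> L' l' a' \<and>
           Linf_quasi_isomorphism L' l' a' L'' l'' a'' F \<and> extends_chain_map L' f F"
proof -
  note L' = assms(2) and L'' = assms(3) and qi = assms(4) and alg = assms(5)
  have \<eta>: "algebra_map \<eta>" using assms(1) by (simp add: affine_manifold_def)
  have cm: "chain_map L' L'' f" using qi by (simp add: quasi_isomorphism_def)
  have f: "linear_on (scl L') (component L' d) (scl L'') (component L'' d) (f d)"
    and f_differential: "x \<in> component L' d \<Longrightarrow> f (d + 1) (differential L' d x) =
        differential L'' d (f d x)" for d x
    using cm by (auto simp: chain_map_def)
  have f_mem: "f d x \<in> component L'' d" if "x \<in> component L' d" for d x
    using f[of d] that by (simp add: linear_on_def)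
  have a'': "chain_map L'' (tangent_complex \<eta>) a''" using alg by (simp add: Linf_algebroid_def)
  \<comment> \<open>Compatibility of the morphism with the anchors leaves no other choice on the
    components.\<close>
  define a' where "a' d x = a'' d (f d x)" for d x
  have a': "chain_map L' (tangent_complex \<eta>) a'"
    unfolding chain_map_def
  proof (intro conjI allI ballI)
    fix d
    show "linear_on (scl L') (component L' d) (scl (tangent_complex \<eta>)) (component (tangent_complex \<eta>)
        d) (a' d)"
      using f[of d] a'' by (auto simp: linear_on_def a'_def chain_map_def)
    fix x assume x: "x \<in> component L' d"
    show "a' (d + 1) (differential L' d x) = differential (tangent_complex \<eta>) d (a' d x)"
      using a'' f_mem[OF x] f_differential[OF x] by (simp add: a'_def chain_map_def)
  qed
  let ?C = "shift_component L'" and ?D = "shift_component L''"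
  let ?h = "shifted l''"
  interpret M: anchored_module "scl L'" ?C "\<lambda>d. a' (d + 1)" by (rule anchored_module_tangent[OF L' a'])
  interpret N: anchored_module "scl L''" ?D "\<lambda>d. a'' (d + 1)" by (rule anchored_module_tangent[OF L'' a''])
  have h: "N.leibniz ?h" and h_unary: "\<And>d y. y \<in> ?D d \<Longrightarrow> ?h [(d, y)] = differential L'' (d + 1) y"
    using Linf_algebroid_leibniz[OF L'' alg] by auto
  have h_flat: "compose_ops ?h 1 ?h ys = 0" if "hom ?D ys" "ys \<noteq> []" for ys
  proof -
    have "Linf_relations L'' l''" using alg by (simp add: Linf_algebroid_def)
    then show ?thesis
      using that by (simp add: Linf_relations_def shift_homogeneous_conv unshuffle_sum_conv)
  qed
  \<comment> \<open>The anchor kills boundaries, because the tangent complex has zero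
    differential.\<close>
  have h_anchor_unary: "a'' (-1 + 1) (?h [(-2, y)]) r = 0" if "y \<in> ?D (-2)" for y r
  proof -
    have "a'' (-1 + 1) (differential L'' (-1) y) = differential (tangent_complex \<eta>) (-1) (a'' (-1) y)"
      using a''[unfolded chain_map_def, THEN conjunct2, THEN spec, THEN bspec, of y "-1"] that by simp
    then show ?thesis using h_unary[OF that] by (simp add: tangent_complex_def)
  qed
  obtain n \<phi> b where basis: "dual_basis (scl L'') (?D (-1)) n \<phi> b"
    using bundle_complexD(7)[OF L''] by blast
  have h_anchor: "N.anchor_defect ?h ys r = 0" if "hom ?D ys" for ys r
    by (rule N.anchor_defect_flat[OF h h_flat h_anchor_unary basis that])
  obtain H where H: "contracts_cone L' L'' f H" using cone_contraction[OF L' L'' qi] ..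
  \<comment> \<open>Everything is read after the shift: a map in shifted degree \<open>d\<close> is
    the original one in degree \<open>d + 1\<close>.\<close>
  interpret homotopy_transfer "scl L'" ?C "\<lambda>d. a' (d + 1)" "scl L''" ?D "\<lambda>d. a'' (d + 1)"
    "\<lambda>d. differential L' (d + 1)" "\<lambda>d. f (d + 1)" ?h H
  proof
    show "y = 0" if "y + y = 0" for y :: 'm by (rule module_half[OF \<eta> M.module_axioms that])
    show "y = 0" if "y + y = 0" for y :: 'n by (rule module_half[OF \<eta> N.module_axioms that])
    show "N.leibniz ?h" by (rule h)
    show "compose_ops ?h 1 ?h ys = 0" if "hom ?D ys" "ys \<noteq> []" for ys by (rule h_flat[OF that])
    show "N.anchor_defect ?h ys r = 0" if "hom ?D ys" for ys r by (rule h_anchor[OF that])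
    show "linear_on (scl L') (?C d) (scl L') (?C (d + 1)) (differential L' (d + 1))" for d
      by (rule bundle_complexD(4)[OF L'])
    show "differential L' (d + 1 + 1) (differential L' (d + 1) x) = 0" if "x \<in> ?C d" for d x
      by (rule bundle_complexD(5)[OF L' that])
    show "linear_on (scl L') (?C d) (scl L'') (?D d) (f (d + 1))" for d by (rule f)
    show "f (d + 1 + 1) (differential L' (d + 1) x) = ?h [(d, f (d + 1) x)]" if "x \<in> ?C d" for d x
      using f_differential[OF that] h_unary f_mem[OF that] by simp
    show "a'' (d + 1) (f (d + 1) x) r = a' (d + 1) x r" for d x r by (simp add: a'_def)
    show "linear_on (\<lambda>r z. (scl L' r (fst z), scl L'' r (snd z))) (?C (d + 1) \<times> ?D d)
        (\<lambda>r z. (scl L' r (fst z), scl L'' r (snd z))) (?C d \<times> ?D (d - 1)) (H d)" for d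
      using H by (simp only: contracts_cone_def)
    fix x y d assume xy: "x \<in> ?C (d + 1)" "y \<in> ?D d"
    have "H d (x, y) \<in> ?C d \<times> ?D (d - 1)"
      using H xy unfolding contracts_cone_def linear_on_def by blast
    then have "?h [(d - 1, snd (H d (x, y)))] = differential L'' (d - 1 + 1) (snd (H d (x, y)))"
      by (intro h_unary) (simp add: mem_Times_iff)
    then show "(differential L' (d + 1) (fst (H d (x, y))), f (d + 1) (fst (H d (x, y)))
        - ?h [(d - 1, snd (H d (x, y)))]) +
        H (d + 1) (differential L' (d + 1 + 1) x, f (d + 1 + 1) x - ?h [(d, y)]) = (x, y)"
      using H xy h_unary[OF xy(2)] by (simp only: contracts_cone_def)
  qed
  have "\<forall>d. \<exists>p. dual_basis (scl L') (?C d) (fst p) (fst (snd p)) (snd (snd p))"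
    using bundle_complexD(7)[OF L'] by auto
  then obtain p where "\<And>d. dual_basis (scl L') (?C d) (fst (p d)) (fst (snd (p d))) (snd (snd (p d)))"
    by metis
  from M.leibniz_exists[OF this bundle_complexD(4)[OF L']] obtain q0 where
    q0: "M.leibniz q0" "\<And>d x. q0 [(d, x)] = differential L' (d + 1) x" by metis
  obtain q F where st: "\<And>n. transfer_state n q F"
    by (rule transfer_exists[OF q0(1)]) (use q0(2) in auto)
  have q: "M.leibniz q" and F: "ops_degree ?C ?D 0 F" "ops_symmetric ?C F" "ops_additive ?C F"
    and F_scale: "\<And>d x vs r. x \<in> ?C d \<Longrightarrow> hom ?C vs \<Longrightarrow> F ((d, scl L' r x) # vs) = scl L'' r (F ((d, x) # vs))"
    and unary: "\<And>d x. x \<in> ?C d \<Longrightarrow> q [(d, x)] = differential L' (d + 1) x" "\<And>d x. x \<in> ?C d \<Longrightarrow> F [(d, x)] =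
        f (d + 1) x"
    using st[of 0] by (auto simp: transfer_state_def)
  have flat: "compose_ops q 1 q ys = 0" "morphism_defect q ?h F ys = 0" if "hom ?C ys" "ys \<noteq> []" for ys
    using st[of "length ys"] that by (auto simp: transfer_state_def)
  have q_ops: "ops_degree ?C ?C 1 q" "ops_symmetric ?C q" "ops_additive ?C q"
    and q_scale: "\<And>d x vs r. x \<in> ?C d \<Longrightarrow> hom ?C vs \<Longrightarrow> q ((d, scl L' r x) # vs) =
        scl L' r (q ((d, x) # vs)) + scl L' (signed d (anchor_ops (\<lambda>d. a' (d + 1)) vs r)) x"
    using q by (auto simp: M.leibniz_def)
  define l' where "l' = unshifted q"
  define F' where "F' = unshifted F"
  have shifted: "shifted l' = q" "shifted F' = F" by (simp_all add: l'_def F'_def shifted_unshifted)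
  have F'_unary: "F' [(d, x)] = f d x" if "x \<in> component L' d" for d x
    using unary(2)[of x "d - 1"] that by (simp add: F'_def unshifted_def)
  have "Linf_algebroid \<eta> L' l' a'"
    unfolding Linf_algebroid_def
  proof (intro conjI allI ballI impI)
    show "l' [(d, x)] = differential L' d x" if "x \<in> component L' d" for d x
      using unary(1)[of x "d - 1"] that by (simp add: l'_def unshifted_def)
    show "has_degree L' L' n (2 - int n) l'" if "n \<ge> 1" for n
      unfolding l'_def by (rule has_degree_unshifted) (use q_ops(1) that bundle_complexD(6)[OF L'] in auto)
    show "graded_skew L' n l'" for n unfolding l'_def by (rule graded_skew_unshifted[OF q_ops(2)])
    show "multilinear_over (range \<eta>) L' L' 2 l'"
      unfolding l'_def
    proof (rule multilinear_over_unshifted[OF bundle_complexD(2)[OF L']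
        M.module_axioms M.module_axioms q_ops(2,3)])
      fix d x vs r assume x: "x \<in> ?C d" "hom ?C vs" "Suc (length vs) = 2" "r \<in> range \<eta>"
      then obtain z where z: "vs = [z]" by (cases vs) auto
      \<comment> \<open>Derivations kill constants, so the Leibniz term disappears for scalars from
        the ground field.\<close>
      have "a' (fst z + 1) (snd z) r = 0"
      proof (cases "fst z = -1")
        case True
        then have "a' (fst z + 1) (snd z) \<in> derivations \<eta>"
          using a'[unfolded chain_map_def linear_on_def, THEN conjunct1, THEN spec, of 0] x(2) z
          by (simp add: tangent_complex_def)
        then show ?thesis using derivation_constant[OF \<eta>] x(4) by auto
      next
        case False
        then show ?thesis using M.anchor_degree[of "snd z" "fst z" r] x(2) z by simp
      qed
      then show "q ((d, scl L' r x) # vs) = scl L' r (q ((d, x) # vs))"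
        using q_scale[OF x(1,2)] z by simp
    qed
    show "multilinear_over UNIV L' L' n l'" if n: "n > 2" for n
      unfolding l'_def
    proof (rule multilinear_over_unshifted[OF bundle_complexD(2)[OF L']
        M.module_axioms M.module_axioms q_ops(2,3)])
      fix d x vs r assume x: "x \<in> ?C d" "hom ?C vs" "Suc (length vs) = n"
      then obtain z w zs where "vs = z # w # zs" using n by (cases vs; cases "tl vs") auto
      then show "q ((d, scl L' r x) # vs) = scl L' r (q ((d, x) # vs))"
        using q_scale[OF x(1,2)] by simp
    qed
    show "Linf_relations L' l'"
      unfolding Linf_relations_def shift_homogeneous_conv unshuffle_sum_conv shifted using flat(1) by blast
    show "chain_map L' (tangent_complex \<eta>) a'" by (rule a')
    fix d e x y r assume xy: "x \<in> component L' d" "y \<in> component L' e"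
    have sw: "l' [(d, x), (e, w)] = signed (d + (d - 1) * (e - 1)) (q [(e - 1, w), (d - 1, x)])"
      if "w \<in> component L' e" for w
      using ops_symmetricD[OF q_ops(2), of "[]" "(d - 1, x)" "(e - 1, w)" "[]"] xy that
      by (simp add: l'_def unshifted_def algebra_simps)
    \<comment> \<open>The total exponent is even for \<open>d = 0\<close>, the only degree in which
      the anchor can be nonzero.\<close>
    have "scl L' (signed (d + (d - 1) * (e - 1)) (signed (e - 1) (a' d x r))) y = scl L' (a' d x r) y"
    proof (cases "d = 0")
      case False
      then show ?thesis using M.anchor_degree[of x "d - 1" r] xy by simp
    qed (auto intro!: arg_cong[where f = "\<lambda>r. scl L' r y"] signed_even)
    moreover have "scl L' r y \<in> component L' e" using M.scale_mem[of y "e - 1" r] xy by simp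
    ultimately show "l' [(d, x), (e, scl L' r y)] = scl L' (a' d x r) y + scl L' r (l' [(d, x), (e, y)])"
      using sw xy q_scale[of y "e - 1" "[(d - 1, x)]" r]
      by (simp add: signed_add M.scale_signed M.signed_scale)
  qed
  moreover have "Linf_quasi_isomorphism L' l' a' L'' l'' a'' F'"
    unfolding Linf_quasi_isomorphism_def Linf_morphism_def
  proof (intro conjI allI ballI impI)
    show "has_degree L' L'' n (1 - int n) F'" if "n \<ge> 1" for n
      unfolding F'_def by (rule has_degree_unshifted) (use F(1) that bundle_complexD(6)[OF L''] in auto)
    show "graded_skew L' n F'" for n unfolding F'_def by (rule graded_skew_unshifted[OF F(2)])
    show "multilinear_over UNIV L' L'' n F'" for n
      unfolding F'_def
      by (rule multilinear_over_unshifted[OF bundle_complexD(2)[OF L']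
          M.module_axioms N.module_axioms F(2,3) F_scale])
    show "unshuffle_sum (shifted F') (shifted l') xs = partition_sum (shifted l'') (shifted F') xs"
      if "xs \<noteq> [] \<and> shift_homogeneous L' xs" for xs
      using flat(2)[of xs] that
      by (simp add: unshuffle_sum_conv partition_sum_conv shifted shift_homogeneous_conv morphism_defect_def)
    have dL': "differential L' d x \<in> component L' (d + 1)" if "x \<in> component L' d" for d x
      using bundle_complexD(4)[OF L', of d] that by (simp add: linear_on_def)
    have L'_closed: "x + y \<in> component L' d" "scl L' r x \<in> component L' d"
      if "x \<in> component L' d" "y \<in> component L' d" for x y d r
      using M.subspace_add[OF bundle_complexD(2)[OF L']] M.subspace_scale[OF bundle_complexD(2)[OF L']]
          that by auto
    show cm': "chain_map L' L'' (\<lambda>d x. F' [(d, x)])"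
      using f f_differential dL' L'_closed by (simp add: chain_map_def linear_on_def F'_unary)
    show "a'' d (F' [(d, x)]) = a' d x" if "x \<in> component L' d" for d x
      by (simp add: F'_unary[OF that] a'_def)
    show "quasi_isomorphism L' L'' (\<lambda>d x. F' [(d, x)])"
      using qi cm' unfolding quasi_isomorphism_def by (simp add: F'_unary cong: bex_cong)
  qed
  moreover have "extends_chain_map L' f F'"
    using F'_unary by (simp add: extends_chain_map_def)
  ultimately show ?thesis by blast
qed

end
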